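(* Let $0<p,q<\infty$ and $\alpha>-1$, and let $\{X_n\}_{n\ge1}$ be a standard random sequence. Then $\mathcal{R}f\in\mathcal{A}^q_\alpha$ almost surely for each $f\in\mathscr{H}^p$ if and only if $p\geq2$.
   Context: A standard random sequence $\{X_n\}$ is a sequence of independent identically distributed random variables on a probability space, all of one of the following three types: Bernoulli ($\mathbb{P}(X_n=1)=\mathbb{P}(X_n=-1)=1/2$), Steinhaus (uniformly distributed on the unit circle), or Gaussian $N(0,1)$ (zero mean, unit variance). For $\theta\in\mathbb{R}$ let $\mathbb{C}_\theta=\{s\in\mathbb{C}:\Re s>\theta\}$. $\mathcal{D}$ is the space of Dirichlet series $\sum_{n\ge1}a_nn^{-s}$ ($a_n\in\mathbb{C}$) converging on some half plane $\mathbb{C}_\theta$, and $\mathcal{P}$ is the space of Dirichlet polynomials $\sum_{n=1}^Na_nn^{-s}$. For $f(s)=\sum_{n\ge1}a_nn^{-s}$ in $\mathcal{D}$, the randomization is $\mathcal{R}f(s)=\sum_{n\ge1}a_nX_nn^{-s}$. Let $p_j$ be the $j$th prime and write $n=\prod_j p_j^{\nu_j(n)}$. The Bohr lift of $P(s)=\sum_{n=1}^N a_nn^{-s}$ is $\mathscr{B}P(z)=\sum_{n=1}^N a_nz^{\nu(n)}$, where $z=(z_1,z_2,\dots)$ and $z^{\nu(n)}=\prod_jz_j^{\nu_j(n)}$. For $0<p<\infty$, $\mathscr{H}^p$ is the completion of $\mathcal{P}$ with respect to the (quasi-)norm $\|P\|_{\mathscr{H}^p}=\left(\int_{\mathbb{T}^\infty}|\mathscr{B}P(z)|^p\,dm_\infty(z)\right)^{1/p}$,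 where $m_\infty$ is the Haar probability measure on the infinite torus $\mathbb{T}^\infty$. For $\sigma\ge0$, $P_\sigma(s)=P(s+\sigma)$. For $0<q<\infty$ and $\alpha>-1$, the Bergman space $\mathcal{A}^q_\alpha$ is the completion of $\mathcal{P}$ with respect to the (quasi-)norm $\|P\|_{\mathcal{A}^q_\alpha}=\left(\int_0^{+\infty}\|P_\sigma\|_{\mathscr{H}^q}^q\,d\mu_\alpha(\sigma)\right)^{1/q}$, where $d\mu_\alpha(\sigma)=\frac{2^{\alpha+1}}{\Gamma(\alpha+1)}\sigma^\alpha e^{-2\sigma}d\sigma$. Elements of $\mathscr{H}^p$ and $\mathcal{A}^q_\alpha$ are identified with Dirichlet series in $\mathcal{D}$ converging on $\mathbb{C}_{1/2}$. *)

theory Defs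
  imports "HOL-Probability.Probability" "HOL-Computational_Algebra.Primes"
begin

text \<open>
  A Dirichlet series \<open>\<Sum>n\<ge>1. a\<^sub>n n\<^sup>-\<^sup>s\<close> is represented by its coefficient function
  \<open>a :: nat \<Rightarrow> complex\<close>; the value \<open>a 0\<close> is irrelevant and is ignored throughout.
\<close>

type_synonym dseries = "nat \<Rightarrow> complex"

text \<open>The term for \<open>n = 0\<close> vanishes, since \<open>0 powr z = 0\<close>.\<close>

definition converges_on_half_plane :: "dseries \<Rightarrow> real \<Rightarrow> bool" where
  "converges_on_half_plane a \<theta> \<longleftrightarrow>
     (\<forall>s. Re s > \<theta> \<longrightarrow> summable (\<lambda>n. a n * of_nat n powr (- s)))"

definition dirichlet_polynomials :: "dseries set" where
  "dirichlet_polynomials = {a. finite {n. a n \<noteq> 0}}"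

definition translate :: "real \<Rightarrow> dseries \<Rightarrow> dseries" where
  "translate \<sigma> a = (\<lambda>n. a n * of_nat n powr (- complex_of_real \<sigma>))"

text \<open>Primes are enumerated from index \<open>0\<close>.\<close>

definition nth_prime :: "nat \<Rightarrow> nat" where
  "nth_prime j = enumerate {p. prime p} j"

definition bohr_monomial :: "nat \<Rightarrow> (nat \<Rightarrow> complex) \<Rightarrow> complex" where
  "bohr_monomial n z = (\<Prod>j | nth_prime j dvd n. z j ^ multiplicity (nth_prime j) n)"

definition bohr_lift :: "dseries \<Rightarrow> (nat \<Rightarrow> complex) \<Rightarrow> complex" where
  "bohr_lift a z = (\<Sum>n | n \<ge> 1 \<and> a n \<noteq> 0. a n * bohr_monomial n z)"

text \<open>
  Normalized arc length on the unit circle, as a Borel measure on the complex plane. The Haar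
  probability measure of the infinite torus is its countable product.
\<close>

definition circle_measure :: "complex measure" where
  "circle_measure = distr (uniform_measure lborel {0..<2 * pi}) borel cis"

definition torus_measure :: "(nat \<Rightarrow> complex) measure" where
  "torus_measure = (\<Pi>\<^sub>M j\<in>UNIV. circle_measure)"

text \<open>The two (quasi-)norms below are meant for Dirichlet polynomials only.\<close>

definition hardy_norm :: "real \<Rightarrow> dseries \<Rightarrow> real" where
  "hardy_norm p a = (LINT z|torus_measure. norm (bohr_lift a z) powr p) powr (1 / p)"

definition bergman_measure :: "real \<Rightarrow> real measure" where
  "bergman_measure \<alpha> = density lborel (\<lambda>\<sigma>. ennreal
     (indicator {0<..} \<sigma> * (2 powr (\<alpha> + 1) / Gamma (\<alpha> + 1) * \<sigma> powr \<alpha> * exp (- 2 * \<sigma>))))"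

definition bergman_norm :: "real \<Rightarrow> real \<Rightarrow> dseries \<Rightarrow> real" where
  "bergman_norm q \<alpha> a =
     (LINT \<sigma>|bergman_measure \<alpha>. hardy_norm q (translate \<sigma> a) powr q) powr (1 / q)"

text \<open>
  The completion of the Dirichlet polynomials with respect to a (quasi-)norm \<open>N\<close>, realized as a
  set of Dirichlet series converging for \<open>Re s > 1/2\<close>: the element of the completion given by an
  \<open>N\<close>-Cauchy sequence of polynomials is identified with the series whose coefficients are the
  limits of the coefficients of these polynomials.
\<close>

definition dirichlet_completion :: "(dseries \<Rightarrow> real) \<Rightarrow> dseries set" where
  "dirichlet_completion N = {a. converges_on_half_plane a (1 / 2) \<and>
     (\<exists>P :: nat \<Rightarrow> dseries.
        (\<forall>k. P k \<in> dirichlet_polynomials) \<and>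
        (\<forall>\<epsilon>>0. \<exists>K. \<forall>j\<ge>K. \<forall>k\<ge>K. N (\<lambda>n. P j n - P k n) < \<epsilon>) \<and>
        (\<forall>n\<ge>1. (\<lambda>k. P k n) \<longlonglongrightarrow> a n))}"

definition hardy_space :: "real \<Rightarrow> dseries set" where
  "hardy_space p = dirichlet_completion (hardy_norm p)"

definition bergman_space :: "real \<Rightarrow> real \<Rightarrow> dseries set" where
  "bergman_space q \<alpha> = dirichlet_completion (bergman_norm q \<alpha>)"

text \<open>All random variables are complex-valued; Bernoulli and Gaussian ones are real a.s.\<close>

definition bernoulli_rv :: "'w measure \<Rightarrow> ('w \<Rightarrow> complex) \<Rightarrow> bool" where
  "bernoulli_rv M Y \<longleftrightarrow> Y \<in> borel_measurable M \<and>
     measure M {\<omega> \<in> space M. Y \<omega> = 1} = 1 / 2 \<and> measure M {\<omega> \<in> space M. Y \<omega> = -1} = 1 / 2"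

definition steinhaus_rv :: "'w measure \<Rightarrow> ('w \<Rightarrow> complex) \<Rightarrow> bool" where
  "steinhaus_rv M Y \<longleftrightarrow> Y \<in> borel_measurable M \<and> distr M borel Y = circle_measure"

definition gaussian_rv :: "'w measure \<Rightarrow> ('w \<Rightarrow> complex) \<Rightarrow> bool" where
  "gaussian_rv M Y \<longleftrightarrow> Y \<in> borel_measurable M \<and>
     distr M borel Y = distr (density lborel (\<lambda>x. ennreal (std_normal_density x))) borel complex_of_real"

definition standard_random_sequence :: "'w measure \<Rightarrow> (nat \<Rightarrow> 'w \<Rightarrow> complex) \<Rightarrow> bool" where
  "standard_random_sequence M X \<longleftrightarrow>
     prob_space M \<and> prob_space.indep_vars M (\<lambda>_. borel) X {1..} \<and>
     ((\<forall>n\<ge>1. bernoulli_rv M (X n)) \<or> (\<forall>n\<ge>1. steinhaus_rv M (X n)) \<or> (\<forall>n\<ge>1. gaussian_rv M (X n)))"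

definition randomize :: "(nat \<Rightarrow> 'w \<Rightarrow> complex) \<Rightarrow> 'w \<Rightarrow> dseries \<Rightarrow> dseries" where
  "randomize X \<omega> a = (\<lambda>n. a n * X n \<omega>)"

end

theory Submission
  imports Defs "HOL-Complex_Analysis.Complex_Analysis" "HOL-Computational_Algebra.Fundamental_Theorem_Algebra"
    "HOL-Computational_Algebra.Squarefree" "HOL-Library.Discrete_Functions" "HOL-Real_Asymp.Real_Asymp"
begin

text \<open>
  If \<open>p \<ge> 2\<close>, then a series in the Hardy space has square summable coefficients by orthogonality of the
  monomials on the torus. The random variables are subgaussian, so Khinchine's inequality bounds the
  expected Bergman norm of a random block by the \<open>\<ell>\<^sup>2\<close> norm of its coefficients, and a sparse
  subsequence of the partial sums is almost surely a Cauchy sequence.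

  If \<open>p < 2\<close>, then \<open>1 + w\<close> has a smaller norm in \<open>L\<^sup>p\<close> than in \<open>L\<^sup>2\<close> on the circle. Hence the products
  \<open>(z\<^sub>0 + z\<^sub>1) (z\<^sub>2 + z\<^sub>3) \<dots>\<close> of \<open>m\<close> factors have an \<open>L\<^sup>2\<close> norm that is larger than the \<open>L\<^sup>p\<close> norm by a
  factor exponential in \<open>m\<close>, and a geometrically weighted sum of them lies in the Hardy space. After
  randomization only \<open>\<ell>\<^sup>2\<close> norms matter. If \<open>\<sigma>\<close> is at most a small multiple of \<open>1 / log p\<^sub>2\<^sub>m\<close>, then the
  translation by \<open>\<sigma>\<close> does not destroy the exponential gain, while the measure of this range of \<open>\<sigma>\<close> is
  only polynomially small in \<open>m\<close>. A single product is isolated from the whole series by extracting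
  one coefficient along suitable one-parameter curves in the torus. This is possible for every
  \<open>q > 0\<close>, with a loss that is polynomial in the degree, since \<open>|P|\<^sup>q\<close> is subharmonic for analytic
  polynomials \<open>P\<close>.
\<close>

subsection \<open>The circle and the infinite torus\<close>

text \<open>An element of a completion is known only through the limits of its coefficients, so a
  lower bound for its norm has to be read off from finitely many coefficients by an operation that
  is continuous in the quasi-norm. Selecting the \<open>n\<close> of a fixed \<open>weight\<close>
  is such an operation: each level is finite because the weights of the primes tend to infinity, and
  the factor \<open>M + 1\<close> is harmless because the weight of a product of \<open>m\<close>
  factors grows only quadratically in \<open>m\<close>.

  Almost sure membership yields only a random finite bound for these projections. Instead of a
  closed graph argument or a zero-one law, the bound is made uniform on an event of probability
  close to one, and the lower Khinchine inequality is proved for integrals restricted to such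
  events.

  Two strict conditions on the ratio \<beta> of the weights drive the counterexample:
  \<open>\<beta> powr p * pair_moment p\<close> is below 1, while \<open>2 * \<beta>\<^sup>2\<close>
  is above 1. The strictness pays for the geometric weights that replace the triangle inequality and
  for the factor lost by the translation.\<close>

lemma sets_circle_measure [simp, measurable_cong]: "sets circle_measure = sets borel"
  by (simp add: circle_measure_def)

lemma space_circle_measure [simp]: "space circle_measure = UNIV"
  by (simp add: circle_measure_def)

lemma measurable_cis [measurable]: "cis \<in> borel_measurable borel"
  by (intro borel_measurable_continuous_onI continuous_intros)

lemma borel_measurable_cnj [measurable (raw)]:
  "f \<in> borel_measurable M \<Longrightarrow> (\<lambda>x. cnj (f x)) \<in> borel_measurable M"
  by (rule borel_measurable_continuous_on[OF continuous_on_cnj[OF continuous_on_id]])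

lemma nn_integral_circle:
  assumes [measurable]: "f \<in> borel_measurable borel"
  shows "(\<integral>\<^sup>+w. f w \<partial>circle_measure) =
    (\<integral>\<^sup>+\<theta>. f (cis \<theta>) * indicator {0..<2 * pi} \<theta> \<partial>lborel) / ennreal (2 * pi)"
  unfolding circle_measure_def
  by (subst nn_integral_distr) (auto simp: nn_integral_uniform_measure)

lemma prob_space_circle: "prob_space circle_measure"
  unfolding circle_measure_def
  by (intro prob_space.prob_space_distr prob_space_uniform_measure) (auto simp: measurable_cis)

lemma AE_circle: "AE w in circle_measure. norm w = 1"
  unfolding circle_measure_def by (subst AE_distr_iff) auto

lemma nn_integral_lborel_shift:
  fixes f :: "real \<Rightarrow> ennreal"
  assumes [measurable]: "f \<in> borel_measurable borel"
  shows "(\<integral>\<^sup>+x. f (x + t) \<partial>lborel) = (\<integral>\<^sup>+x. f x \<partial>lborel)"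
  using nn_integral_real_affine[of f 1 t] by (simp add: add.commute)

text \<open>Rotation by \<open>cis t\<close> shifts the period interval to
  \<open>{t..<2 * pi + t}\<close>. The part beyond \<open>2 * pi\<close> is moved back by a full
  period and fills the missing \<open>{0..<t}\<close>.\<close>

lemma nn_integral_circle_rotate:
  assumes [measurable]: "f \<in> borel_measurable borel" and u: "norm u = 1"
  shows "(\<integral>\<^sup>+w. f (u * w) \<partial>circle_measure) = (\<integral>\<^sup>+w. f w \<partial>circle_measure)"
proof -
  obtain t where t: "0 \<le> t" "t < 2 * pi" "u = cis t"
    using that[of "Arg2pi u"] Arg2pi[of u] u by (simp add: cis_conv_exp is_Arg_def)
  define g where "g \<theta> = f (cis \<theta>)" for \<theta>
  have [measurable]: "g \<in> borel_measurable borel"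
    unfolding g_def by measurable
  have per: "g (\<theta> + 2 * pi) = g \<theta>" for \<theta>
    by (simp add: g_def cis.ctr)
  have "(\<integral>\<^sup>+\<theta>. f (u * cis \<theta>) * indicator {0..<2 * pi} \<theta> \<partial>lborel)
      = (\<integral>\<^sup>+\<theta>. g (\<theta> + t) * indicator {t..<2 * pi + t} (\<theta> + t) \<partial>lborel)"
    by (intro nn_integral_cong) (auto simp: g_def t cis_mult add.commute indicator_def)
  also have "\<dots> = (\<integral>\<^sup>+\<theta>. g \<theta> * indicator {t..<2 * pi + t} \<theta> \<partial>lborel)"
    by (rule nn_integral_lborel_shift) measurable
  also have "\<dots> = (\<integral>\<^sup>+\<theta>. g \<theta> * indicator {t..<2 * pi} \<theta> + g \<theta> * indicator {2 * pi..<2 * pi + t} \<theta> \<partial>lborel)"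
    using t by (intro nn_integral_cong) (auto simp: indicator_def)
  also have "\<dots> = (\<integral>\<^sup>+\<theta>. g \<theta> * indicator {t..<2 * pi} \<theta> \<partial>lborel)
      + (\<integral>\<^sup>+\<theta>. g \<theta> * indicator {2 * pi..<2 * pi + t} \<theta> \<partial>lborel)"
    by (intro nn_integral_add) measurable
  also have "(\<integral>\<^sup>+\<theta>. g \<theta> * indicator {2 * pi..<2 * pi + t} \<theta> \<partial>lborel)
      = (\<integral>\<^sup>+\<theta>. g (\<theta> + 2 * pi) * indicator {2 * pi..<2 * pi + t} (\<theta> + 2 * pi) \<partial>lborel)"
    by (rule nn_integral_lborel_shift[symmetric]) measurable
  also have "\<dots> = (\<integral>\<^sup>+\<theta>. g \<theta> * indicator {0..<t} \<theta> \<partial>lborel)"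
    by (intro nn_integral_cong) (auto simp: per indicator_def)
  also have "(\<integral>\<^sup>+\<theta>. g \<theta> * indicator {t..<2 * pi} \<theta> \<partial>lborel) + \<dots>
     = (\<integral>\<^sup>+\<theta>. g \<theta> * indicator {t..<2 * pi} \<theta> + g \<theta> * indicator {0..<t} \<theta> \<partial>lborel)"
    by (intro nn_integral_add[symmetric]) measurable
  also have "\<dots> = (\<integral>\<^sup>+\<theta>. f (cis \<theta>) * indicator {0..<2 * pi} \<theta> \<partial>lborel)"
    using t by (intro nn_integral_cong) (auto simp: indicator_def g_def)
  finally show ?thesis
    by (simp add: nn_integral_circle)
qed

lemma distr_circle_rotate:
  assumes u: "norm u = 1"
  shows "distr circle_measure borel (\<lambda>w. u * w) = circle_measure"
proof (rule measure_eqI)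
  fix A assume "A \<in> sets (distr circle_measure borel (\<lambda>w. u * w))"
  then have A [measurable]: "A \<in> sets borel" by simp
  have "emeasure (distr circle_measure borel (\<lambda>w. u * w)) A
    = (\<integral>\<^sup>+w. indicator A w \<partial>distr circle_measure borel (\<lambda>w. u * w))"
    by simp
  also have "\<dots> = (\<integral>\<^sup>+w. indicator A (u * w) \<partial>circle_measure)"
    by (rule nn_integral_distr) measurable
  also have "\<dots> = (\<integral>\<^sup>+w. indicator A w \<partial>circle_measure)"
    by (rule nn_integral_circle_rotate[OF _ u]) simp
  finally show "emeasure (distr circle_measure borel (\<lambda>w. u * w)) A = emeasure circle_measure A"
    by simp
qed simp

section \<open>Haar measure of the infinite torus and its invariance under rotations\<close>

interpretation torus: product_prob_space "\<lambda>_::nat. circle_measure" UNIV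
  by (intro product_prob_spaceI prob_space_circle)

lemma sets_torus_measure [measurable_cong]: "sets torus_measure = sets (\<Pi>\<^sub>M j\<in>UNIV. borel)"
  unfolding torus_measure_def by (intro sets_PiM_cong) auto

lemma space_torus_measure [simp]: "space torus_measure = UNIV"
  by (simp add: torus_measure_def space_PiM)

lemma prob_space_torus: "prob_space torus_measure"
  unfolding torus_measure_def by (rule torus.prob_space_axioms)

lemma AE_torus: "AE z in torus_measure. \<forall>j. norm (z j) = 1"
proof -
  have "AE z in torus_measure. norm (z j) = 1" for j
    unfolding torus_measure_def
    by (rule torus.AE_component) (auto simp: AE_circle)
  then show ?thesis by (simp add: AE_all_countable)
qed

lemma measurable_rotate_torus:
  "(\<lambda>z j. u j * z j) \<in> torus_measure \<rightarrow>\<^sub>M torus_measure"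
  unfolding torus_measure_def
  by (rule measurable_PiM_single') (auto simp: space_PiM)

text \<open>A rotation acts coordinatewise, so the preimage of a finite-dimensional box is again a
  box, with sides of unchanged measure, and boxes determine the product measure.\<close>

lemma distr_torus_rotate:
  assumes "\<And>j. norm (u j) = 1"
  shows "distr torus_measure torus_measure (\<lambda>z j. u j * z j) = torus_measure"
proof -
  have "distr torus_measure torus_measure (\<lambda>z j. u j * z j) = (\<Pi>\<^sub>M j\<in>UNIV. circle_measure)"
  proof (rule torus.PiM_eq)
    fix J :: "nat set" and F :: "nat \<Rightarrow> complex set"
    assume J: "finite J" and F: "\<And>j. j \<in> J \<Longrightarrow> F j \<in> sets circle_measure"
    let ?E = "\<lambda>F. prod_emb UNIV (\<lambda>_. circle_measure) J (\<Pi>\<^sub>E j\<in>J. F j)"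
    have F': "(\<lambda>w. u j * w) -` F j \<in> sets circle_measure" if "j \<in> J" for j
      using measurable_sets[of "(\<lambda>w. u j * w)" borel borel "F j"] F[OF that] by auto
    have eq: "emeasure circle_measure ((\<lambda>w. u j * w) -` F j) = emeasure circle_measure (F j)" if "j \<in> J" for j
      using emeasure_distr[of "\<lambda>w. u j * w" circle_measure borel "F j"] F[OF that]
      by (simp add: distr_circle_rotate assms)
    have "?E F \<in> sets torus_measure"
      unfolding torus_measure_def using J F by (intro sets_PiM_I) auto
    then have "emeasure (distr torus_measure torus_measure (\<lambda>z j. u j * z j)) (?E F)
        = emeasure torus_measure ((\<lambda>z j. u j * z j) -` ?E F \<inter> space torus_measure)"
      by (intro emeasure_distr measurable_rotate_torus)
    also have "(\<lambda>z j. u j * z j) -` ?E F \<inter> space torus_measure = ?E (\<lambda>j. (\<lambda>w. u j * w) -` F j)"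
      by (auto simp: prod_emb_def PiE_iff)
    also have "emeasure torus_measure \<dots> = (\<Prod>j\<in>J. emeasure circle_measure ((\<lambda>w. u j * w) -` F j))"
      unfolding torus_measure_def using J F' by (intro torus.emeasure_PiM_emb) auto
    also have "\<dots> = (\<Prod>j\<in>J. emeasure circle_measure (F j))"
      by (intro prod.cong) (auto simp: eq)
    finally show "emeasure (distr torus_measure torus_measure (\<lambda>z j. u j * z j)) (?E F)
       = (\<Prod>j\<in>J. emeasure circle_measure (F j))" .
  qed (simp add: torus_measure_def)
  then show ?thesis by (simp add: torus_measure_def)
qed

lemma nn_integral_torus_rotate:
  assumes "h \<in> borel_measurable torus_measure" and u: "\<And>j. norm (u j) = 1"
  shows "(\<integral>\<^sup>+z. h (\<lambda>j. u j * z j) \<partial>torus_measure) = (\<integral>\<^sup>+z. h z \<partial>torus_measure)"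
proof -
  have "(\<integral>\<^sup>+z. h z \<partial>distr torus_measure torus_measure (\<lambda>z j. u j * z j))
      = (\<integral>\<^sup>+z. h (\<lambda>j. u j * z j) \<partial>torus_measure)"
    by (rule nn_integral_distr[OF measurable_rotate_torus]) (simp only: assms measurable_distr_eq1)
  then show ?thesis
    by (simp only: distr_torus_rotate[OF u])
qed

lemma integral_torus_rotate:
  fixes h :: "(nat \<Rightarrow> complex) \<Rightarrow> complex"
  assumes "h \<in> borel_measurable torus_measure" and u: "\<And>j. norm (u j) = 1"
  shows "(LINT z|torus_measure. h (\<lambda>j. u j * z j)) = (LINT z|torus_measure. h z)"
proof -
  have "(LINT z|distr torus_measure torus_measure (\<lambda>z j. u j * z j). h z)
      = (LINT z|torus_measure. h (\<lambda>j. u j * z j))"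
    by (rule integral_distr[OF measurable_rotate_torus assms(1)])
  then show ?thesis
    by (simp only: distr_torus_rotate[OF u])
qed

subsection \<open>Coefficients of analytic polynomials\<close>

text \<open>This is the mean value property, that is, Cauchy's formula at the centre. The majorant
  \<open>g\<close> only has to be measurable, since the right-hand side may be infinite.\<close>

lemma norm_holomorphic_le_nn_integral_circle:
  fixes g :: "complex \<Rightarrow> real"
  assumes f: "f holomorphic_on cball 0 1"
    and [measurable]: "g \<in> borel_measurable borel"
    and g: "\<And>w. norm w = 1 \<Longrightarrow> norm (f w) \<le> g w"
  shows "ennreal (norm (f 0)) \<le> (\<integral>\<^sup>+w. ennreal (g w) \<partial>circle_measure)"
proof -
  have "((\<lambda>u. f u / (u - 0)) has_contour_integral (2 * of_real pi * \<i> * f 0)) (circlepath 0 1)"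
    by (rule Cauchy_integral_circlepath_simple[OF f]) simp
  then have i: "((\<lambda>t. f (cis t) * \<i>) has_integral (2 * of_real pi * \<i> * f 0)) {0..2 * pi}"
    unfolding circlepath_def by (subst (asm) has_contour_integral_part_circlepath_iff) auto
  \<comment> \<open>With \<open>u = cis t\<close> one has \<open>du / u = \<i> dt\<close>;
    multiplication by \<open>- \<i>\<close> removes this factor.\<close>
  have I: "((\<lambda>t. f (cis t)) has_integral (2 * of_real pi * f 0)) {0..2 * pi}"
  proof -
    have "f (cis t) * \<i> * - \<i> = f (cis t)" for t
      by (simp add: mult.assoc)
    moreover have "2 * of_real pi * \<i> * f 0 * - \<i> = 2 * of_real pi * f 0"
      by (simp add: algebra_simps)
    ultimately show ?thesis
      using has_integral_mult_left[OF i, of "- \<i>"] by (simp only:)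
  qed
  have cont: "continuous_on {0..2 * pi} (\<lambda>t. norm (f (cis t)))"
    by (intro continuous_on_norm continuous_on_compose2[OF holomorphic_on_imp_continuous_on[OF f]]
        continuous_intros) auto
  define J where "J = integral {0..2 * pi} (\<lambda>t. norm (f (cis t)))"
  have J: "((\<lambda>t. norm (f (cis t))) has_integral J) {0..2 * pi}"
    unfolding J_def by (rule integrable_integral[OF integrable_continuous_real[OF cont]])
  have "norm (2 * of_real pi * f 0) \<le> J"
    unfolding integral_unique[OF I, symmetric] J_def
    by (rule integral_norm_bound_integral[OF has_integral_integrable[OF I] has_integral_integrable[OF J]])
      simp
  then have *: "norm (f 0) \<le> J / (2 * pi)"
    by (simp add: norm_mult field_simps)
  have J0: "0 \<le> J"
    by (rule has_integral_nonneg[OF J]) simp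
  have "ennreal J = (\<integral>\<^sup>+t. indicator {0..2 * pi} t * norm (f (cis t)) \<partial>lborel)"
    by (rule nn_integral_has_integral_lebesgue[OF _ J, symmetric]) auto
  also have "\<dots> \<le> (\<integral>\<^sup>+t. ennreal (g (cis t)) * indicator {0..<2 * pi} t \<partial>lborel)"
  proof (rule nn_integral_mono_AE, use AE_lborel_singleton[of "2 * pi"] in eventually_elim)
    fix t :: real assume "t \<noteq> 2 * pi"
    then show "ennreal (indicator {0..2 * pi} t * norm (f (cis t)))
        \<le> ennreal (g (cis t)) * indicator {0..<2 * pi} t"
      using g[of "cis t"] by (auto simp: indicator_def ennreal_leI)
  qed
  finally have "ennreal J / ennreal (2 * pi) \<le> (\<integral>\<^sup>+w. ennreal (g w) \<partial>circle_measure)"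
    by (simp add: nn_integral_circle divide_right_mono_ennreal)
  then show ?thesis
    using * J0 by (simp add: divide_ennreal) (meson ennreal_leI order_trans)
qed

lemma measurable_norm_poly_powr [measurable]:
  "(\<lambda>w::complex. norm (poly p w) powr q) \<in> borel_measurable borel"
proof -
  have [measurable]: "poly p \<in> borel_measurable borel"
    by (intro borel_measurable_continuous_onI continuous_intros)
  show ?thesis by measurable
qed

text \<open>Since \<open>norm (\<gamma> i) < 1\<close>, every \<open>1 - \<gamma> i * w\<close>
  stays in the right half plane on the closed disc. Hence \<open>f\<close> is a holomorphic branch
  of the \<open>q\<close>-th power of the product; it equals 1 at the origin, and the mean value
  property applies.\<close>

lemma nn_integral_prod_powr_ge_1_strict:
  fixes \<gamma> :: "nat \<Rightarrow> complex"
  assumes "\<And>i. i < d \<Longrightarrow> norm (\<gamma> i) < 1"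
  shows "1 \<le> (\<integral>\<^sup>+w. ennreal (\<Prod>i<d. norm (1 - \<gamma> i * w) powr q) \<partial>circle_measure)"
proof -
  define f where "f w = exp (of_real q * (\<Sum>i<d. Ln (1 - \<gamma> i * w)))" for w
  have pos: "0 < Re (1 - \<gamma> i * w)" if "i < d" "norm w \<le> 1" for i w
  proof -
    have "norm (\<gamma> i * w) < 1"
      using assms[OF that(1)] that(2) mult_left_le[of "norm w" "norm (\<gamma> i)"]
      by (simp add: norm_mult)
    then show ?thesis using complex_Re_le_cmod[of "\<gamma> i * w"] by simp
  qed
  have "f holomorphic_on cball 0 1"
    unfolding f_def
    by (intro holomorphic_intros) (use pos in \<open>fastforce simp: complex_nonpos_Reals_iff\<close>)
  moreover have "norm (f w) = (\<Prod>i<d. norm (1 - \<gamma> i * w) powr q)" if "norm w = 1" for w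
  proof -
    have nz: "1 - \<gamma> i * w \<noteq> 0" if "i < d" for i
      using pos[OF that, of w] \<open>norm w = 1\<close> by (auto simp del: minus_complex.sel)
    have "norm (f w) = (\<Prod>i<d. exp (q * Re (Ln (1 - \<gamma> i * w))))"
      by (simp add: f_def sum_distrib_left exp_sum prod_norm[symmetric])
    also have "\<dots> = (\<Prod>i<d. norm (1 - \<gamma> i * w) powr q)"
      using nz by (intro prod.cong) (auto simp: powr_def)
    finally show ?thesis .
  qed
  ultimately have "ennreal (norm (f 0)) \<le> (\<integral>\<^sup>+w. ennreal (\<Prod>i<d. norm (1 - \<gamma> i * w) powr q) \<partial>circle_measure)"
    by (intro norm_holomorphic_le_nn_integral_circle) (auto intro!: borel_measurable_prod)
  then show ?thesis by (simp add: f_def)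
qed

text \<open>Zeros on the circle itself are reached by shrinking: \<open>t n * \<gamma> i\<close>
  with \<open>t n\<close> increasing to 1 satisfies the strict hypothesis, and
  \<open>2 powr q\<close> per factor gives a dominating constant.\<close>

lemma nn_integral_prod_powr_ge_1:
  fixes \<gamma> :: "nat \<Rightarrow> complex"
  assumes \<gamma>: "\<And>i. i < d \<Longrightarrow> norm (\<gamma> i) \<le> 1" and q: "0 < q"
  shows "1 \<le> (\<integral>\<^sup>+w. ennreal (\<Prod>i<d. norm (1 - \<gamma> i * w) powr q) \<partial>circle_measure)"
proof -
  define t where "t n = 1 - inverse (real (Suc n))" for n
  have t: "0 \<le> t n" "t n < 1" for n
    by (auto simp: t_def field_simps)
  have t_lim: "t \<longlonglongrightarrow> 1"
    unfolding t_def using tendsto_diff[OF tendsto_const LIMSEQ_inverse_real_of_nat] by simp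
  have "(\<lambda>n. \<integral>\<^sup>+w. ennreal (\<Prod>i<d. norm (1 - (of_real (t n) * \<gamma> i) * w) powr q) \<partial>circle_measure)
      \<longlonglongrightarrow> (\<integral>\<^sup>+w. ennreal (\<Prod>i<d. norm (1 - \<gamma> i * w) powr q) \<partial>circle_measure)"
  proof (rule nn_integral_dominated_convergence[where w = "\<lambda>_. ennreal (\<Prod>i<d. 2 powr q)"])
    show "AE w in circle_measure. ennreal (\<Prod>i<d. norm (1 - (of_real (t n) * \<gamma> i) * w) powr q)
        \<le> ennreal (\<Prod>i<d. 2 powr q)" for n
      using AE_circle
    proof eventually_elim
      fix w :: complex assume w: "norm w = 1"
      have "norm (1 - (of_real (t n) * \<gamma> i) * w) \<le> 2" if "i < d" for i
      proof -
        have "t n * norm (\<gamma> i) \<le> 1"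
          using t[of n] \<gamma>[OF that] mult_le_one[of "t n" "norm (\<gamma> i)"] by simp
        then show ?thesis
          using norm_triangle_ineq4[of 1 "(of_real (t n) * \<gamma> i) * w"] w t[of n] by (simp add: norm_mult)
      qed
      then show "ennreal (\<Prod>i<d. norm (1 - (of_real (t n) * \<gamma> i) * w) powr q) \<le> ennreal (\<Prod>i<d. 2 powr q)"
        using q by (intro ennreal_leI prod_mono conjI powr_mono2) auto
    qed
    have "(\<lambda>n. norm (1 - (of_real (t n) * \<gamma> i) * w) powr q) \<longlonglongrightarrow> norm (1 - (of_real 1 * \<gamma> i) * w) powr q" for i w
      using q by (intro tendsto_powr' tendsto_intros t_lim) auto
    then show "AE w in circle_measure. (\<lambda>n. ennreal (\<Prod>i<d. norm (1 - (of_real (t n) * \<gamma> i) * w) powr q))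
      \<longlonglongrightarrow> ennreal (\<Prod>i<d. norm (1 - \<gamma> i * w) powr q)"
      by (intro AE_I2 tendsto_ennrealI tendsto_prod) auto
    show "(\<integral>\<^sup>+w. ennreal (\<Prod>i<d. 2 powr q) \<partial>circle_measure) < \<infinity>"
      by (simp add: prob_space.emeasure_space_1[OF prob_space_circle, simplified])
  qed auto
  moreover have "norm (of_real (t n) * \<gamma> i) < 1" if "i < d" for n i
    using t[of n] \<gamma>[OF that] mult_left_le[of "norm (\<gamma> i)" "t n"] by (simp add: norm_mult)
  ultimately show ?thesis
    by (intro LIMSEQ_le_const) (auto intro!: nn_integral_prod_powr_ge_1_strict)
qed

text \<open>
  Subharmonicity of \<open>|P|\<^sup>q\<close> at the origin: on the unit circle a zero inside the disc may be
  reflected to the outside without changing the modulus, and a zero-free polynomial has a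
  holomorphic \<open>q\<close>-th power.
\<close>

lemma poly_0_powr_le_nn_integral_circle:
  fixes P :: "complex poly"
  assumes q: "0 < q"
  shows "ennreal (norm (poly P 0) powr q) \<le> (\<integral>\<^sup>+w. ennreal (norm (poly P w) powr q) \<partial>circle_measure)"
proof (cases "poly P 0 = 0")
  case False
  obtain r where r: "smult (lead_coeff P) (\<Prod>i<degree P. [:- r i, 1:]) = P"
    using complex_poly_decompose' by blast
  define d where "d = degree P"
  have P: "poly P w = lead_coeff P * (\<Prod>i<d. w - r i)" for w
    by (subst r[symmetric]) (simp add: poly_prod d_def)
  have r0: "r i \<noteq> 0" if "i < d" for i
    using False that by (auto simp: P)
  have P': "poly P w = poly P 0 * (\<Prod>i<d. 1 - inverse (r i) * w)" for w
  proof -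
    have "(\<Prod>i<d. w - r i) = (\<Prod>i<d. (0 - r i) * (1 - inverse (r i) * w))"
      using r0 by (intro prod.cong) (auto simp: field_simps)
    then show ?thesis unfolding P prod.distrib by (simp only: mult.assoc)
  qed
  \<comment> \<open>A zero \<open>r i\<close> inside the disc is reflected to
    \<open>1 / cnj (r i)\<close>. Both factors are normalized to 1 at the origin, so on the circle
    their moduli agree only up to the factor \<open>norm (r i) < 1\<close>; the inequality
    \<open>le\<close> goes in the useful direction.\<close>
  define \<gamma> where "\<gamma> i = (if norm (r i) \<ge> 1 then inverse (r i) else cnj (r i))" for i
  have \<gamma>1: "norm (\<gamma> i) \<le> 1" for i
    by (auto simp: \<gamma>_def norm_inverse inverse_le_1_iff)
  have le: "norm (1 - \<gamma> i * w) \<le> norm (1 - inverse (r i) * w)" if w: "norm w = 1" and i: "i < d" for i w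
  proof (cases "norm (r i) \<ge> 1")
    case False
    have "norm (1 - cnj (r i) * w) = norm (cnj w * w - cnj (r i) * w)"
      using w complex_norm_square[of w] by (simp add: mult.commute)
    also have "\<dots> = norm (cnj (w - r i) * w)" by (simp add: algebra_simps)
    also have "\<dots> = norm (w - r i)" using w by (simp only: norm_mult complex_mod_cnj mult_1_right)
    also have "w - r i = - r i * (1 - inverse (r i) * w)"
      using r0[OF i] by (simp add: field_simps)
    also have "norm \<dots> = norm (r i) * norm (1 - inverse (r i) * w)"
      by (simp only: norm_mult norm_minus_cancel)
    also have "\<dots> \<le> norm (1 - inverse (r i) * w)"
      using False by (intro mult_left_le_one_le) auto
    finally show ?thesis using False by (simp add: \<gamma>_def)
  qed (simp add: \<gamma>_def)
  have "ennreal (norm (poly P 0) powr q) * 1 \<le>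
      ennreal (norm (poly P 0) powr q) * (\<integral>\<^sup>+w. ennreal (\<Prod>i<d. norm (1 - \<gamma> i * w) powr q) \<partial>circle_measure)"
    by (intro mult_left_mono nn_integral_prod_powr_ge_1 \<gamma>1 q) auto
  also have "\<dots> = (\<integral>\<^sup>+w. ennreal (norm (poly P 0) powr q) * ennreal (\<Prod>i<d. norm (1 - \<gamma> i
    * w) powr q) \<partial>circle_measure)"
    by (intro nn_integral_cmult[symmetric]) measurable
  also have "\<dots> \<le> (\<integral>\<^sup>+w. ennreal (norm (poly P w) powr q) \<partial>circle_measure)"
  proof (rule nn_integral_mono_AE, use AE_circle in eventually_elim)
    fix w :: complex assume w: "norm w = 1"
    have "norm (poly P 0) powr q * (\<Prod>i<d. norm (1 - \<gamma> i * w) powr q)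
        \<le> norm (poly P 0) powr q * (\<Prod>i<d. norm (1 - inverse (r i) * w) powr q)"
      using q le[OF w] by (intro mult_left_mono prod_mono conjI powr_mono2) auto
    also have "\<dots> = norm (poly P w) powr q"
      unfolding P'[of w] by (simp add: norm_mult powr_mult prod_norm[symmetric] prod_powr_distrib prod_nonneg)
    finally show "ennreal (norm (poly P 0) powr q) * ennreal (\<Prod>i<d. norm (1 - \<gamma> i * w) powr q)
        \<le> ennreal (norm (poly P w) powr q)"
      by (simp add: ennreal_mult[symmetric] prod_nonneg ennreal_leI)
  qed
  finally show ?thesis by simp
qed simp

lemma exists_ge_average:
  fixes a :: "nat \<Rightarrow> real"
  assumes "L > 0"
  shows "\<exists>j<L. (\<Sum>j<L. a j) / L \<le> a j"
proof (rule ccontr)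
  assume "\<not> ?thesis"
  then have "(\<Sum>j<L. a j) < (\<Sum>j<L. (\<Sum>j<L. a j) / L)"
    using assms by (intro sum_strict_mono) (auto simp: not_le)
  then show False using assms by simp
qed

text \<open>
  Averaging over the rotations by \<open>(M + 1)\<close>-th roots of unity removes all terms of degree
  below \<open>M\<close>, so that subharmonicity applies after division by \<open>w\<^sup>M\<close>. For \<open>q < 1\<close> the usual
  Fourier coefficient bound is not available.
\<close>

lemma coefficient_powr_le_nn_integral_circle:
  fixes c :: "nat \<Rightarrow> complex"
  assumes q: "0 < q" and K: "finite K" and M: "M \<in> K"
  shows "ennreal (norm (c M) powr q) \<le>
    of_nat (M + 1) * (\<integral>\<^sup>+w. ennreal (norm (\<Sum>k\<in>K. c k * w ^ k) powr q) \<partial>circle_measure)"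
proof -
  define L where "L = M + 1"
  define \<zeta> where "\<zeta> = cis (2 * pi / L)"
  define F where "F w = (\<Sum>k\<in>K. c k * w ^ k)" for w
  \<comment> \<open>Effect of one rotation by \<zeta> on \<open>w ^ k\<close>, normalized so that
    the exponent \<open>M\<close> is left alone.\<close>
  define \<eta> where "\<eta> k = \<zeta> ^ k * cnj \<zeta> ^ M" for k
  have L: "L > 0" by (simp add: L_def)
  have [measurable]: "F \<in> borel_measurable borel" unfolding F_def by measurable
  have \<zeta>L: "\<zeta> ^ L = 1"
    using L by (simp add: \<zeta>_def Complex.DeMoivre)
  have [simp]: "norm \<zeta> = 1" by (simp add: \<zeta>_def)
  have \<eta>L: "\<eta> k ^ L = 1" for k
  proof -
    have "\<eta> k ^ L = (\<zeta> ^ L) ^ k * cnj (\<zeta> ^ L) ^ M"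
      by (simp add: \<eta>_def power_mult_distrib power_mult[symmetric] mult.commute)
    then show ?thesis by (simp add: \<zeta>L)
  qed
  have \<eta>M: "\<eta> M = 1"
    using complex_norm_square[of \<zeta>] by (simp add: \<eta>_def power_mult_distrib[symmetric])
  \<comment> \<open>\<open>\<eta> k = 1\<close> means that \<open>k\<close> and \<open>M\<close>
    agree modulo \<open>L = M + 1\<close>, and \<open>M\<close> is the least natural number in its
    class. This is the reason for using roots of unity of order \<open>M + 1\<close>.\<close>
  have \<eta>_less: "M \<le> k" if "\<eta> k = 1" for k
  proof (rule ccontr)
    assume "\<not> M \<le> k"
    then have kM: "k < M" by simp
    have "\<eta> k = cis ((real k - real M) * (2 * pi / L))"
      by (simp add: \<eta>_def \<zeta>_def Complex.DeMoivre cis_cnj cis_mult left_diff_distrib diff_divide_distrib)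
    with that have "cos ((real k - real M) * (2 * pi / L)) = 1"
      by (metis cis.sel(1) one_complex.sel(1))
    then obtain n :: int where "(real k - real M) * (2 * pi / L) = n * 2 * pi"
      using cos_one_2pi_int[of "(real k - real M) * (2 * pi / L)"] by auto
    then have "(real k - real M) * (2 * pi / L) * L = n * 2 * pi * L" by simp
    then have "(real k - real M) * (2 * pi) = (of_int n * L) * (2 * pi)"
      using L by (simp add: mult_ac)
    then have "real k - real M = of_int n * L"
      by (subst (asm) mult_cancel_right) simp
    then have "real_of_int (int k - int M) = real_of_int (n * int L)" by simp
    then have *: "int k - int M = n * int L" by (simp only: of_int_eq_iff)
    have "n < 0" using * kM L by (smt (verit) mult_nonneg_nonneg of_nat_0_le_iff of_nat_less_iff)
    then have "n * int L \<le> - 1 * int L" using L by (intro mult_right_mono) auto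
    with * kM show False by (simp add: L_def)
  qed
  have sum_\<eta>: "(\<Sum>j<L. \<eta> k ^ j) = (if \<eta> k = 1 then of_nat L else 0)" for k
    using geometric_sum[of "\<eta> k" L] \<eta>L[of k] by auto
  \<comment> \<open>By \<open>\<eta>_less\<close> all exponents are at least \<open>M\<close>, so
    the truncated subtraction is exact and \<open>P\<close> is the average divided by
    \<open>w ^ M\<close>.\<close>
  define P where "P = (\<Sum>k | k \<in> K \<and> \<eta> k = 1. monom (c k) (k - M))"
  have avg: "(\<Sum>j<L. cnj (\<zeta> ^ j) ^ M * F (\<zeta> ^ j * w)) = of_nat L * (w ^ M * poly P w)" for w
  proof -
    have "(\<Sum>j<L. cnj (\<zeta> ^ j) ^ M * F (\<zeta> ^ j * w))
        = (\<Sum>j<L. \<Sum>k\<in>K. c k * w ^ k * \<eta> k ^ j)"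
      unfolding F_def \<eta>_def
      by (simp add: sum_distrib_left power_mult_distrib power_mult[symmetric] mult_ac)
    also have "\<dots> = (\<Sum>k\<in>K. c k * w ^ k * (\<Sum>j<L. \<eta> k ^ j))"
      by (subst sum.swap) (simp add: sum_distrib_left)
    also have "\<dots> = (\<Sum>k\<in>K. if \<eta> k = 1 then c k * w ^ k * of_nat L else 0)"
      by (intro sum.cong) (auto simp: sum_\<eta>)
    also have "\<dots> = (\<Sum>k | k \<in> K \<and> \<eta> k = 1. c k * w ^ k * of_nat L)"
      using K by (subst sum.inter_filter[symmetric]) auto
    also have "\<dots> = (\<Sum>k | k \<in> K \<and> \<eta> k = 1. of_nat L * (w ^ M * (c k * w ^ (k - M))))"
      by (intro sum.cong) (auto dest!: \<eta>_less simp: power_add[symmetric] mult_ac)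
    finally show ?thesis
      by (simp add: P_def poly_sum poly_monom sum_distrib_left)
  qed
  have "poly P 0 = (\<Sum>k | k \<in> K \<and> \<eta> k = 1. if k = M then c k else 0)"
    unfolding P_def poly_sum poly_monom
    by (intro sum.cong) (use \<eta>_less in \<open>auto simp: power_0_left le_antisym\<close>)
  also have "\<dots> = c M"
    using K M \<eta>M by (simp add: sum.delta)
  finally have P0: "poly P 0 = c M" .
  have bound: "ennreal (norm (poly P w) powr q) \<le> (\<Sum>j<L. ennreal (norm (F (\<zeta> ^ j * w)) powr q))"
    if w: "norm w = 1" for w
  proof -
    have "L * norm (poly P w) = norm (\<Sum>j<L. cnj (\<zeta> ^ j) ^ M * F (\<zeta> ^ j * w))"
      unfolding avg using w by (simp add: norm_mult norm_power)
    also have "\<dots> \<le> (\<Sum>j<L. norm (F (\<zeta> ^ j * w)))"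
      by (rule order_trans[OF norm_sum]) (simp add: norm_mult norm_power)
    finally have "norm (poly P w) \<le> (\<Sum>j<L. norm (F (\<zeta> ^ j * w))) / L"
      using L by (simp add: field_simps)
    \<comment> \<open>Some rotation is at least as large as the average. Selecting it before taking
      the \<open>q\<close>-th power replaces Jensen's inequality, which fails for
      \<open>q < 1\<close>, at the cost of the factor \<open>L\<close>.\<close>
    with exists_ge_average[OF L] obtain j where j: "j < L" "norm (poly P w) \<le> norm (F (\<zeta> ^ j * w))"
      by (meson order_trans)
    have "norm (poly P w) powr q \<le> norm (F (\<zeta> ^ j * w)) powr q"
      using j q by (intro powr_mono2) auto
    also have "\<dots> \<le> (\<Sum>j<L. norm (F (\<zeta> ^ j * w)) powr q)"
      using j by (intro member_le_sum) auto
    finally show ?thesis by (simp add: ennreal_leI sum_ennreal)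
  qed
  have "ennreal (norm (c M) powr q) \<le> (\<integral>\<^sup>+w. ennreal (norm (poly P w) powr q) \<partial>circle_measure)"
    using poly_0_powr_le_nn_integral_circle[OF q, of P] by (simp add: P0)
  also have "\<dots> \<le> (\<integral>\<^sup>+w. (\<Sum>j<L. ennreal (norm (F (\<zeta> ^ j * w)) powr q)) \<partial>circle_measure)"
    by (rule nn_integral_mono_AE, use AE_circle in eventually_elim) (rule bound)
  also have "\<dots> = (\<Sum>j<L. \<integral>\<^sup>+w. ennreal (norm (F (\<zeta> ^ j * w)) powr q) \<partial>circle_measure)"
    by (intro nn_integral_sum) measurable
  also have "\<dots> = (\<Sum>j<L. \<integral>\<^sup>+w. ennreal (norm (F w) powr q) \<partial>circle_measure)"
    by (intro sum.cong refl nn_integral_circle_rotate[where f = "\<lambda>w. ennreal (norm (F w) powr q)"])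
       (auto simp: norm_power)
  finally show ?thesis by (simp add: L_def F_def)
qed

subsection \<open>Bohr monomials\<close>

lemma strict_mono_nth_prime: "strict_mono nth_prime"
  unfolding nth_prime_def[abs_def] by (rule strict_mono_enumerate[OF primes_infinite])

lemma prime_nth_prime [simp]: "prime (nth_prime j)"
  using enumerate_in_set[OF primes_infinite, of j] by (simp add: nth_prime_def)

lemma nth_prime_eq_iff [simp]: "nth_prime i = nth_prime j \<longleftrightarrow> i = j"
  using strict_mono_nth_prime by (simp add: strict_mono_eq)

lemma prime_eq_nth_prime:
  assumes "prime p"
  obtains j where "p = nth_prime j"
  using enumerate_Ex[of "{p. prime p}" p] primes_infinite assms by (auto simp: nth_prime_def)

lemma finite_nth_prime_dvd:
  assumes "n \<ge> 1"
  shows "finite {j. nth_prime j dvd n}"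
proof -
  have "inj_on nth_prime {j. nth_prime j dvd n}"
    by (rule inj_onI) simp
  moreover have "nth_prime ` {j. nth_prime j dvd n} \<subseteq> {..n}"
    using assms by (auto dest: dvd_imp_le)
  ultimately show ?thesis
    using finite_atMost by (rule inj_on_finite)
qed

lemma bohr_monomial_eq_prod:
  assumes "n \<ge> 1" "finite J" "{j. nth_prime j dvd n} \<subseteq> J"
  shows "bohr_monomial n z = (\<Prod>j\<in>J. z j ^ multiplicity (nth_prime j) n)"
  unfolding bohr_monomial_def
  by (rule prod.mono_neutral_left) (use assms in \<open>auto simp: not_dvd_imp_multiplicity_0\<close>)

lemma bohr_monomial_1 [simp]: "bohr_monomial (Suc 0) z = 1"
  unfolding bohr_monomial_def by (rule prod.neutral) (auto dest: not_prime_unit[rotated])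

lemma bohr_monomial_mult:
  assumes "m \<ge> 1" "n \<ge> 1"
  shows "bohr_monomial (m * n) z = bohr_monomial m z * bohr_monomial n z"
proof -
  let ?J = "{j. nth_prime j dvd m * n}"
  have J: "finite ?J" using assms by (intro finite_nth_prime_dvd) auto
  have "bohr_monomial (m * n) z =
      (\<Prod>j\<in>?J. z j ^ multiplicity (nth_prime j) m * z j ^ multiplicity (nth_prime j) n)"
    unfolding bohr_monomial_def using assms
    by (intro prod.cong) (auto simp: prime_elem_multiplicity_mult_distrib power_add)
  also have "\<dots> = bohr_monomial m z * bohr_monomial n z"
    unfolding prod.distrib using assms J by (subst (1 2) bohr_monomial_eq_prod[of _ ?J]) auto
  finally show ?thesis .
qed

lemma bohr_monomial_nth_prime [simp]: "bohr_monomial (nth_prime j) z = z j"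
proof -
  have "{i. nth_prime i dvd nth_prime j} = {j}"
    by (auto dest: primes_dvd_imp_eq[rotated 2])
  then show ?thesis
    by (simp add: bohr_monomial_def multiplicity_self prime_gt_0_nat prime_nth_prime)
qed

lemma norm_bohr_monomial:
  "(\<And>j. norm (z j) = 1) \<Longrightarrow> norm (bohr_monomial n z) = 1"
  by (simp add: bohr_monomial_def prod_norm[symmetric] norm_power)

lemma bohr_monomial_rotate:
  "bohr_monomial n (\<lambda>j. u j * z j) = bohr_monomial n u * bohr_monomial n z"
  by (simp add: bohr_monomial_def power_mult_distrib prod.distrib)

lemma measurable_torus_component: "(\<lambda>z. z j) \<in> borel_measurable torus_measure"
  unfolding torus_measure_def
  using measurable_component_singleton[of j UNIV "\<lambda>_. circle_measure"] by simp

lemma measurable_bohr_monomial [measurable]: "bohr_monomial n \<in> borel_measurable torus_measure"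
  unfolding bohr_monomial_def[abs_def]
  by (intro borel_measurable_prod borel_measurable_power measurable_torus_component)

lemma exists_multiplicity_nth_prime_neq:
  assumes "m \<ge> 1" "n \<ge> 1" "m \<noteq> n"
  shows "\<exists>j. multiplicity (nth_prime j) m \<noteq> multiplicity (nth_prime j) n"
proof (rule ccontr)
  assume *: "\<not> ?thesis"
  have "m = n"
  proof (rule multiplicity_eq_nat)
    fix p :: nat assume "prime p"
    then obtain j where "p = nth_prime j" by (rule prime_eq_nth_prime)
    with * show "multiplicity p m = multiplicity p n" by auto
  qed (use assms in auto)
  with assms show False by simp
qed

lemma bohr_monomial_single:
  assumes "n \<ge> 1"
  shows "bohr_monomial n (\<lambda>i. if i = j then w else 1) = w ^ multiplicity (nth_prime j) n"
proof -
  have "bohr_monomial n (\<lambda>i. if i = j then w else 1) =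
    (\<Prod>i\<in>insert j {j. nth_prime j dvd n}. (if i = j then w else 1) ^ multiplicity (nth_prime i) n)"
    using finite_nth_prime_dvd[OF assms] by (intro bohr_monomial_eq_prod assms) auto
  also have "\<dots> = (\<Prod>i\<in>insert j {j. nth_prime j dvd n}. if i = j then w ^ multiplicity (nth_prime i) n else 1)"
    by (intro prod.cong) auto
  also have "\<dots> = w ^ multiplicity (nth_prime j) n"
    using finite_nth_prime_dvd[OF assms] by (subst prod.delta) auto
  finally show ?thesis .
qed

text \<open>Rotating one coordinate in which the exponents \<open>a\<close> and \<open>b\<close>
  differ leaves the measure invariant and multiplies the integrand by
  \<open>w ^ a * cnj w ^ b\<close>. Once this constant is not 1, the integral must vanish.\<close>

lemma integral_bohr_monomial_orthogonal:
  assumes mn: "m \<ge> 1" "n \<ge> 1" "m \<noteq> n"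
  shows "(LINT z|torus_measure. bohr_monomial m z * cnj (bohr_monomial n z)) = 0"
proof -
  obtain j where j: "multiplicity (nth_prime j) m \<noteq> multiplicity (nth_prime j) n"
    using exists_multiplicity_nth_prime_neq[OF mn] by blast
  define a b where "a = multiplicity (nth_prime j) m" and "b = multiplicity (nth_prime j) n"
  \<comment> \<open>The resulting angle \<open>(a - b) * pi / (a + b + 1)\<close> is nonzero and of
    modulus less than \<open>pi\<close>.\<close>
  define w where "w = cis (pi / (a + b + 1))"
  define u where "u i = (if i = j then w else 1)" for i
  have u1: "norm (u i) = 1" for i by (simp add: u_def w_def)
  have w1: "w ^ a * cnj w ^ b \<noteq> 1"
  proof
    assume "w ^ a * cnj w ^ b = 1"
    then have "cis ((real a - real b) * (pi / (a + b + 1))) = 1"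
      by (simp add: w_def Complex.DeMoivre cis_cnj cis_mult left_diff_distrib diff_divide_distrib)
    then have "cos ((real a - real b) * (pi / (a + b + 1))) = 1"
      by (metis cis.sel(1) one_complex.sel(1))
    then obtain k :: int where "(real a - real b) * (pi / (a + b + 1)) = k * 2 * pi"
      using cos_one_2pi_int[of "(real a - real b) * (pi / (a + b + 1))"] by auto
    then have "(real a - real b) * pi = (2 * k * (a + b + 1)) * pi"
      by (simp add: field_simps)
    then have "real_of_int (int a - int b) = real_of_int (2 * k * (int a + int b + 1))"
      by simp
    then have k: "int a - int b = 2 * k * (int a + int b + 1)"
      by (simp only: of_int_eq_iff)
    have "k = 0"
    proof (rule ccontr)
      assume "k \<noteq> 0"
      then have "1 * \<bar>int a + int b + 1\<bar> \<le> \<bar>2 * k\<bar> * \<bar>int a + int b + 1\<bar>"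
        by (intro mult_right_mono) auto
      also have "\<dots> = \<bar>int a - int b\<bar>" by (simp only: k abs_mult)
      finally show False by simp
    qed
    with k j show False by (simp add: a_def b_def)
  qed
  define I where "I = (LINT z|torus_measure. bohr_monomial m z * cnj (bohr_monomial n z))"
  have "I = (LINT z|torus_measure. bohr_monomial m (\<lambda>i. u i * z i) * cnj (bohr_monomial n (\<lambda>i. u i * z i)))"
    unfolding I_def
    by (rule integral_torus_rotate[where u = u and h
      = "\<lambda>z. bohr_monomial m z * cnj (bohr_monomial n z)", symmetric])
      (auto simp: u1 intro!: borel_measurable_times borel_measurable_cnj)
  also have "\<dots> = (LINT z|torus_measure. (w ^ a * cnj w ^ b) * (bohr_monomial m z * cnj (bohr_monomial n z)))"
    unfolding bohr_monomial_rotate u_def bohr_monomial_single[OF mn(1)] bohr_monomial_single[OF mn(2)]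
    by (simp add: a_def b_def mult_ac)
  also have "\<dots> = (w ^ a * cnj w ^ b) * I"
    unfolding I_def by (rule integral_mult_right_zero)
  finally show ?thesis using w1 unfolding I_def[symmetric] by simp
qed

subsection \<open>Norms of \<open>L\<^sup>q\<close> type on Dirichlet polynomials\<close>

lemma norm_add_powr_le:
  fixes x y :: "'a::real_normed_vector"
  assumes "0 < q"
  shows "norm (x + y) powr q \<le> 2 powr q * (norm x powr q + norm y powr q)"
proof -
  have "norm (x + y) powr q \<le> (2 * max (norm x) (norm y)) powr q"
    using assms norm_triangle_ineq[of x y] by (intro powr_mono2) auto
  also have "\<dots> = 2 powr q * max (norm x) (norm y) powr q"
    by (rule powr_mult)
  also have "max (norm x) (norm y) powr q \<le> norm x powr q + norm y powr q"
    by (auto simp: max_def)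
  finally show ?thesis by simp
qed

text \<open>A substitute for the triangle inequality that covers all exponents at once.\<close>

lemma norm_sum_powr_le_geometric:
  fixes x :: "nat \<Rightarrow> 'a::real_normed_vector"
  assumes q: "0 < q" and l: "0 < l" "l < 1"
  shows "norm (\<Sum>k\<in>{i..<j}. x k) powr q
    \<le> (1 / (1 - l)) powr q * (\<Sum>k\<in>{i..<j}. (1 / l ^ k) powr q * norm (x k) powr q)"
proof (cases "i < j")
  case True
  \<comment> \<open>With the largest ratio to the geometric sequence \<open>l ^ k\<close> as
    \<open>m\<close>, the sum is at most \<open>m / (1 - l)\<close>, and \<open>m powr q\<close> is
    one of the weighted terms on the right.\<close>
  define m where "m = Max ((\<lambda>k. norm (x k) / l ^ k) ` {i..<j})"
  have "m \<in> (\<lambda>k. norm (x k) / l ^ k) ` {i..<j}"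
    unfolding m_def using True by (intro Max_in) auto
  then obtain k where k: "k \<in> {i..<j}" "m = norm (x k) / l ^ k" by blast
  have m: "norm (x k) / l ^ k \<le> m" if "k \<in> {i..<j}" for k
    unfolding m_def using that by (intro Max_ge) auto
  have "norm (\<Sum>k\<in>{i..<j}. x k) \<le> (\<Sum>k\<in>{i..<j}. norm (x k))" by (rule norm_sum)
  also have "\<dots> \<le> (\<Sum>k\<in>{i..<j}. m * l ^ k)"
    using m l by (intro sum_mono) (simp add: divide_le_eq)
  also have "\<dots> = m * (\<Sum>k\<in>{i..<j}. l ^ k)" by (simp add: sum_distrib_left)
  also have "\<dots> \<le> m * (1 / (1 - l))"
  proof (intro mult_left_mono)
    have "(\<Sum>k\<in>{i..<j}. l ^ k) \<le> (\<Sum>k. l ^ k)"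
      using l by (intro sum_le_suminf summable_geometric) auto
    then show "(\<Sum>k\<in>{i..<j}. l ^ k) \<le> 1 / (1 - l)" using l by (simp add: suminf_geometric)
    show "0 \<le> m" using k l by simp
  qed
  finally have "norm (\<Sum>k\<in>{i..<j}. x k) powr q \<le> (m * (1 / (1 - l))) powr q"
    using q by (intro powr_mono2) auto
  also have "\<dots> = (1 / (1 - l)) powr q * m powr q"
    using k l by (subst powr_mult) (auto simp: mult.commute)
  also have "m powr q = (1 / l ^ k) powr q * norm (x k) powr q"
    using k l by (subst powr_mult[symmetric]) auto
  also have "\<dots> \<le> (\<Sum>k\<in>{i..<j}. (1 / l ^ k) powr q * norm (x k) powr q)"
    using k by (intro member_le_sum) auto
  finally show ?thesis by (simp add: mult_left_mono)
qed simp

lemma dirichlet_polynomials_diff: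
  "P \<in> dirichlet_polynomials \<Longrightarrow> Q \<in> dirichlet_polynomials \<Longrightarrow> (\<lambda>n. P n - Q n) \<in> dirichlet_polynomials"
proof -
  assume "P \<in> dirichlet_polynomials" "Q \<in> dirichlet_polynomials"
  then have "finite ({n. P n \<noteq> 0} \<union> {n. Q n \<noteq> 0})"
    by (simp add: dirichlet_polynomials_def)
  then show ?thesis
    unfolding dirichlet_polynomials_def mem_Collect_eq by (rule finite_subset[rotated]) auto
qed

text \<open>The Hardy and the Bergman quasi-norms are both of this form: an L^q quasi-norm over a
  finite measure space of a combination of functions \<open>e n\<close>, which are Bohr monomials or
  Bohr monomials times \<open>n powr - \<sigma>\<close>.\<close>

locale dirichlet_norm = finite_measure N for N :: "'x measure" +
  fixes e :: "nat \<Rightarrow> 'x \<Rightarrow> complex" and q :: real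
  assumes e_measurable [measurable]: "e n \<in> borel_measurable N"
    and e_bounded: "AE x in N. \<forall>n\<ge>1. norm (e n x) \<le> 1"
    and q_pos: "0 < q"
begin

definition ev :: "dseries \<Rightarrow> 'x \<Rightarrow> complex" where
  "ev P x = (\<Sum>n | n \<ge> 1 \<and> P n \<noteq> 0. P n * e n x)"

text \<open>The \<open>q\<close>-th power of the quasi-norm as an extended real: Tonelli and Fatou
  then apply without integrability conditions, and no roots occur.\<close>

definition moment :: "dseries \<Rightarrow> ennreal" where
  "moment P = (\<integral>\<^sup>+x. ennreal (norm (ev P x) powr q) \<partial>N)"

definition nrm :: "dseries \<Rightarrow> real" where
  "nrm P = enn2real (moment P) powr (1 / q)"

lemma ev_eq_sum:
  assumes "finite A" "A \<subseteq> {1..}" "\<And>n. n \<ge> 1 \<Longrightarrow> n \<notin> A \<Longrightarrow> P n = 0"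
  shows "ev P x = (\<Sum>n\<in>A. P n * e n x)"
  unfolding ev_def by (rule sum.mono_neutral_left) (use assms in auto)

lemma ev_poly:
  assumes "P \<in> dirichlet_polynomials"
  obtains K where "\<And>x. ev P x = (\<Sum>n\<in>{1..<K}. P n * e n x)" "\<And>n. n \<ge> K \<Longrightarrow> P n = 0"
proof -
  obtain K where K: "{n. P n \<noteq> 0} \<subseteq> {..<K}"
    using assms finite_nat_iff_bounded unfolding dirichlet_polynomials_def by blast
  show ?thesis
  proof (rule that[of K])
    show "ev P x = (\<Sum>n\<in>{1..<K}. P n * e n x)" for x
      using K by (intro ev_eq_sum) (auto simp: subset_eq not_less)
  qed (use K in \<open>auto simp: subset_eq not_less[symmetric]\<close>)
qed

lemma ev_measurable [measurable]: "ev P \<in> borel_measurable N"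
  unfolding ev_def[abs_def] by measurable

lemma ev_diff:
  assumes "P \<in> dirichlet_polynomials" "Q \<in> dirichlet_polynomials"
  shows "ev (\<lambda>n. P n - Q n) x = ev P x - ev Q x"
proof -
  obtain K where K: "\<And>x. ev P x = (\<Sum>n\<in>{1..<K}. P n * e n x)" "\<And>n. n \<ge> K \<Longrightarrow> P n = 0"
    using ev_poly[OF assms(1)] by blast
  obtain L where L: "\<And>x. ev Q x = (\<Sum>n\<in>{1..<L}. Q n * e n x)" "\<And>n. n \<ge> L \<Longrightarrow> Q n = 0"
    using ev_poly[OF assms(2)] by blast
  have "ev R x = (\<Sum>n\<in>{1..<max K L}. R n * e n x)" if "\<And>n. n \<ge> max K L \<Longrightarrow> R n = 0" for R
    using that by (intro ev_eq_sum) (auto simp: not_less)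
  note * = this
  show ?thesis
    using *[of P] *[of Q] *[of "\<lambda>n. P n - Q n"] K(2) L(2) by (simp add: left_diff_distrib sum_subtractf)
qed

lemma moment_finite:
  assumes "P \<in> dirichlet_polynomials"
  shows "moment P < \<infinity>"
proof -
  obtain K where K: "\<And>x. ev P x = (\<Sum>n\<in>{1..<K}. P n * e n x)" "\<And>n. n \<ge> K \<Longrightarrow> P n = 0"
    using ev_poly[OF assms(1)] by blast
  have "moment P \<le> (\<integral>\<^sup>+x. ennreal ((\<Sum>n\<in>{1..<K}. norm (P n)) powr q) \<partial>N)"
    unfolding moment_def
  proof (rule nn_integral_mono_AE, use e_bounded in eventually_elim)
    fix x assume x: "\<forall>n\<ge>1. norm (e n x) \<le> 1"
    have "norm (ev P x) \<le> (\<Sum>n\<in>{1..<K}. norm (P n * e n x))"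
      unfolding K by (rule norm_sum)
    also have "\<dots> \<le> (\<Sum>n\<in>{1..<K}. norm (P n))"
      using x by (intro sum_mono) (auto simp: norm_mult intro!: mult_left_le)
    finally show "ennreal (norm (ev P x) powr q) \<le> ennreal ((\<Sum>n\<in>{1..<K}. norm (P n)) powr q)"
      using q_pos by (intro ennreal_leI powr_mono2) auto
  qed
  also have "\<dots> < \<infinity>"
    by (simp add: ennreal_mult_less_top less_top[symmetric]) (simp add: ennreal_mult_eq_top_iff)
  finally show ?thesis .
qed

lemma nrm_less_iff:
  assumes "P \<in> dirichlet_polynomials" "0 < c"
  shows "nrm P < c \<longleftrightarrow> moment P < ennreal (c powr q)"
proof -
  define I where "I = enn2real (moment P)"
  have I: "moment P = ennreal I" "0 \<le> I"
    using moment_finite[OF assms(1)] by (auto simp: I_def)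
  have "nrm P < c \<longleftrightarrow> I < c powr q"
  proof
    assume "nrm P < c"
    then have "(I powr (1 / q)) powr q < c powr q"
      using q_pos by (intro powr_less_mono2) (auto simp: nrm_def I_def)
    then show "I < c powr q" using I q_pos by (simp add: powr_powr)
  next
    assume "I < c powr q"
    then have "I powr (1 / q) < (c powr q) powr (1 / q)"
      using q_pos I by (intro powr_less_mono2) auto
    then show "nrm P < c" using assms(2) q_pos by (simp add: powr_powr nrm_def I_def)
  qed
  then show ?thesis using I by (simp add: ennreal_less_iff)
qed

text \<open>All late terms lie within distance 1 of the single polynomial \<open>P K\<close>, whose
  moment is finite.\<close>

lemma Cauchy_nrm_imp_bounded_moment:
  fixes P :: "nat \<Rightarrow> dseries"
  assumes P: "\<And>k. P k \<in> dirichlet_polynomials"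
    and C: "\<forall>\<epsilon>>0. \<exists>K. \<forall>j\<ge>K. \<forall>k\<ge>K. nrm (\<lambda>n. P j n - P k n) < \<epsilon>"
  obtains B K where "\<And>k. k \<ge> K \<Longrightarrow> moment (P k) \<le> ennreal B"
proof -
  obtain K where K: "\<forall>j\<ge>K. \<forall>k\<ge>K. nrm (\<lambda>n. P j n - P k n) < 1"
    using C by (meson zero_less_one)
  define I where "I = enn2real (moment (P K))"
  have I: "moment (P K) = ennreal I" "0 \<le> I"
    using moment_finite[OF P] by (auto simp: I_def)
  show ?thesis
  proof (rule that[of K "2 powr q * (1 + I)"])
    fix k assume k: "k \<ge> K"
    have PkK: "(\<lambda>n. P k n - P K n) \<in> dirichlet_polynomials"
      by (intro dirichlet_polynomials_diff P)
    have *: "moment (\<lambda>n. P k n - P K n) < ennreal 1"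
      using K[rule_format, OF k le_refl] nrm_less_iff[OF PkK, of 1] by simp
    have "moment (P k) \<le> (\<integral>\<^sup>+x. ennreal (2 powr q) * (ennreal (norm (ev (\<lambda>n. P k n - P K n) x) powr q)
        + ennreal (norm (ev (P K) x) powr q)) \<partial>N)"
      unfolding moment_def
    proof (intro nn_integral_mono)
      fix x
      have "ev (P k) x = ev (\<lambda>n. P k n - P K n) x + ev (P K) x"
        by (simp add: ev_diff P)
      then have "norm (ev (P k) x) powr q \<le> 2 powr q * (norm (ev (\<lambda>n. P k n - P K n) x) powr q
        + norm (ev (P K) x) powr q)"
        using norm_add_powr_le[OF q_pos] by simp
      then show "ennreal (norm (ev (P k) x) powr q) \<le> ennreal (2 powr q) *
          (ennreal (norm (ev (\<lambda>n. P k n - P K n) x) powr q) + ennreal (norm (ev (P K) x) powr q))"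
        by (simp add: ennreal_mult[symmetric] ennreal_plus[symmetric] ennreal_leI del: ennreal_plus)
    qed
    also have "\<dots> = ennreal (2 powr q) * (moment (\<lambda>n. P k n - P K n) + moment (P K))"
      unfolding moment_def by (subst nn_integral_cmult) (auto simp: nn_integral_add)
    also have "\<dots> \<le> ennreal (2 powr q) * (ennreal 1 + ennreal I)"
      using * I by (intro mult_left_mono add_mono) auto
    also have "\<dots> = ennreal (2 powr q * (1 + I))"
      using I by (simp add: ennreal_mult ennreal_plus)
    finally show "moment (P k) \<le> ennreal (2 powr q * (1 + I))" .
  qed
qed

text \<open>Telescoping writes \<open>S j - S i\<close> as a sum of increments. As \<open>q\<close>
  may be less than 1, this long sum is estimated by the geometrically weighted inequality, hence the
  weights \<open>(1 / l ^ k) powr q\<close> in the assumption.\<close>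

lemma summable_moments_imp_Cauchy_nrm:
  assumes S: "\<And>k. S k \<in> dirichlet_polynomials" and l: "0 < l" "l < 1"
    and sum: "(\<Sum>k. ennreal ((1 / l ^ k) powr q) * moment (\<lambda>n. S (Suc k) n - S k n)) < \<infinity>"
  shows "\<forall>\<epsilon>>0. \<exists>K. \<forall>j\<ge>K. \<forall>k\<ge>K. nrm (\<lambda>n. S j n - S k n) < \<epsilon>"
proof (intro allI impI)
  fix \<epsilon> :: real assume \<epsilon>: "\<epsilon> > 0"
  define c where "c = (1 / (1 - l)) powr q"
  define d where "d k = enn2real (moment (\<lambda>n. S (Suc k) n - S k n))" for k
  have Sd: "(\<lambda>n. S j n - S k n) \<in> dirichlet_polynomials" for j k
    by (intro dirichlet_polynomials_diff S)
  have d: "moment (\<lambda>n. S (Suc k) n - S k n) = ennreal (d k)" "0 \<le> d k" for k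
    using moment_finite[OF Sd] by (auto simp: d_def)
  define t where "t k = (1 / l ^ k) powr q * d k" for k
  have t0: "0 \<le> t k" for k using d by (simp add: t_def)
  have "(\<Sum>k. ennreal (t k)) \<noteq> \<infinity>"
    using sum d by (simp add: t_def ennreal_mult)
  then have t: "summable t"
    using t0 by (intro summable_suminf_not_top) auto
  have c: "c > 0" using l by (simp add: c_def)
  obtain K where K: "\<And>m n. m \<ge> K \<Longrightarrow> norm (sum t {m..<n}) < \<epsilon> powr q / c"
  proof -
    have "\<epsilon> powr q / c > 0" using \<epsilon> c by simp
    then show ?thesis using t[unfolded summable_Cauchy] that by blast
  qed
  have main: "nrm (\<lambda>n. S j n - S i n) < \<epsilon>" if "K \<le> i" "i \<le> j" for i j
  proof -
    have ev: "ev (\<lambda>n. S j n - S i n) x = (\<Sum>k\<in>{i..<j}. ev (\<lambda>n. S (Suc k) n - S k n) x)" for x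
      using sum_Suc_diff'[OF that(2), of "\<lambda>k. ev (S k) x"] by (simp add: ev_diff S)
    have "moment (\<lambda>n. S j n - S i n) \<le> (\<integral>\<^sup>+x. (\<Sum>k\<in>{i..<j}. ennreal (c * (1 / l ^ k) powr q)
      * ennreal (norm (ev (\<lambda>n. S (Suc k) n - S k n) x) powr q)) \<partial>N)"
      unfolding moment_def
    proof (intro nn_integral_mono)
      fix x
      have "norm (ev (\<lambda>n. S j n - S i n) x) powr q
        \<le> c * (\<Sum>k\<in>{i..<j}. (1 / l ^ k) powr q * norm (ev (\<lambda>n. S (Suc k) n - S k n) x) powr q)"
        unfolding ev c_def by (rule norm_sum_powr_le_geometric[OF q_pos l])
      also have "\<dots> = (\<Sum>k\<in>{i..<j}. c * (1 / l ^ k) powr q * norm (ev (\<lambda>n. S (Suc k) n - S k n) x) powr q)"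
        by (simp add: sum_distrib_left mult.assoc)
      finally show "ennreal (norm (ev (\<lambda>n. S j n - S i n) x) powr q) \<le>
          (\<Sum>k\<in>{i..<j}. ennreal (c * (1 / l ^ k) powr q)
            * ennreal (norm (ev (\<lambda>n. S (Suc k) n - S k n) x) powr q))"
        using c by (simp add: ennreal_mult[symmetric] sum_ennreal ennreal_leI)
    qed
    also have "\<dots> = (\<Sum>k\<in>{i..<j}. ennreal (c * (1 / l ^ k) powr q) * moment (\<lambda>n. S (Suc k) n - S k n))"
      unfolding moment_def by (subst nn_integral_sum) (auto simp: nn_integral_cmult)
    also have "\<dots> = (\<Sum>k\<in>{i..<j}. ennreal (c * t k))"
      using c d by (intro sum.cong) (auto simp: t_def ennreal_mult[symmetric] mult.assoc)
    also have "\<dots> = ennreal (c * sum t {i..<j})"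
      using c t0 by (subst sum_ennreal) (auto simp: sum_distrib_left)
    also have "\<dots> < ennreal (\<epsilon> powr q)"
      using K[OF that(1), of j] c t0 \<epsilon> by (auto simp: ennreal_less_iff sum_nonneg field_simps)
    finally show ?thesis using nrm_less_iff[OF Sd \<epsilon>] by simp
  qed
  have sym: "nrm (\<lambda>n. S j n - S i n) = nrm (\<lambda>n. S i n - S j n)" for i j
    by (simp add: nrm_def moment_def ev_diff S norm_minus_commute)
  show "\<exists>K. \<forall>j\<ge>K. \<forall>k\<ge>K. nrm (\<lambda>n. S j n - S k n) < \<epsilon>"
  proof (intro exI[of _ K] allI impI)
    fix j k assume "K \<le> j" "K \<le> k"
    then show "nrm (\<lambda>n. S j n - S k n) < \<epsilon>"
      using main[of j k] main[of k j] sym[of j k] by (cases "j \<le> k") auto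
  qed
qed

end

subsection \<open>Hardy and Bergman norms\<close>

lemma sets_bergman_measure [simp, measurable_cong]: "sets (bergman_measure \<alpha>) = sets borel"
  by (simp add: bergman_measure_def)

lemma space_bergman_measure [simp]: "space (bergman_measure \<alpha>) = UNIV"
  by (simp add: bergman_measure_def)

lemma AE_bergman_measure_pos: "AE \<sigma> in bergman_measure \<alpha>. 0 < \<sigma>"
  unfolding bergman_measure_def by (subst AE_density) (auto simp: indicator_def)

text \<open>Half of the exponential decay is given up so that the majorant becomes the integrand of
  \<open>Gamma (\<alpha> + 1)\<close>.\<close>

lemma finite_bergman_measure:
  assumes "\<alpha> > -1"
  shows "finite_measure (bergman_measure \<alpha>)"
proof
  define c where "c = 2 powr (\<alpha> + 1) / Gamma (\<alpha> + 1)"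
  have c: "c > 0" using assms by (simp add: c_def Gamma_real_pos)
  have "emeasure (bergman_measure \<alpha>) UNIV =
      (\<integral>\<^sup>+\<sigma>. ennreal (indicator {0<..} \<sigma> * (c * \<sigma> powr \<alpha> * exp (- 2 * \<sigma>))) \<partial>lborel)"
    unfolding bergman_measure_def c_def by (subst emeasure_density) auto
  also have "\<dots> \<le> (\<integral>\<^sup>+\<sigma>. ennreal c * ennreal (indicator {0..} \<sigma> * \<sigma> powr ((\<alpha> + 1) - 1) / exp \<sigma>) \<partial>lborel)"
  proof (intro nn_integral_mono)
    fix \<sigma> :: real
    have "\<sigma> powr \<alpha> * exp (- 2 * \<sigma>) \<le> \<sigma> powr \<alpha> * exp (- \<sigma>)" if "0 < \<sigma>"
      using that by (intro mult_left_mono) auto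
    then have "c * (\<sigma> powr \<alpha> * exp (- 2 * \<sigma>)) \<le> c * (\<sigma> powr \<alpha> * exp (- \<sigma>))" if "0 < \<sigma>"
      using that c by (intro mult_left_mono) auto
    then have "indicator {0<..} \<sigma> * (c * \<sigma> powr \<alpha> * exp (- 2 * \<sigma>))
        \<le> c * (indicator {0..} \<sigma> * \<sigma> powr ((\<alpha> + 1) - 1) / exp \<sigma>)"
      using c by (auto simp: indicator_def exp_minus field_simps)
    then show "ennreal (indicator {0<..} \<sigma> * (c * \<sigma> powr \<alpha> * exp (- 2 * \<sigma>)))
        \<le> ennreal c * ennreal (indicator {0..} \<sigma> * \<sigma> powr ((\<alpha> + 1) - 1) / exp \<sigma>)"
      using c by (subst ennreal_mult[symmetric]) (auto intro: ennreal_leI)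
  qed
  also have "\<dots> = ennreal c * ennreal (Gamma (\<alpha> + 1))"
    using assms by (subst nn_integral_cmult) (auto simp: Gamma_conv_nn_integral_real)
  also have "\<dots> < \<infinity>" by (simp add: ennreal_mult_less_top)
  finally show "emeasure (bergman_measure \<alpha>) (space (bergman_measure \<alpha>)) \<noteq> \<infinity>"
    by simp
qed

text \<open>On \<open>{\<delta> / 2..\<delta>}\<close> with \<open>\<delta> \<le> 1\<close> one has
  \<open>\<sigma> powr \<alpha> \<ge> \<sigma> powr \<bar>\<alpha>\<bar> \<ge> (\<delta> / 2) powr
  \<bar>\<alpha>\<bar>\<close> for either sign of \<alpha>. The exponent is not sharp for negative
  \<alpha>, but any power of \<delta> suffices.\<close>

lemma bergman_measure_near_0:
  assumes "\<alpha> > -1"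
  obtains c where "c > 0"
    "\<And>\<delta>. 0 < \<delta> \<Longrightarrow> \<delta> \<le> 1 \<Longrightarrow> ennreal (c * \<delta> powr (\<bar>\<alpha>\<bar> + 1)) \<le> emeasure (bergman_measure \<alpha>) {0<..\<delta>}"
proof -
  define k where "k = 2 powr (\<alpha> + 1) / Gamma (\<alpha> + 1)"
  have k: "k > 0" using assms by (simp add: k_def Gamma_real_pos)
  define c where "c = k * exp (- 2) * (1 / 2) powr \<bar>\<alpha>\<bar> / 2"
  have "ennreal (c * \<delta> powr (\<bar>\<alpha>\<bar> + 1)) \<le> emeasure (bergman_measure \<alpha>) {0<..\<delta>}"
    if \<delta>: "0 < \<delta>" "\<delta> \<le> 1" for \<delta>
  proof -
    define h where "h = k * (\<delta> / 2) powr \<bar>\<alpha>\<bar> * exp (- 2)"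
    have h: "0 \<le> h" using k by (simp add: h_def)
    have "(\<delta> / 2) powr \<bar>\<alpha>\<bar> = (1 / 2) powr \<bar>\<alpha>\<bar> * \<delta> powr \<bar>\<alpha>\<bar>"
      using \<delta> by (simp add: powr_mult[symmetric])
    then have "c * \<delta> powr (\<bar>\<alpha>\<bar> + 1) = h * (\<delta> / 2)"
      using \<delta> by (simp add: c_def h_def powr_add)
    then have "ennreal (c * \<delta> powr (\<bar>\<alpha>\<bar> + 1)) = ennreal h * emeasure lborel {\<delta> / 2..\<delta>}"
      using \<delta> h by (simp only: ennreal_mult) simp
    also have "\<dots> = (\<integral>\<^sup>+\<sigma>. ennreal h * indicator {\<delta> / 2..\<delta>} \<sigma> \<partial>lborel)"
      by (simp add: nn_integral_cmult)
    also have "\<dots> \<le> (\<integral>\<^sup>+\<sigma>. ennreal (indicator {0<..} \<sigma> * (k * \<sigma> powr \<alpha> * exp (- 2 * \<sigma>)))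
      * indicator {0<..\<delta>} \<sigma> \<partial>lborel)"
    proof (intro nn_integral_mono)
      fix \<sigma> :: real
      have "h \<le> k * \<sigma> powr \<alpha> * exp (- 2 * \<sigma>)" if \<sigma>: "\<delta> / 2 \<le> \<sigma>" "\<sigma> \<le> \<delta>"
      proof -
        have "(\<delta> / 2) powr \<bar>\<alpha>\<bar> \<le> \<sigma> powr \<bar>\<alpha>\<bar>" using \<sigma> \<delta> by (intro powr_mono2) auto
        also have "\<dots> \<le> \<sigma> powr \<alpha>" using \<sigma> \<delta> by (intro powr_mono') auto
        finally show ?thesis
          unfolding h_def using \<sigma> \<delta> k by (intro mult_mono) auto
      qed
      then show "ennreal h * indicator {\<delta> / 2..\<delta>} \<sigma> \<le>
          ennreal (indicator {0<..} \<sigma> * (k * \<sigma> powr \<alpha> * exp (- 2 * \<sigma>))) * indicator {0<..\<delta>} \<sigma>"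
        using \<delta> by (auto simp: indicator_def intro: ennreal_leI)
    qed
    also have "\<dots> = emeasure (bergman_measure \<alpha>) {0<..\<delta>}"
      unfolding bergman_measure_def k_def by (subst emeasure_density) auto
    finally show ?thesis .
  qed
  then show ?thesis using that[of c] k by (auto simp: c_def)
qed

lemma dirichlet_norm_torus:
  assumes "0 < p"
  shows "dirichlet_norm torus_measure bohr_monomial p"
proof -
  interpret P: prob_space torus_measure by (rule prob_space_torus)
  have "AE z in torus_measure. \<forall>n\<ge>1. norm (bohr_monomial n z) \<le> 1"
    using AE_torus by eventually_elim (simp add: norm_bohr_monomial)
  then show ?thesis
    using assms by unfold_locales auto
qed

lemma hardy_norm_eq_nrm:
  assumes "0 < p"
  shows "hardy_norm p P = dirichlet_norm.nrm torus_measure bohr_monomial p P"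
proof -
  interpret dirichlet_norm torus_measure bohr_monomial p by (rule dirichlet_norm_torus[OF assms])
  have ev: "bohr_lift P = ev P"
    by (simp add: fun_eq_iff bohr_lift_def ev_def)
  have "(LINT z|torus_measure. norm (ev P z) powr p) = enn2real (moment P)"
    unfolding moment_def by (rule integral_eq_nn_integral) auto
  then show ?thesis by (simp add: hardy_norm_def nrm_def ev)
qed

section \<open>The Bergman norm as an L^q norm over pairs of a translation and a point of the
  torus\<close>

definition bergman_basis :: "nat \<Rightarrow> real \<times> (nat \<Rightarrow> complex) \<Rightarrow> complex" where
  "bergman_basis n x = of_real (real n powr - fst x) * bohr_monomial n (snd x)"

abbreviation bergman_product :: "real \<Rightarrow> (real \<times> (nat \<Rightarrow> complex)) measure" where
  "bergman_product \<alpha> \<equiv> bergman_measure \<alpha> \<Otimes>\<^sub>M torus_measure"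

lemma bergman_basis_measurable [measurable]: "bergman_basis n \<in> borel_measurable (bergman_product \<alpha>)"
  unfolding bergman_basis_def[abs_def] by measurable

lemma pair_sigma_finite_bergman:
  assumes "\<alpha> > -1"
  shows "pair_sigma_finite (bergman_measure \<alpha>) torus_measure"
  using finite_bergman_measure[OF assms] prob_space_torus
  by (intro pair_sigma_finite.intro finite_measure.sigma_finite_measure prob_space_imp_sigma_finite) 

lemma AE_bergman_product:
  assumes "\<alpha> > -1"
  shows "AE x in bergman_product \<alpha>. 0 < fst x \<and> (\<forall>j. norm (snd x j) = 1)"
proof -
  interpret pair_sigma_finite "bergman_measure \<alpha>" torus_measure
    by (rule pair_sigma_finite_bergman[OF assms])
  show ?thesis
  proof (rule AE_pair_measure)
    show "{x \<in> space (bergman_product \<alpha>). 0 < fst x \<and> (\<forall>j. norm (snd x j) = 1)} \<in> sets (bergman_product \<alpha>)"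
    proof -
      have [measurable]: "(\<lambda>x. snd x j) \<in> borel_measurable (bergman_product \<alpha>)" for j
        by (rule measurable_compose[OF measurable_snd measurable_torus_component])
      show ?thesis by measurable
    qed
    show "AE x in bergman_measure \<alpha>. AE y in torus_measure. 0 < fst (x, y) \<and> (\<forall>j. norm (snd (x, y) j) = 1)"
      using AE_bergman_measure_pos by eventually_elim (use AE_torus in auto)
  qed
qed

lemma dirichlet_norm_bergman:
  assumes "\<alpha> > -1" "0 < q"
  shows "dirichlet_norm (bergman_product \<alpha>) bergman_basis q"
proof -
  interpret A: finite_measure "bergman_measure \<alpha>" by (rule finite_bergman_measure[OF assms(1)])
  interpret P: prob_space torus_measure by (rule prob_space_torus)
  interpret finite_measure "bergman_product \<alpha>"
    by (intro finite_measure_pair_measure) unfold_locales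
  have "AE x in bergman_product \<alpha>. \<forall>n\<ge>1. norm (bergman_basis n x) \<le> 1"
    using AE_bergman_product[OF assms(1)]
  proof eventually_elim
    case (elim x)
    have "real n powr - fst x \<le> 1" if "n \<ge> 1" for n
      using elim that powr_mono[of "- fst x" 0 "real n"] by simp
    then show ?case using elim by (auto simp: bergman_basis_def norm_mult norm_bohr_monomial)
  qed
  then show ?thesis
    using assms by unfold_locales auto
qed

lemma bohr_lift_translate:
  "bohr_lift (translate \<sigma> P) z = (\<Sum>n | n \<ge> 1 \<and> P n \<noteq> 0. P n * bergman_basis n (\<sigma>, z))"
proof -
  have pw: "of_nat n powr (- complex_of_real \<sigma>) = complex_of_real (real n powr - \<sigma>)" for n
    using powr_of_real[of "real n" "- \<sigma>"] by simp
  have "{n. n \<ge> 1 \<and> translate \<sigma> P n \<noteq> 0} = {n. n \<ge> 1 \<and> P n \<noteq> 0}"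
    by (auto simp: translate_def)
  then show ?thesis
    unfolding bohr_lift_def by (simp add: translate_def pw bergman_basis_def mult.assoc)
qed

text \<open>Tonelli merges the integrals over \<sigma> and over the torus. For a polynomial all
  inner moments are finite, so the passage through real-valued integrals in the definitions loses
  nothing.\<close>

lemma bergman_norm_eq_nrm:
  assumes \<alpha>: "\<alpha> > -1" and q: "0 < q" and P: "P \<in> dirichlet_polynomials"
  shows "bergman_norm q \<alpha> P = dirichlet_norm.nrm (bergman_product \<alpha>) bergman_basis q P"
proof -
  interpret dirichlet_norm "bergman_product \<alpha>" bergman_basis q
    by (rule dirichlet_norm_bergman[OF \<alpha> q])
  interpret T: dirichlet_norm torus_measure bohr_monomial q
    by (rule dirichlet_norm_torus[OF q])
  interpret pair_sigma_finite "bergman_measure \<alpha>" torus_measure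
    by (rule pair_sigma_finite_bergman[OF \<alpha>])
  define g where "g \<sigma> = (\<integral>\<^sup>+z. ennreal (norm (ev P (\<sigma>, z)) powr q) \<partial>torus_measure)" for \<sigma>
  have [measurable]: "g \<in> borel_measurable (bergman_measure \<alpha>)"
    unfolding g_def by measurable
  have ev: "ev P (\<sigma>, z) = T.ev (translate \<sigma> P) z" for \<sigma> z
    using bohr_lift_translate[of \<sigma> P z] by (simp add: ev_def T.ev_def bohr_lift_def)
  have g: "g \<sigma> = T.moment (translate \<sigma> P)" for \<sigma>
    by (simp add: g_def T.moment_def ev)
  have fin: "g \<sigma> < \<infinity>" for \<sigma>
  proof -
    have "translate \<sigma> P \<in> dirichlet_polynomials"
      using P unfolding dirichlet_polynomials_def translate_def
      by (auto elim!: finite_subset[rotated])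
    then show ?thesis unfolding g by (rule T.moment_finite)
  qed
  have "hardy_norm q (translate \<sigma> P) powr q = enn2real (g \<sigma>)" for \<sigma>
    using q by (simp add: hardy_norm_eq_nrm T.nrm_def g powr_powr)
  then have "(LINT \<sigma>|bergman_measure \<alpha>. hardy_norm q (translate \<sigma> P) powr q) =
      enn2real (\<integral>\<^sup>+\<sigma>. ennreal (enn2real (g \<sigma>)) \<partial>bergman_measure \<alpha>)"
    by (simp add: integral_eq_nn_integral)
  also have "(\<integral>\<^sup>+\<sigma>. ennreal (enn2real (g \<sigma>)) \<partial>bergman_measure \<alpha>) = (\<integral>\<^sup>+\<sigma>. g \<sigma> \<partial>bergman_measure \<alpha>)"
    using fin by simp
  also have "\<dots> = moment P"
    unfolding g_def moment_def by (rule T.nn_integral_fst) measurable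
  finally show ?thesis by (simp add: bergman_norm_def nrm_def)
qed

subsection \<open>Subgaussian random variables and Khinchine's inequality\<close>

text \<open>Parseval's identity in a form that serves both the monomials on the torus and the random
  variables.\<close>

lemma nn_integral_norm_sum_orthonormal:
  fixes \<phi> :: "nat \<Rightarrow> 'x \<Rightarrow> complex"
  assumes A: "finite A"
    and int: "\<And>m n. m \<in> A \<Longrightarrow> n \<in> A \<Longrightarrow> integrable N (\<lambda>x. \<phi> m x * cnj (\<phi> n x))"
    and orth: "\<And>m n. m \<in> A \<Longrightarrow> n \<in> A \<Longrightarrow> (LINT x|N. \<phi> m x * cnj (\<phi> n x)) = (if m = n then 1 else 0)"
  shows "(\<integral>\<^sup>+x. ennreal ((norm (\<Sum>n\<in>A. c n * \<phi> n x))\<^sup>2) \<partial>N) = ennreal (\<Sum>n\<in>A. (norm (c n))\<^sup>2)"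
proof -
  define S where "S x = (\<Sum>n\<in>A. c n * \<phi> n x)" for x
  have S: "complex_of_real ((norm (S x))\<^sup>2) = (\<Sum>m\<in>A. \<Sum>n\<in>A. c m * cnj (c n) * (\<phi> m x * cnj (\<phi> n x)))" for x
    unfolding complex_norm_square S_def cnj_sum sum_product by (simp add: mult_ac)
  have I: "integrable N (\<lambda>x. complex_of_real ((norm (S x))\<^sup>2))"
    unfolding S using int by auto
  have "(LINT x|N. complex_of_real ((norm (S x))\<^sup>2)) = (\<Sum>m\<in>A. \<Sum>n\<in>A. c m * cnj (c n) * (if m
    = n then 1 else 0))"
    unfolding S using int orth by (simp add: Bochner_Integration.integral_sum)
  also have "\<dots> = complex_of_real (\<Sum>n\<in>A. (norm (c n))\<^sup>2)"
    unfolding of_real_sum complex_norm_square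
    using A by (simp add: if_distrib[of "\<lambda>x. _ * x"] sum.delta cong: if_cong)
  finally have "(LINT x|N. (norm (S x))\<^sup>2) = (\<Sum>n\<in>A. (norm (c n))\<^sup>2)"
    by (simp only: integral_complex_of_real of_real_eq_iff)
  moreover have "integrable N (\<lambda>x. (norm (S x))\<^sup>2)"
    using I integrable_Re by fastforce
  ultimately show ?thesis
    unfolding S_def by (subst nn_integral_eq_integral) auto
qed

text \<open>The inequality \<open>ln y \<le> y - 1\<close> at \<open>y = x / q\<close>. It converts
  bounds for exponential moments into bounds for \<open>q\<close>-th moments.\<close>

lemma powr_le_powr_self_mult_exp:
  fixes x q :: real
  assumes "0 \<le> x" "0 < q"
  shows "x powr q \<le> q powr q * exp x"
proof (cases "x = 0")
  case False
  then have x: "x > 0" using assms by simp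
  have "ln (x / q) \<le> x / q - 1"
    using x assms by (intro ln_le_minus_one) auto
  then have "q * ln (x / q) \<le> x - q"
    using assms by (simp add: field_simps)
  then have "q * ln x \<le> q * ln q + x"
    using x assms by (simp add: ln_div algebra_simps)
  then have "exp (q * ln x) \<le> exp (q * ln q + x)" by simp
  then show ?thesis
    using x assms by (simp add: powr_def exp_add)
qed (use assms in auto)

lemma integral_circle_id: "(LINT w|circle_measure. w) = 0"
proof -
  have "(LINT w|circle_measure. w) = (LINT w|distr circle_measure borel (\<lambda>w. -1 * w). w)"
    by (subst distr_circle_rotate) auto
  also have "\<dots> = (LINT w|circle_measure. -1 * w)"
    by (rule integral_distr) measurable
  finally show ?thesis by simp
qed

text \<open>What the three types of random variables have in common and the argument needs.\<close>

definition standardized_subgaussian :: "'w measure \<Rightarrow> ('w \<Rightarrow> complex) \<Rightarrow> bool" where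
  "standardized_subgaussian M Y \<longleftrightarrow> Y \<in> borel_measurable M \<and> integrable M Y \<and> (LINT \<omega>|M. Y \<omega>) = 0 \<and>
     integrable M (\<lambda>\<omega>. Y \<omega> * cnj (Y \<omega>)) \<and> (LINT \<omega>|M. Y \<omega> * cnj (Y \<omega>)) = 1 \<and>
     (\<forall>c. (\<integral>\<^sup>+\<omega>. ennreal (exp (Re (c * Y \<omega>))) \<partial>M) \<le> ennreal (exp ((norm c)\<^sup>2 / 2)))"

text \<open>The variable \<open>Re (c * Y)\<close> has mean 0 and lies in an interval of length
  \<open>2 * norm c\<close>, and Hoeffding's lemma gives the exponent
  \<open>(2 * norm c)\<^sup>2 / 8\<close>.\<close>

lemma (in prob_space) standardized_subgaussian_unimodular:
  assumes [measurable]: "Y \<in> borel_measurable M"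
    and Y1: "AE \<omega> in M. norm (Y \<omega>) = 1" and EY: "(LINT \<omega>|M. Y \<omega>) = 0"
  shows "standardized_subgaussian M Y"
  unfolding standardized_subgaussian_def
proof (intro conjI allI)
  show int: "integrable M Y"
    by (rule integrable_const_bound[where B = 1]) (use Y1 in auto)
  have *: "AE \<omega> in M. Y \<omega> * cnj (Y \<omega>) = 1"
    using Y1 by eventually_elim (simp add: complex_norm_square[symmetric])
  show "integrable M (\<lambda>\<omega>. Y \<omega> * cnj (Y \<omega>))"
    by (rule integrable_const_bound[where B = 1]) (use * in auto)
  have "(LINT \<omega>|M. Y \<omega> * cnj (Y \<omega>)) = (LINT \<omega>|M. 1)"
    by (rule integral_cong_AE) (use * in auto)
  then show "(LINT \<omega>|M. Y \<omega> * cnj (Y \<omega>)) = 1" by (simp add: prob_space)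
  fix c :: complex
  interpret interval_bounded_random_variable M "\<lambda>\<omega>. Re (c * Y \<omega>)" "- norm c" "norm c"
  proof
    show "AE \<omega> in M. Re (c * Y \<omega>) \<in> {- norm c..norm c}"
      using Y1
    proof eventually_elim
      case (elim \<omega>)
      then show ?case using abs_Re_le_cmod[of "c
        * Y \<omega>"] by (simp add: norm_mult abs_le_iff del: times_complex.sel)
    qed
  qed measurable
  have "expectation (\<lambda>\<omega>. Re (c * Y \<omega>)) = Re (c * (LINT \<omega>|M. Y \<omega>))"
    using int by (simp del: times_complex.sel)
  then have "expectation (\<lambda>\<omega>. Re (c * Y \<omega>)) = 0" by (simp add: EY)
  from Hoeffdings_lemma_nn_integral_0[OF zero_less_one this]
  show "(\<integral>\<^sup>+\<omega>. ennreal (exp (Re (c * Y \<omega>))) \<partial>M) \<le> ennreal (exp ((norm c)\<^sup>2 / 2))"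
    by (simp add: power2_eq_square del: times_complex.sel)
qed (use EY in simp_all)

lemma (in prob_space) bernoulli_standardized:
  assumes "bernoulli_rv M Y"
  shows "standardized_subgaussian M Y"
proof -
  have Y [measurable]: "Y \<in> borel_measurable M"
    and h: "measure M {\<omega> \<in> space M. Y \<omega> = 1} = 1 / 2" "measure M {\<omega> \<in> space M. Y \<omega> = -1} = 1 / 2"
    using assms by (auto simp: bernoulli_rv_def)
  define A B where "A = {\<omega> \<in> space M. Y \<omega> = 1}" and "B = {\<omega> \<in> space M. Y \<omega> = -1}"
  have [measurable]: "A \<in> events" "B \<in> events" unfolding A_def B_def by measurable
  have "prob (A \<union> B) = prob A + prob B"
    by (rule finite_measure_Union) (auto simp: A_def B_def)
  then have "prob (A \<union> B) = 1" using h by (simp add: A_def B_def)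
  then have AE: "AE \<omega> in M. \<omega> \<in> A \<union> B" by (rule AE_prob_1)
  have "(LINT \<omega>|M. Y \<omega>) = (LINT \<omega>|M. complex_of_real (indicator A \<omega> - indicator B \<omega>))"
  proof (rule integral_cong_AE)
    show "AE \<omega> in M. Y \<omega> = complex_of_real (indicator A \<omega> - indicator B \<omega>)"
      using AE by eventually_elim (auto simp: A_def B_def)
  qed measurable
  also have "\<dots> = 0"
    unfolding integral_complex_of_real using h
    by (subst Bochner_Integration.integral_diff)
      (auto simp: A_def[symmetric] B_def[symmetric] emeasure_eq_measure)
  finally show ?thesis
    by (intro standardized_subgaussian_unimodular Y) (use AE in \<open>auto simp: A_def B_def\<close>)
qed

lemma (in prob_space) steinhaus_standardized:
  assumes "steinhaus_rv M Y"
  shows "standardized_subgaussian M Y"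
proof -
  have Y [measurable]: "Y \<in> borel_measurable M" and d: "distr M borel Y = circle_measure"
    using assms by (auto simp: steinhaus_rv_def)
  have "AE \<omega> in M. norm (Y \<omega>) = 1"
    using AE_circle unfolding d[symmetric] by (subst (asm) AE_distr_iff) auto
  moreover have "(LINT \<omega>|M. Y \<omega>) = 0"
    using integral_circle_id unfolding d[symmetric] by (simp add: integral_distr)
  ultimately show ?thesis by (intro standardized_subgaussian_unimodular Y)
qed

text \<open>Completing the square: \<open>exp (t * x)\<close> times the standard density is
  \<open>exp (t\<^sup>2 / 2)\<close> times the normal density with mean \<open>t\<close>.\<close>

lemma nn_integral_exp_std_normal:
  "(\<integral>\<^sup>+x. ennreal (std_normal_density x) * ennreal (exp (t * x)) \<partial>lborel) = ennreal (exp (t\<^sup>2 / 2))"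
proof -
  interpret P: prob_space "density lborel (normal_density t 1)"
    by (rule prob_space_normal_density) simp
  have "std_normal_density x * exp (t * x) = exp (t\<^sup>2 / 2) * normal_density t 1 x" for x
    by (simp add: normal_density_def exp_add[symmetric] field_simps power2_eq_square)
  then have "(\<integral>\<^sup>+x. ennreal (std_normal_density x) * ennreal (exp (t * x)) \<partial>lborel)
      = (\<integral>\<^sup>+x. ennreal (exp (t\<^sup>2 / 2)) * ennreal (normal_density t 1 x) \<partial>lborel)"
    by (intro nn_integral_cong) (simp add: ennreal_mult[symmetric])
  also have "\<dots> = ennreal (exp (t\<^sup>2 / 2)) * emeasure (density lborel (normal_density t 1)) UNIV"
    by (subst nn_integral_cmult) (auto simp: emeasure_density)
  finally show ?thesis using P.emeasure_space_1 by simp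
qed

lemma (in prob_space) gaussian_standardized:
  assumes "gaussian_rv M Y"
  shows "standardized_subgaussian M Y"
proof -
  define G where "G = density lborel (\<lambda>x. ennreal (std_normal_density x))"
  have Y [measurable]: "Y \<in> borel_measurable M" and d: "distr M borel Y = distr G borel complex_of_real"
    using assms by (auto simp: gaussian_rv_def G_def)
  have [measurable_cong, simp]: "sets G = sets borel" by (simp add: G_def)
  have [measurable]: "complex_of_real \<in> borel_measurable borel"
    by (intro borel_measurable_continuous_onI continuous_intros)
  \<comment> \<open>Only the law of \<open>Y\<close> matters, so the mean and the second moment are
    computed for the real standard normal law \<open>G\<close>.\<close>
  have transfer: "(LINT \<omega>|M. h (Y \<omega>)) = (LINT x|G. h (complex_of_real x))"
    "integrable M (\<lambda>\<omega>. h (Y \<omega>)) \<longleftrightarrow> integrable G (\<lambda>x. h (complex_of_real x))"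
    if [measurable]: "h \<in> borel_measurable borel" for h :: "complex \<Rightarrow> complex"
    using integral_distr[of Y M borel h] integral_distr[of complex_of_real G borel h]
      integrable_distr_eq[of Y M borel h] integrable_distr_eq[of complex_of_real G borel h]
    by (simp_all add: d)
  have G1: "integrable G (\<lambda>x. x)" "(LINT x|G. x) = 0"
    unfolding G_def using integrable_std_normal_moment[of 1] integral_std_normal_moment_odd[of 0]
    by (simp_all add: integrable_real_density integral_real_density)
  have G2: "integrable G (\<lambda>x. x\<^sup>2)" "(LINT x|G. x\<^sup>2) = 1"
    unfolding G_def using integrable_std_normal_moment[of 2] integral_std_normal_moment_even[of 1]
    by (simp_all add: integrable_real_density integral_real_density)
  show ?thesis
    unfolding standardized_subgaussian_def
  proof (intro conjI allI)
    show "integrable M Y" "(LINT \<omega>|M. Y \<omega>) = 0"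
      using transfer[of "\<lambda>x. x"] G1 by (simp_all add: integral_complex_of_real)
    show "integrable M (\<lambda>\<omega>. Y \<omega> * cnj (Y \<omega>))" "(LINT \<omega>|M. Y \<omega> * cnj (Y \<omega>)) = 1"
      using transfer[of "\<lambda>x. x * cnj x"] G2
      by (simp_all add: of_real_mult[symmetric] power2_eq_square integral_complex_of_real del: of_real_mult)
    fix c
    have "(\<integral>\<^sup>+\<omega>. ennreal (exp (Re (c * Y \<omega>))) \<partial>M) = (\<integral>\<^sup>+w. ennreal (exp (Re (c * w))) \<partial>distr M borel Y)"
      by (rule nn_integral_distr[symmetric]) measurable
    also have "\<dots> = (\<integral>\<^sup>+x. ennreal (exp (Re (c * complex_of_real x))) \<partial>G)"
      unfolding d by (rule nn_integral_distr) measurable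
    also have "\<dots> = (\<integral>\<^sup>+x. ennreal (std_normal_density x) * ennreal (exp (Re c * x)) \<partial>lborel)"
      unfolding G_def by (subst nn_integral_density) auto
    also have "\<dots> = ennreal (exp ((Re c)\<^sup>2 / 2))" by (rule nn_integral_exp_std_normal)
    also have "\<dots> \<le> ennreal (exp ((norm c)\<^sup>2 / 2))"
      using abs_Re_le_cmod[of c] by (intro ennreal_leI) (auto simp: abs_le_square_iff[symmetric])
    finally show "(\<integral>\<^sup>+\<omega>. ennreal (exp (Re (c * Y \<omega>))) \<partial>M) \<le> ennreal (exp ((norm c)\<^sup>2 / 2))" .
  qed measurable
qed

section \<open>Khinchine's inequalities for sums of independent subgaussian variables\<close>

locale subgaussian_sequence = prob_space M for M :: "'w measure" +
  fixes X :: "nat \<Rightarrow> 'w \<Rightarrow> complex"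
  assumes indep: "indep_vars (\<lambda>_. borel) X {1..}"
    and std: "n \<ge> 1 \<Longrightarrow> standardized_subgaussian M (X n)"
begin

lemma X_measurable [measurable (raw)]: "n \<ge> 1 \<Longrightarrow> X n \<in> borel_measurable M"
  using std by (simp add: standardized_subgaussian_def)

lemma sum_X_measurable:
  "A \<subseteq> {1..} \<Longrightarrow> (\<lambda>\<omega>. \<Sum>n\<in>A. c n * X n \<omega>) \<in> borel_measurable M"
  by (intro borel_measurable_sum borel_measurable_times X_measurable) auto

lemma orthonormal:
  assumes "m \<ge> 1" "n \<ge> 1"
  shows "integrable M (\<lambda>\<omega>. X m \<omega> * cnj (X n \<omega>))"
    and "(LINT \<omega>|M. X m \<omega> * cnj (X n \<omega>)) = (if m = n then 1 else 0)"
proof -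
  have "integrable M (\<lambda>\<omega>. X m \<omega> * cnj (X n \<omega>)) \<and>
      (LINT \<omega>|M. X m \<omega> * cnj (X n \<omega>)) = (if m = n then 1 else 0)"
  proof (cases "m = n")
    case True
    then show ?thesis using std[OF assms(1)] by (simp add: standardized_subgaussian_def)
  next
    case False
    \<comment> \<open>Conjugation is applied to one factor only; by independence the expectation of
      the product then splits and contains the vanishing mean of \<open>X m\<close>.\<close>
    define f where "f k = (if k = m then (\<lambda>x. x) else cnj)" for k
    have "indep_vars (\<lambda>_. borel) X {m, n}"
      by (rule indep_vars_subset[OF indep]) (use assms in auto)
    then have "indep_vars (\<lambda>_. borel) (\<lambda>k \<omega>. f k (X k \<omega>)) {m, n}"
      by (rule indep_vars_compose2) (auto simp: f_def)
    moreover have "integrable M (\<lambda>\<omega>. f k (X k \<omega>))" if "k \<in> {m, n}" for k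
      using std[of k] that assms by (auto simp: f_def standardized_subgaussian_def)
    ultimately have "integrable M (\<lambda>\<omega>. \<Prod>k\<in>{m, n}. f k (X k \<omega>))"
      "(LINT \<omega>|M. (\<Prod>k\<in>{m, n}. f k (X k \<omega>))) = (\<Prod>k\<in>{m, n}. (LINT \<omega>|M. f k (X k \<omega>)))"
      by (auto intro!: indep_vars_integrable indep_vars_lebesgue_integral simp del: prod.insert)
    with False show ?thesis
      using std[OF assms(1)] by (simp add: f_def standardized_subgaussian_def)
  qed
  then show "integrable M (\<lambda>\<omega>. X m \<omega> * cnj (X n \<omega>))"
    and "(LINT \<omega>|M. X m \<omega> * cnj (X n \<omega>)) = (if m = n then 1 else 0)" by auto
qed

lemma second_moment:
  assumes "finite A" "A \<subseteq> {1..}"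
  shows "(\<integral>\<^sup>+\<omega>. ennreal ((norm (\<Sum>n\<in>A. c n * X n \<omega>))\<^sup>2) \<partial>M) = ennreal (\<Sum>n\<in>A. (norm (c n))\<^sup>2)"
  using assms by (intro nn_integral_norm_sum_orthonormal orthonormal) auto

text \<open>Independence turns the exponential of the sum into a product, and the variances add up
  in the exponent.\<close>

lemma exp_moment:
  assumes A: "finite A" "A \<subseteq> {1..}"
  shows "(\<integral>\<^sup>+\<omega>. ennreal (exp (Re (\<Sum>n\<in>A. c n * X n \<omega>))) \<partial>M) \<le> ennreal (exp ((\<Sum>n\<in>A. (norm (c n))\<^sup>2) / 2))"
proof -
  define f where "f n x = ennreal (exp (Re (c n * x)))" for n x
  have [measurable]: "f n \<in> borel_measurable borel" for n
    unfolding f_def by measurable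
  have "indep_vars (\<lambda>_. borel) X A"
    by (rule indep_vars_subset[OF indep A(2)])
  then have ind: "indep_vars (\<lambda>_. borel) (\<lambda>n \<omega>. f n (X n \<omega>)) A"
    by (rule indep_vars_compose2) auto
  have "(\<integral>\<^sup>+\<omega>. ennreal (exp (Re (\<Sum>n\<in>A. c n * X n \<omega>))) \<partial>M) = (\<integral>\<^sup>+\<omega>. (\<Prod>n\<in>A. f n (X n \<omega>)) \<partial>M)"
    unfolding f_def by (simp only: Re_sum exp_sum[OF A(1)] prod_ennreal[OF exp_ge_zero])
  also have "\<dots> = (\<Prod>n\<in>A. \<integral>\<^sup>+\<omega>. f n (X n \<omega>) \<partial>M)"
    by (rule indep_vars_nn_integral[OF A(1) ind]) auto
  also have "\<dots> \<le> (\<Prod>n\<in>A. ennreal (exp ((norm (c n))\<^sup>2 / 2)))"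
    using A std by (intro prod_mono_ennreal) (auto simp: f_def standardized_subgaussian_def)
  also have "\<dots> = ennreal (exp ((\<Sum>n\<in>A. (norm (c n))\<^sup>2) / 2))"
    by (simp add: prod_ennreal exp_sum[OF A(1)] sum_divide_distrib)
  finally show ?thesis .
qed

text \<open>Origin of the factors: \<open>2 powr q\<close> from splitting into real and imaginary
  part, \<open>q powr q\<close> from comparing a power with the exponential, 4 from the two signs of
  both parts, and \<open>exp (1 / 2)\<close> from the exponential moment at variance 1.\<close>

definition khinchine_const :: "real \<Rightarrow> real" where
  "khinchine_const q = 2 powr q * q powr q * 4 * exp (1 / 2)"

lemma khinchine_upper:
  assumes q: "0 < q" and A: "finite A" "A \<subseteq> {1..}"
  shows "(\<integral>\<^sup>+\<omega>. ennreal (norm (\<Sum>n\<in>A. c n * X n \<omega>) powr q) \<partial>M)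
    \<le> ennreal (khinchine_const q * (\<Sum>n\<in>A. (norm (c n))\<^sup>2) powr (q / 2))"
proof -
  define V where "V = (\<Sum>n\<in>A. (norm (c n))\<^sup>2)"
  have V0: "0 \<le> V" by (simp add: V_def sum_nonneg)
  show ?thesis
  proof (cases "V = 0")
    case True
    then have "c n = 0" if "n \<in> A" for n
      using A that by (auto simp: V_def sum_nonneg_eq_0_iff)
    then show ?thesis by simp
  next
    case False
    with V0 have V: "V > 0" by simp
    \<comment> \<open>Scaling to unit variance, since the bound for exponential moments is not
      homogeneous.\<close>
    define r where "r = sqrt V"
    have r: "r > 0" "r\<^sup>2 = V" using V by (auto simp: r_def)
    define T where "T u \<omega> = (\<Sum>n\<in>A. (u * c n / of_real r) * X n \<omega>)" for u \<omega>
    have T: "T u \<omega> = u * T 1 \<omega>" for u \<omega>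
      by (simp add: T_def sum_distrib_left mult.assoc)
    have S: "(\<Sum>n\<in>A. c n * X n \<omega>) = of_real r * T 1 \<omega>" for \<omega>
      using r by (simp add: T_def sum_distrib_left)
    have meas [measurable]: "T u \<in> borel_measurable M" for u
      unfolding T_def using A by (intro sum_X_measurable)
    have E: "(\<integral>\<^sup>+\<omega>. ennreal (exp (Re (T u \<omega>))) \<partial>M) \<le> ennreal (exp (1 / 2))" if "norm u = 1" for u
    proof -
      have "(\<Sum>n\<in>A. (norm (u * c n / of_real r))\<^sup>2) = 1"
        using V r that by (simp add: norm_mult norm_divide power_divide sum_divide_distrib[symmetric] V_def)
      then show ?thesis
        unfolding T_def using exp_moment[OF A, of "\<lambda>n. u * c n / of_real r"] by simp
    qed
    \<comment> \<open>The fourth roots of unity produce the exponentials of both signs of the real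
      and of the imaginary part of \<open>T 1 \<omega>\<close>.\<close>
    define U where "U = {1, -1, \<i>, - \<i>}"
    have bound: "norm (T 1 \<omega>) powr q \<le> (2 powr q * q powr q) * (\<Sum>u\<in>U. exp (Re (T u \<omega>)))" for \<omega>
    proof -
      have *: "\<bar>x\<bar> powr q \<le> q powr q * (exp x + exp (- x))" for x :: real
        using powr_le_powr_self_mult_exp[OF abs_ge_zero q, of x]
        by (rule order_trans) (auto simp: abs_if intro!: mult_left_mono)
      have "norm (T 1 \<omega>) = norm (of_real (Re (T 1 \<omega>)) + \<i> * of_real (Im (T 1 \<omega>)))"
        by (simp only: complex_eq[symmetric])
      then have "norm (T 1 \<omega>) powr q \<le> 2 powr q * (\<bar>Re (T 1 \<omega>)\<bar> powr q + \<bar>Im (T 1 \<omega>)\<bar> powr q)"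
        using norm_add_powr_le[OF q, of "of_real (Re (T 1 \<omega>))" "\<i> * of_real (Im (T 1 \<omega>))"]
        by (simp add: norm_mult)
      also have "\<dots> \<le> 2 powr q * (q powr q * (exp (Re (T 1 \<omega>)) + exp (- Re (T 1 \<omega>)))
          + q powr q * (exp (Im (T 1 \<omega>)) + exp (- Im (T 1 \<omega>))))"
        by (intro mult_left_mono add_mono *) auto
      also have "\<dots> = (2 powr q * q powr q) * (\<Sum>u\<in>U. exp (Re (T u \<omega>)))"
      proof -
        have "(\<Sum>u\<in>U. exp (Re (T u \<omega>))) = (\<Sum>u\<in>U. exp (Re (u * T 1 \<omega>)))"
          by (intro sum.cong refl) (subst T, simp)
        also have "\<dots> = exp (Re (T 1 \<omega>)) + exp (- Re (T 1 \<omega>)) + exp (- Im (T 1 \<omega>)) + exp (Im (T 1 \<omega>))"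
          by (simp add: U_def complex_eq_iff)
        finally show ?thesis by (simp add: algebra_simps)
      qed
      finally show ?thesis .
    qed
    have "(\<integral>\<^sup>+\<omega>. ennreal (norm (\<Sum>n\<in>A. c n * X n \<omega>) powr q) \<partial>M)
        \<le> (\<integral>\<^sup>+\<omega>. ennreal (r powr q * (2 powr q * q powr q)) * (\<Sum>u\<in>U. ennreal (exp (Re (T u \<omega>)))) \<partial>M)"
    proof (intro nn_integral_mono)
      fix \<omega>
      have "norm (\<Sum>n\<in>A. c n * X n \<omega>) powr q = r powr q * norm (T 1 \<omega>) powr q"
        unfolding S using r by (simp add: norm_mult powr_mult)
      also have "\<dots> \<le> r powr q * ((2 powr q * q powr q) * (\<Sum>u\<in>U. exp (Re (T u \<omega>))))"
        by (intro mult_left_mono bound) auto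
      finally show "ennreal (norm (\<Sum>n\<in>A. c n * X n \<omega>) powr q)
          \<le> ennreal (r powr q * (2 powr q * q powr q)) * (\<Sum>u\<in>U. ennreal (exp (Re (T u \<omega>))))"
        by (subst sum_ennreal, simp, subst ennreal_mult[symmetric])
          (auto intro: ennreal_leI sum_nonneg simp: mult.assoc)
    qed
    also have "\<dots> = ennreal (r powr q * (2 powr q * q powr q)) * (\<Sum>u\<in>U. \<integral>\<^sup>+\<omega>. ennreal (exp (Re (T u \<omega>))) \<partial>M)"
      by (subst nn_integral_cmult) (auto simp del: sum_ennreal intro!: arg_cong[where f
        = "(*) _"] nn_integral_sum)
    also have "\<dots> \<le> ennreal (r powr q * (2 powr q * q powr q)) * (\<Sum>u\<in>U. ennreal (exp (1 / 2)))"
      by (intro mult_left_mono sum_mono E) (auto simp: U_def)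
    also have "(\<Sum>u\<in>U. ennreal (exp (1 / 2))) = ennreal (4 * exp (1 / 2))"
      by (simp add: U_def complex_eq_iff ennreal_mult)
    also have "ennreal (r powr q * (2 powr q * q powr q)) * ennreal (4 * exp (1 / 2))
        = ennreal (khinchine_const q * r powr q)"
      by (simp add: ennreal_mult[symmetric] khinchine_const_def mult_ac)
    also have "r powr q = V powr (q / 2)"
      using V by (simp add: r_def powr_half_sqrt[symmetric] powr_powr)
    finally show ?thesis by (simp add: V_def)
  qed
qed

text \<open>A unit second moment and a bounded fourth moment force a definite share of the second
  moment onto values of moderate size inside \<open>E\<close>, where \<open>y\<^sup>2\<close> is
  controlled by \<open>y powr q\<close>. Events are included because almost sure membership in a
  space gives a uniform bound only on an event of probability close to 1.\<close>

lemma khinchine_lower: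
  assumes q: "0 < q"
  obtains \<delta> \<epsilon> where "\<delta> > 0" "\<epsilon> > 0"
    "\<And>A c E. finite A \<Longrightarrow> A \<subseteq> {1..} \<Longrightarrow> E \<in> events \<Longrightarrow> prob (space M - E) \<le> \<epsilon> \<Longrightarrow>
      ennreal (\<delta> * (\<Sum>n\<in>A. (norm (c n))\<^sup>2) powr (q / 2))
        \<le> (\<integral>\<^sup>+\<omega>. ennreal (norm (\<Sum>n\<in>A. c n * X n \<omega>) powr q) * indicator E \<omega> \<partial>M)"
proof -
  define C where "C = khinchine_const 4"
  have C: "C > 0" by (simp add: C_def khinchine_const_def)
  \<comment> \<open>Chosen such that \<open>l * (1 + 2 * C) = 1 / 4\<close>, where \<open>C\<close>
    bounds the fourth moment at unit variance.\<close>
  define l where "l = 1 / (4 * (1 + 2 * C))"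
  have l: "l > 0" using C by (simp add: l_def)
  define K where "K = (1 / l) * (1 / l) powr (q / 2)"
  have K: "K > 0" using l by (simp add: K_def)
  \<comment> \<open>Values with \<open>y\<^sup>2 \<le> l\<close> are absorbed by the constant and
    those with \<open>y\<^sup>2 \<ge> 1 / l\<close> by the fourth power; in between,
    \<open>K\<close> bounds the ratio of \<open>y\<^sup>2\<close> to
    \<open>y powr q\<close>.\<close>
  have pointwise: "y\<^sup>2 \<le> l * (1 + y powr 4) + K * y powr q" if y: "0 \<le> y" for y :: real
  proof -
    have y4: "y powr 4 = y\<^sup>2 * y\<^sup>2"
      using y by (cases "y = 0") (simp_all add: less_le flip: power_add)
    consider "y\<^sup>2 \<le> l" | "1 / l \<le> y\<^sup>2" | "l \<le> y\<^sup>2" "y\<^sup>2 \<le> 1 / l" by linarith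
    then show ?thesis
    proof cases
      case 1
      then show ?thesis using l K by (simp add: distrib_left add_increasing2)
    next
      case 2
      then have "1 * y\<^sup>2 \<le> (l * y\<^sup>2) * y\<^sup>2"
        using l by (intro mult_right_mono) (auto simp: field_simps)
      then show ?thesis using l K y4 by (simp add: distrib_left add_increasing add_increasing2 mult.assoc)
    next
      case 3
      have "y\<^sup>2 \<le> (1 / l) * (1 / l * l) powr (q / 2)" using 3 l by simp
      also have "\<dots> = K * l powr (q / 2)"
        using l by (simp only: K_def powr_mult mult.assoc)
      also have "\<dots> \<le> K * (y\<^sup>2) powr (q / 2)"
        using 3 l K q by (intro mult_left_mono powr_mono2) auto
      also have "(y\<^sup>2) powr (q / 2) = y powr q"
        using y by (cases "y = 0") (simp_all add: powr_powr flip: powr_numeral)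
      finally show ?thesis using l by (simp add: add_increasing)
    qed
  qed
  show ?thesis
  proof (rule that[of "1 / (2 * K)" "l"])
    fix A :: "nat set" and c :: "nat \<Rightarrow> complex" and E
    assume A: "finite A" "A \<subseteq> {1..}" and E [measurable]: "E \<in> events" and pE: "prob (space M - E) \<le> l"
    define V where "V = (\<Sum>n\<in>A. (norm (c n))\<^sup>2)"
    have V0: "0 \<le> V" by (simp add: V_def sum_nonneg)
    have "ennreal (1 / (2 * K) * V powr (q / 2))
        \<le> (\<integral>\<^sup>+\<omega>. ennreal (norm (\<Sum>n\<in>A. c n * X n \<omega>) powr q) * indicator E \<omega> \<partial>M)"
    proof (cases "V = 0")
      case False
      with V0 have V: "V > 0" by simp
      define r where "r = sqrt V"
      have r: "r > 0" "r\<^sup>2 = V" using V by (auto simp: r_def)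
      define T where "T \<omega> = (\<Sum>n\<in>A. (c n / of_real r) * X n \<omega>)" for \<omega>
      have S: "(\<Sum>n\<in>A. c n * X n \<omega>) = of_real r * T \<omega>" for \<omega>
        using r by (simp add: T_def sum_distrib_left)
      have meas [measurable]: "T \<in> borel_measurable M"
        unfolding T_def using A by (intro sum_X_measurable)
      have V1: "(\<Sum>n\<in>A. (norm (c n / of_real r))\<^sup>2) = 1"
        using V r by (simp add: norm_mult norm_divide power_divide sum_divide_distrib[symmetric] V_def)
      have M2: "(\<integral>\<^sup>+\<omega>. ennreal ((norm (T \<omega>))\<^sup>2) \<partial>M) = 1"
        using second_moment[OF A, of "\<lambda>n. c n / of_real r"] V1 by (simp add: T_def)
      have M4: "(\<integral>\<^sup>+\<omega>. ennreal (norm (T \<omega>) powr 4) \<partial>M) \<le> ennreal C"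
        using khinchine_upper[OF _ A, of 4 "\<lambda>n. c n / of_real r"] V1 by (simp add: T_def C_def)
      \<comment> \<open>Outside \<open>E\<close> the completed square
        \<open>y\<^sup>2 \<le> l * y powr 4 + d\<close> is used. As this set has probability at most
        \<open>l\<close>, the constant contributes at most \<open>d * l = 1 / 4\<close>.\<close>
      define d where "d = 1 / (4 * l)"
      have d: "d > 0" using l by (simp add: d_def)
      define J where "J = (\<integral>\<^sup>+\<omega>. ennreal (norm (T \<omega>) powr q) * indicator E \<omega> \<partial>M)"
      have "1 \<le> (\<integral>\<^sup>+\<omega>. ennreal l + ennreal (2 * l) * ennreal (norm (T \<omega>) powr 4)
          + ennreal d * indicator (space M - E) \<omega>
          + ennreal K * (ennreal (norm (T \<omega>) powr q) * indicator E \<omega>) \<partial>M)"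
        unfolding M2[symmetric]
      proof (intro nn_integral_mono)
        fix \<omega> assume \<omega>: "\<omega> \<in> space M"
        define y where "y = norm (T \<omega>)"
        have y: "0 \<le> y" by (simp add: y_def)
        have y4: "y powr 4 = y\<^sup>2 * y\<^sup>2"
          using y by (cases "y = 0") (simp_all add: less_le flip: power_add)
        have "0 \<le> (2 * l * y\<^sup>2 - 1)\<^sup>2" by simp
        then have "4 * l * y\<^sup>2 \<le> 4 * l * (l * y powr 4) + 1"
          unfolding y4 by (simp add: power2_diff power_mult_distrib power2_eq_square algebra_simps)
        then have Ec: "y\<^sup>2 \<le> l * y powr 4 + d"
          using l by (simp add: d_def field_simps)
        have "y\<^sup>2 \<le> l + (2 * l) * y powr 4 + d * indicator (space M - E) \<omega> + K * (y powr q * indicator E \<omega>)"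
        proof (cases "\<omega> \<in> E")
          case True
          have "0 \<le> l * y powr 4" using l by simp
          then show ?thesis using pointwise[OF y] True d by (simp add: distrib_left)
        next
          case False
          then have "indicator (space M - E) \<omega> = (1::real)" "indicator E \<omega> = (0::real)"
            using \<omega> by auto
          moreover have "0 \<le> l * y powr 4" using l by simp
          ultimately show ?thesis using Ec l by (simp only:)
        qed
        then have "ennreal (y\<^sup>2) \<le> ennreal (l + (2 * l) * y powr 4 + d * indicator (space M - E) \<omega>
          + K * (y powr q * indicator E \<omega>))"
          by (rule ennreal_leI)
        also have "\<dots> = ennreal l + ennreal (2 * l) * ennreal (y powr 4)
          + ennreal d * indicator (space M - E) \<omega>
          + ennreal K * (ennreal (y powr q) * indicator E \<omega>)"
          using l K d by (simp add: ennreal_mult ennreal_plus ennreal_indicator)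
        finally show "ennreal ((norm (T \<omega>))\<^sup>2) \<le> ennreal l + ennreal (2 * l) * ennreal (norm (T \<omega>) powr 4)
          + ennreal d * indicator (space M - E) \<omega>
          + ennreal K * (ennreal (norm (T \<omega>) powr q) * indicator E \<omega>)"
          by (simp only: y_def)
      qed
      also have "\<dots> = ennreal l + ennreal (2 * l) * (\<integral>\<^sup>+\<omega>. ennreal (norm (T \<omega>) powr 4) \<partial>M)
          + ennreal d * emeasure M (space M - E) + ennreal K * J"
        unfolding J_def by (simp add: nn_integral_add nn_integral_cmult emeasure_space_1)
      also have "\<dots> \<le> ennreal l + ennreal (2 * l) * ennreal C + ennreal d * ennreal l + ennreal K * J"
        using pE M4 by (intro add_mono mult_left_mono) (auto simp: emeasure_eq_measure intro: ennreal_leI)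
      also have "\<dots> = ennreal (l + 2 * l * C + d * l) + ennreal K * J"
        using l C d by (simp add: ennreal_mult ennreal_plus)
      \<comment> \<open>The error terms use up 1/4 + 1/4 of the second moment 1, which leaves at
        least 1/2 for \<open>K * J\<close>.\<close>
      also have "l + 2 * l * C + d * l = 1 / 2"
        proof -
        have "l * (1 + 2 * C) = 1 / 4" using C by (simp add: l_def)
        moreover have "d * l = 1 / 4" using l by (simp add: d_def)
        ultimately show ?thesis by (simp add: algebra_simps)
      qed
      finally have *: "1 \<le> ennreal (1 / 2) + ennreal K * J" .
      have J: "ennreal (1 / (2 * K)) \<le> J"
      proof (cases "J = \<infinity>")
        case False
        then obtain j where j: "J = ennreal j" "0 \<le> j" by (cases J) auto
        have "ennreal 1 \<le> ennreal (1 / 2 + K * j)"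
          using * j K by (simp add: ennreal_mult ennreal_plus)
        then have "1 \<le> 1 / 2 + K * j" using j K by (subst (asm) ennreal_le_iff) auto
        then have "1 / (2 * K) \<le> j" using K by (simp add: field_simps)
        then show ?thesis using j by (simp add: ennreal_leI)
      qed simp
      have "ennreal (1 / (2 * K) * V powr (q / 2)) = ennreal (r powr q) * ennreal (1 / (2 * K))"
        using V K by (simp add: r_def powr_half_sqrt[symmetric] powr_powr ennreal_mult[symmetric])
      also have "\<dots> \<le> ennreal (r powr q) * J" by (intro mult_left_mono J) auto
      also have "\<dots> = (\<integral>\<^sup>+\<omega>. ennreal (norm (\<Sum>n\<in>A. c n * X n \<omega>) powr q) * indicator E \<omega> \<partial>M)"
        unfolding S J_def using r
        by (subst nn_integral_cmult[symmetric]) (auto simp: norm_mult powr_mult ennreal_mult mult.assoc)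
      finally show ?thesis .
    qed simp
    then show "ennreal (1 / (2 * K) * (\<Sum>n\<in>A. (norm (c n))\<^sup>2) powr (q / 2))
        \<le> (\<integral>\<^sup>+\<omega>. ennreal (norm (\<Sum>n\<in>A. c n * X n \<omega>) powr q) * indicator E \<omega> \<partial>M)"
      by (simp add: V_def)
  qed (use K l in auto)
qed

end

lemma subgaussian_sequence:
  assumes "standard_random_sequence M X"
  shows "subgaussian_sequence M X"
proof -
  interpret prob_space M
    using assms by (simp add: standard_random_sequence_def)
  show ?thesis
    using assms unfolding standard_random_sequence_def
    by unfold_locales
      (auto intro: bernoulli_standardized steinhaus_standardized gaussian_standardized)
qed

subsection \<open>Random Dirichlet series\<close>

definition restrict_coeffs :: "nat set \<Rightarrow> dseries \<Rightarrow> dseries" where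
  "restrict_coeffs A a = (\<lambda>n. if n \<in> A then a n else 0)"

lemma restrict_coeffs_polynomial: "finite A \<Longrightarrow> restrict_coeffs A a \<in> dirichlet_polynomials"
  by (auto simp: dirichlet_polynomials_def restrict_coeffs_def elim: finite_subset[rotated])

text \<open>Tonelli interchanges the random and the deterministic integration, so that Khinchine's
  inequalities can be applied at each fixed \<open>x\<close> with coefficients
  \<open>a n * e n x\<close>. The event \<open>E\<close> is the whole space for upper bounds and a
  large event for lower bounds.\<close>

lemma random_moment:
  assumes N: "dirichlet_norm N e q" and M: "subgaussian_sequence M X"
    and A: "finite A" "A \<subseteq> {1..}"
  shows "(\<lambda>\<omega>. dirichlet_norm.moment N e q (restrict_coeffs A (randomize X \<omega> a))) \<in> borel_measurable M"
    and "E \<in> sets M \<Longrightarrow>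
      (\<integral>\<^sup>+\<omega>. dirichlet_norm.moment N e q (restrict_coeffs A (randomize X \<omega> a)) * indicator E \<omega> \<partial>M) =
      (\<integral>\<^sup>+x. (\<integral>\<^sup>+\<omega>. ennreal (norm (\<Sum>n\<in>A. (a n * e n x) * X n \<omega>) powr q) * indicator E \<omega> \<partial>M) \<partial>N)"
proof -
  interpret D: dirichlet_norm N e q by fact
  interpret R: subgaussian_sequence M X by fact
  interpret P: pair_sigma_finite M N ..
  define F where "F \<omega> x = ennreal (norm (\<Sum>n\<in>A. (a n * e n x) * X n \<omega>) powr q)" for \<omega> x
  have moment: "D.moment (restrict_coeffs A (randomize X \<omega> a)) = (\<integral>\<^sup>+x. F \<omega> x \<partial>N)" for \<omega>
  proof -
    have "D.ev (restrict_coeffs A (randomize X \<omega> a)) x = (\<Sum>n\<in>A. (a n * e n x) * X n \<omega>)" for x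
      by (subst D.ev_eq_sum[OF A]) (auto simp: restrict_coeffs_def randomize_def mult_ac intro!: sum.cong)
    then show ?thesis by (simp add: D.moment_def F_def)
  qed
  have [measurable]: "X n \<in> borel_measurable M" if "n \<in> A" for n
    using that A by (auto intro: R.X_measurable)
  have [measurable]: "(\<lambda>x. X n (fst x)) \<in> borel_measurable (M \<Otimes>\<^sub>M N)" if "n \<in> A" for n
    using that A by (intro measurable_compose[OF measurable_fst] R.X_measurable) auto
  have "(\<lambda>x. (\<Sum>n\<in>A. (a n * e n (snd x)) * X n (fst x))) \<in> borel_measurable (M \<Otimes>\<^sub>M N)"
    by (intro borel_measurable_sum borel_measurable_times) measurable
  then have F [measurable]: "(\<lambda>x. F (fst x) (snd x)) \<in> borel_measurable (M \<Otimes>\<^sub>M N)"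
    unfolding F_def by measurable
  then have F': "case_prod F \<in> borel_measurable (M \<Otimes>\<^sub>M N)"
    by (simp add: case_prod_beta')
  show "(\<lambda>\<omega>. D.moment (restrict_coeffs A (randomize X \<omega> a))) \<in> borel_measurable M"
    unfolding moment by (rule D.borel_measurable_nn_integral[OF F'])
  assume E [measurable]: "E \<in> sets M"
  have "(\<lambda>x. F (fst x) (snd x) * indicator E (fst x)) \<in> borel_measurable (M \<Otimes>\<^sub>M N)"
    by measurable
  then have FE: "(\<lambda>(\<omega>, x). F \<omega> x * indicator E \<omega>) \<in> borel_measurable (M \<Otimes>\<^sub>M N)"
    by (simp add: case_prod_beta')
  have Fx: "F \<omega> \<in> borel_measurable N" if "\<omega> \<in> space M" for \<omega>
    using measurable_compose[OF measurable_Pair1'[OF that] F'] by simp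
  have "(\<integral>\<^sup>+\<omega>. D.moment (restrict_coeffs A (randomize X \<omega> a)) * indicator E \<omega> \<partial>M) =
      (\<integral>\<^sup>+\<omega>. (\<integral>\<^sup>+x. F \<omega> x * indicator E \<omega> \<partial>N) \<partial>M)"
    unfolding moment using Fx by (intro nn_integral_cong nn_integral_multc[symmetric]) auto
  also have "\<dots> = (\<integral>\<^sup>+x. (\<integral>\<^sup>+\<omega>. F \<omega> x * indicator E \<omega> \<partial>M) \<partial>N)"
    using P.Fubini'[OF FE] by simp
  finally show "(\<integral>\<^sup>+\<omega>. D.moment (restrict_coeffs A (randomize X \<omega> a)) * indicator E \<omega> \<partial>M) =
      (\<integral>\<^sup>+x. (\<integral>\<^sup>+\<omega>. ennreal (norm (\<Sum>n\<in>A. (a n * e n x) * X n \<omega>) powr q) * indicator E \<omega> \<partial>M) \<partial>N)"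
    by (simp only: F_def)
qed

lemma random_moment_upper:
  assumes N: "dirichlet_norm N e q" and M: "subgaussian_sequence M X"
    and A: "finite A" "A \<subseteq> {1..}"
  shows "(\<integral>\<^sup>+\<omega>. dirichlet_norm.moment N e q (restrict_coeffs A (randomize X \<omega> a)) \<partial>M)
    \<le> ennreal (subgaussian_sequence.khinchine_const q * (\<Sum>n\<in>A. (norm (a n))\<^sup>2) powr (q / 2)
      * measure N (space N))"
proof -
  interpret D: dirichlet_norm N e q by fact
  interpret R: subgaussian_sequence M X by fact
  let ?C = "R.khinchine_const q"
  have C: "?C > 0" using D.q_pos by (simp add: R.khinchine_const_def)
  have "(\<integral>\<^sup>+\<omega>. D.moment (restrict_coeffs A (randomize X \<omega> a)) \<partial>M) =
      (\<integral>\<^sup>+\<omega>. D.moment (restrict_coeffs A (randomize X \<omega> a)) * indicator (space M) \<omega> \<partial>M)"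
    by (intro nn_integral_cong) auto
  also have "\<dots> = (\<integral>\<^sup>+x. (\<integral>\<^sup>+\<omega>. ennreal (norm (\<Sum>n\<in>A. (a n * e n x) * X n \<omega>) powr q)
    * indicator (space M) \<omega> \<partial>M) \<partial>N)"
    by (intro random_moment[OF N M A]) auto
  also have "\<dots> = (\<integral>\<^sup>+x. (\<integral>\<^sup>+\<omega>. ennreal (norm (\<Sum>n\<in>A. (a n * e n x) * X n \<omega>) powr q) \<partial>M) \<partial>N)"
    by (intro nn_integral_cong) auto
  also have "\<dots> \<le> (\<integral>\<^sup>+x. ennreal (?C * (\<Sum>n\<in>A. (norm (a n))\<^sup>2) powr (q / 2)) \<partial>N)"
  proof (rule nn_integral_mono_AE, use D.e_bounded in eventually_elim)
    case (elim x)
    have "(\<Sum>n\<in>A. (norm (a n * e n x))\<^sup>2) \<le> (\<Sum>n\<in>A. (norm (a n))\<^sup>2)"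
      using elim A by (intro sum_mono power_mono) (auto simp: norm_mult intro!: mult_left_le)
    then have "?C * (\<Sum>n\<in>A. (norm (a n * e n x))\<^sup>2) powr (q / 2) \<le> ?C * (\<Sum>n\<in>A. (norm (a n))\<^sup>2) powr (q / 2)"
      using C D.q_pos by (intro mult_left_mono powr_mono2 sum_nonneg) auto
    then show ?case
      by (rule order_trans[OF R.khinchine_upper[OF D.q_pos A] ennreal_leI])
  qed
  also have "\<dots> = ennreal (?C * (\<Sum>n\<in>A. (norm (a n))\<^sup>2) powr (q / 2) * measure N (space N))"
    using C by (simp add: D.emeasure_eq_measure ennreal_mult)
  finally show ?thesis .
qed

lemma norm_nat_powr_minus:
  assumes "n \<ge> 1"
  shows "norm (of_nat n powr (- s)) = real n powr - Re s"
  using assms norm_powr_real_powr[of "of_nat n" "- s"] by simp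

text \<open>By \<open>x * y \<le> x\<^sup>2 + y\<^sup>2\<close>, square summability makes
  \<open>norm (a n) * n powr - \<sigma>\<close> summable for every \<sigma> > 1/2. The first moments
  of the \<open>X n\<close> are bounded, so the sum of the norms of the random terms has finite
  expectation.\<close>

lemma random_series_converges:
  assumes M: "subgaussian_sequence M X" and a: "summable (\<lambda>n. (norm (a n))\<^sup>2)"
  shows "AE \<omega> in M. converges_on_half_plane (randomize X \<omega> a) (1 / 2)"
proof -
  interpret R: subgaussian_sequence M X by fact
  \<comment> \<open>A sequence decreasing to 1/2, so that a single null set serves all
    \<open>s\<close> in the half plane.\<close>
  define \<sigma> where "\<sigma> k = 1 / 2 + inverse (real (Suc k))" for k
  define t where "t k n = norm (a (Suc n)) * real (Suc n) powr - \<sigma> k" for k n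
  have t0: "0 \<le> t k n" for k n by (simp add: t_def)
  have t: "summable (t k)" for k
  proof (rule summable_comparison_test')
    have "summable (\<lambda>n. real n powr (- 2 * \<sigma> k))"
      by (subst summable_real_powr_iff) (simp add: \<sigma>_def)
    then have "summable (\<lambda>n. real (Suc n) powr (- 2 * \<sigma> k))" by (subst summable_Suc_iff)
    moreover have "summable (\<lambda>n. (norm (a (Suc n)))\<^sup>2)" using a by (subst summable_Suc_iff)
    ultimately show "summable (\<lambda>n. (norm (a (Suc n)))\<^sup>2 + real (Suc n) powr (- 2 * \<sigma> k))"
      by (rule summable_add[rotated])
    fix n :: nat
    define x y where "x = norm (a (Suc n))" and "y = real (Suc n) powr - \<sigma> k"
    have "y\<^sup>2 = real (Suc n) powr (- 2 * \<sigma> k)"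
      by (simp add: y_def power2_eq_square powr_add[symmetric])
    moreover have "x * y \<le> x\<^sup>2 + y\<^sup>2"
    proof -
      have "0 \<le> x * y" by (simp add: x_def y_def)
      then show ?thesis using sum_squares_bound[of x y] by (simp only: mult.assoc)
    qed
    ultimately show "norm (t k n) \<le> (norm (a (Suc n)))\<^sup>2 + real (Suc n) powr (- 2 * \<sigma> k)"
      unfolding t_def by (simp add: x_def y_def)
  qed
  define C where "C = R.khinchine_const 1"
  have C: "C \<ge> 0" by (simp add: C_def R.khinchine_const_def)
  have EX: "(\<integral>\<^sup>+\<omega>. ennreal (norm (X n \<omega>)) \<partial>M) \<le> ennreal C" if "n \<ge> 1" for n
    using R.khinchine_upper[of 1 "{n}" "\<lambda>_. 1"] that by (simp add: C_def)
  have "AE \<omega> in M. (\<Sum>n. ennreal (t k n) * ennreal (norm (X (Suc n) \<omega>))) \<noteq> \<infinity>" for k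
  proof (rule nn_integral_PInf_AE)
    show "(\<lambda>\<omega>. \<Sum>n. ennreal (t k n) * ennreal (norm (X (Suc n) \<omega>))) \<in> borel_measurable M"
      by measurable
    have "(\<integral>\<^sup>+\<omega>. (\<Sum>n. ennreal (t k n) * ennreal (norm (X (Suc n) \<omega>))) \<partial>M)
        = (\<Sum>n. ennreal (t k n) * (\<integral>\<^sup>+\<omega>. ennreal (norm (X (Suc n) \<omega>)) \<partial>M))"
      by (subst nn_integral_suminf) (auto simp: nn_integral_cmult)
    also have "\<dots> \<le> (\<Sum>n. ennreal (t k n * C))"
      using t0 C by (intro suminf_le) (auto simp: ennreal_mult intro!: mult_left_mono EX)
    also have "\<dots> < \<infinity>"
      using t0 C t[of k] by (subst suminf_ennreal2) (auto intro!: summable_mult2)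
    finally show "(\<integral>\<^sup>+\<omega>. (\<Sum>n. ennreal (t k n) * ennreal (norm (X (Suc n) \<omega>))) \<partial>M) \<noteq> \<infinity>" by simp
  qed
  then have "AE \<omega> in M. \<forall>k. (\<Sum>n. ennreal (t k n) * ennreal (norm (X (Suc n) \<omega>))) \<noteq> \<infinity>"
    by (simp add: AE_all_countable)
  then show ?thesis
  proof eventually_elim
    case (elim \<omega>)
    have sum: "summable (\<lambda>n. t k n * norm (X (Suc n) \<omega>))" for k
      using elim[rule_format, of k] t0
      by (intro summable_suminf_not_top) (auto simp: ennreal_mult)
    show ?case
      unfolding converges_on_half_plane_def
    proof (intro allI impI)
      fix s assume s: "Re s > 1 / 2"
      obtain k where k: "inverse (real (Suc k)) < Re s - 1 / 2"
        using reals_Archimedean[of "Re s - 1 / 2"] s by auto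
      have "summable (\<lambda>n. randomize X \<omega> a (Suc n) * of_nat (Suc n) powr (- s))"
      proof (rule summable_comparison_test'[OF sum[of k]])
        fix n :: nat
        have "real (Suc n) powr - Re s \<le> real (Suc n) powr - \<sigma> k"
          using k by (intro powr_mono) (auto simp: \<sigma>_def)
        then have "norm (a (Suc n)) * norm (X (Suc n) \<omega>) * real (Suc n) powr - Re s
           \<le> norm (a (Suc n)) * norm (X (Suc n) \<omega>) * real (Suc n) powr - \<sigma> k"
          by (intro mult_left_mono) auto
        then show "norm (randomize X \<omega> a (Suc n) * of_nat (Suc n) powr (- s)) \<le> t k n * norm (X (Suc n) \<omega>)"
          using norm_nat_powr_minus[of "Suc n" s]
          by (simp add: randomize_def norm_mult t_def mult_ac del: of_nat_Suc)
      qed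
      then show "summable (\<lambda>n. randomize X \<omega> a n * of_nat n powr (- s))"
        by (subst (asm) summable_Suc_iff)
    qed
  qed
qed

section \<open>Square summable coefficients give random elements of the Bergman space\<close>

lemma square_summable_imp_random_bergman:
  assumes M: "subgaussian_sequence M X" and \<alpha>: "\<alpha> > -1" and q: "0 < q"
    and a: "summable (\<lambda>n. (norm (a n))\<^sup>2)"
  shows "AE \<omega> in M. randomize X \<omega> a \<in> bergman_space q \<alpha>"
proof -
  note N = dirichlet_norm_bergman[OF \<alpha> q]
  interpret D: dirichlet_norm "bergman_product \<alpha>" bergman_basis q by (rule N)
  interpret R: subgaussian_sequence M X by fact
  define b where "b = R.khinchine_const q * measure (bergman_product \<alpha>) (space (bergman_product \<alpha>))"
  have b: "b \<ge> 0" using q by (simp add: b_def R.khinchine_const_def)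
  \<comment> \<open>By the Cauchy criterion, blocks far enough out have expected moment at most
    \<open>(1 / 4) ^ k\<close>; multiplied by the weights \<open>2 ^ k\<close> this is still
    summable.\<close>
  have "\<exists>N. \<forall>m\<ge>N. \<forall>n. b * (\<Sum>i\<in>{m..<n}. (norm (a i))\<^sup>2) powr (q / 2) \<le> (1 / 4) ^ k" for k
  proof -
    define \<epsilon> where "\<epsilon> = ((1 / 4) ^ k / (b + 1)) powr (2 / q)"
    have "\<epsilon> > 0" using b by (simp add: \<epsilon>_def)
    then obtain N where N: "\<And>m n. m \<ge> N \<Longrightarrow> norm (\<Sum>i\<in>{m..<n}. (norm (a i))\<^sup>2) < \<epsilon>"
      using a[unfolded summable_Cauchy] by blast
    have "b * (\<Sum>i\<in>{m..<n}. (norm (a i))\<^sup>2) powr (q / 2) \<le> (1 / 4) ^ k" if "m \<ge> N" for m n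
    proof -
      have "(\<Sum>i\<in>{m..<n}. (norm (a i))\<^sup>2) powr (q / 2) \<le> \<epsilon> powr (q / 2)"
        using N[OF that, of n] q by (intro powr_mono2) (auto intro: sum_nonneg)
      also have "\<dots> = (1 / 4) ^ k / (b + 1)"
        using b q by (simp add: \<epsilon>_def powr_powr)
      finally have "b * (\<Sum>i\<in>{m..<n}. (norm (a i))\<^sup>2) powr (q / 2) \<le> b * ((1 / 4) ^ k / (b + 1))"
        using b by (intro mult_left_mono) auto
      also have "\<dots> = (1 / 4) ^ k * (b / (b + 1))" by simp
      also have "\<dots> \<le> (1 / 4) ^ k"
        using b by (intro mult_left_le) auto
      finally show ?thesis .
    qed
    then show ?thesis by blast
  qed
  then obtain N' where N': "\<And>k m n. m \<ge> N' k \<Longrightarrow> b * (\<Sum>i\<in>{m..<n}. (norm (a i))\<^sup>2) powr (q / 2) \<le> (1 / 4) ^ k"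
    by metis
  \<comment> \<open>Summing the thresholds makes \<open>L\<close> monotone and keeps it above
    \<open>N' k\<close>; the term \<open>Suc k\<close> lets it exceed \<open>k\<close>, so that
    every coefficient is eventually included.\<close>
  define L where "L k = Suc k + (\<Sum>i\<le>k. N' i)" for k
  have L_Suc: "L k \<le> L (Suc k)" for k by (simp add: L_def)
  have L_gt: "k < L k" for k by (simp add: L_def)
  have L_ge: "N' k \<le> L k" for k
    using member_le_sum[of k "{..k}" N'] by (simp add: L_def)
  define S where "S \<omega> k = restrict_coeffs {1..<L k} (randomize X \<omega> a)" for \<omega> k
  define B where "B k = {L k..<L (Suc k)}" for k
  have B: "finite (B k)" "B k \<subseteq> {1..}" for k
    using L_gt[of k] by (auto simp: B_def)
  have diff: "(\<lambda>n. S \<omega> (Suc k) n - S \<omega> k n) = restrict_coeffs (B k) (randomize X \<omega> a)" for \<omega> k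
    using L_gt[of k] L_Suc[of k] by (auto simp: fun_eq_iff S_def B_def restrict_coeffs_def)
  \<comment> \<open>Chosen such that \<open>l powr q = 1 / 2\<close>, hence the weights
    \<open>(1 / l ^ k) powr q\<close> are \<open>2 ^ k\<close>.\<close>
  define l where "l = (1 / 2 :: real) powr (1 / q)"
  have l: "0 < l" "l < 1"
    using q powr_less_mono2[of "1 / q" "1 / 2" 1] by (auto simp: l_def)
  have lk: "(1 / l ^ k) powr q = 2 ^ k" for k
  proof -
    have "l ^ k = (1 / 2) powr (k / q)"
      by (simp add: l_def powr_power)
    then have "(l ^ k) powr q = (1 / 2) powr real k"
      using q by (simp only: powr_powr) simp
    moreover have "(1 / l ^ k) powr q = 1 / (l ^ k) powr q"
      by (simp only: powr_divide) simp
    moreover have "(1 / 2 :: real) powr real k = (1 / 2) ^ k"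
      by (rule powr_realpow) simp
    ultimately show ?thesis by (simp add: power_one_over)
  qed
  have meas [measurable]: "(\<lambda>\<omega>. D.moment (restrict_coeffs (B k) (randomize X \<omega> a)))
    \<in> borel_measurable M" for k
    by (rule random_moment[OF N M B])
  have "AE \<omega> in M. (\<Sum>k. ennreal (2 ^ k) * D.moment (restrict_coeffs (B k) (randomize X \<omega> a))) \<noteq> \<infinity>"
  proof (rule nn_integral_PInf_AE)
    have "(\<integral>\<^sup>+\<omega>. (\<Sum>k. ennreal (2 ^ k) * D.moment (restrict_coeffs (B k) (randomize X \<omega> a))) \<partial>M)
        = (\<Sum>k. ennreal (2 ^ k) * (\<integral>\<^sup>+\<omega>. D.moment (restrict_coeffs (B k) (randomize X \<omega> a)) \<partial>M))"
      by (subst nn_integral_suminf) (auto simp: nn_integral_cmult)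
    also have "\<dots> \<le> (\<Sum>k. ennreal ((1 / 2) ^ k))"
    proof (intro suminf_le)
      fix k
      have "(\<integral>\<^sup>+\<omega>. D.moment (restrict_coeffs (B k) (randomize X \<omega> a)) \<partial>M) \<le> ennreal ((1 / 4) ^ k)"
        using N'[OF L_ge[of k], of "L (Suc k)"]
        by (intro order_trans[OF random_moment_upper[OF N M B]] ennreal_leI) (simp add: b_def B_def mult_ac)
      then have "ennreal (2 ^ k) * (\<integral>\<^sup>+\<omega>. D.moment (restrict_coeffs (B k) (randomize X \<omega> a)) \<partial>M)
        \<le> ennreal (2 ^ k) * ennreal ((1 / 4) ^ k)"
        by (intro mult_left_mono) auto
      also have "\<dots> = ennreal ((1 / 2) ^ k)"
        by (simp add: ennreal_mult[symmetric] power_mult_distrib[symmetric])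
      finally show "ennreal (2 ^ k) * (\<integral>\<^sup>+\<omega>. D.moment (restrict_coeffs (B k) (randomize X \<omega> a)) \<partial>M)
        \<le> ennreal ((1 / 2) ^ k)" .
    qed auto
    also have "\<dots> < \<infinity>"
      by (subst suminf_ennreal2) (auto intro!: summable_geometric)
    finally show "(\<integral>\<^sup>+\<omega>. (\<Sum>k. ennreal (2 ^ k) * D.moment (restrict_coeffs (B k) (randomize X \<omega> a))) \<partial>M) \<noteq> \<infinity>"
      by simp
  qed measurable
  with random_series_converges[OF M a] show ?thesis
  proof eventually_elim
    case (elim \<omega>)
    have S: "S \<omega> k \<in> dirichlet_polynomials" for k
      unfolding S_def by (rule restrict_coeffs_polynomial) simp
    have "\<forall>\<epsilon>>0. \<exists>K. \<forall>j\<ge>K. \<forall>k\<ge>K. D.nrm (\<lambda>n. S \<omega> j n - S \<omega> k n) < \<epsilon>"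
      by (rule D.summable_moments_imp_Cauchy_nrm[OF S l])
        (use elim(2) in \<open>simp add: lk diff less_top[symmetric]\<close>)
    then have "\<forall>\<epsilon>>0. \<exists>K. \<forall>j\<ge>K. \<forall>k\<ge>K. bergman_norm q \<alpha> (\<lambda>n. S \<omega> j n - S \<omega> k n) < \<epsilon>"
      by (simp add: bergman_norm_eq_nrm[OF \<alpha> q] dirichlet_polynomials_diff S)
    moreover have "(\<lambda>k. S \<omega> k n) \<longlonglongrightarrow> randomize X \<omega> a n" if "n \<ge> 1" for n
    proof (rule tendsto_eventually, rule eventually_sequentiallyI)
      fix k assume "n \<le> k"
      then show "S \<omega> k n = randomize X \<omega> a n"
        using L_gt[of k] that by (simp add: S_def restrict_coeffs_def)
    qed
    ultimately show ?case
      using elim(1) S unfolding bergman_space_def dirichlet_completion_def by blast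
  qed
qed

text \<open>On a probability space \<open>y\<^sup>2 \<le> 1 + y powr p\<close> bounds the second
  moment by the \<open>p\<close>-th. By Parseval this bounds the square sums of the approximating
  polynomials uniformly, and the bound passes to the limit in every finite partial sum.\<close>

lemma hardy_space_imp_square_summable:
  assumes p: "p \<ge> 2" and a: "a \<in> hardy_space p"
  shows "summable (\<lambda>n. (norm (a n))\<^sup>2)"
proof -
  have p0: "0 < p" using p by simp
  interpret D: dirichlet_norm torus_measure bohr_monomial p by (rule dirichlet_norm_torus[OF p0])
  interpret T: prob_space torus_measure by (rule prob_space_torus)
  obtain P where P: "\<And>k. P k \<in> dirichlet_polynomials"
    and C: "\<forall>\<epsilon>>0. \<exists>K. \<forall>j\<ge>K. \<forall>k\<ge>K. D.nrm (\<lambda>n. P j n - P k n) < \<epsilon>"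
    and lim: "\<And>n. n \<ge> 1 \<Longrightarrow> (\<lambda>k. P k n) \<longlonglongrightarrow> a n"
    using a unfolding hardy_space_def dirichlet_completion_def hardy_norm_eq_nrm[OF p0] by blast
  obtain B K where B: "\<And>k. k \<ge> K \<Longrightarrow> D.moment (P k) \<le> ennreal B"
    using D.Cauchy_nrm_imp_bounded_moment[OF P C] by blast
  define B' where "B' = 1 + max B 0"
  have bound: "(\<Sum>n\<in>{1..<m}. (norm (P k n))\<^sup>2) \<le> B'" if k: "k \<ge> K" for k m
  proof -
    obtain L where L: "\<And>z. D.ev (P k) z = (\<Sum>n\<in>{1..<L}. P k n * bohr_monomial n z)" "\<And>n. n \<ge> L \<Longrightarrow> P k n = 0"
      using D.ev_poly[OF P] by blast
    have "(\<Sum>n\<in>{1..<m}. (norm (P k n))\<^sup>2) \<le> (\<Sum>n\<in>{1..<max m L}. (norm (P k n))\<^sup>2)"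
      by (intro sum_mono2) auto
    also have "\<dots> = (\<Sum>n\<in>{1..<L}. (norm (P k n))\<^sup>2)"
      using L(2) by (intro sum.mono_neutral_right) auto
    finally have "ennreal (\<Sum>n\<in>{1..<m}. (norm (P k n))\<^sup>2) \<le> ennreal (\<Sum>n\<in>{1..<L}. (norm (P k n))\<^sup>2)"
      by (rule ennreal_leI)
    also have "\<dots> = (\<integral>\<^sup>+z. ennreal ((norm (D.ev (P k) z))\<^sup>2) \<partial>torus_measure)"
      unfolding L(1)
    proof (rule nn_integral_norm_sum_orthonormal[symmetric])
      fix i j assume ij: "i \<in> {1..<L}" "j \<in> {1..<L}"
      have bounded: "AE z in torus_measure. norm (bohr_monomial i z * cnj (bohr_monomial j z)) \<le> 1"
        using AE_torus by eventually_elim (simp add: norm_mult norm_bohr_monomial)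
      show "integrable torus_measure (\<lambda>z. bohr_monomial i z * cnj (bohr_monomial j z))"
        by (rule D.integrable_const_bound[OF bounded]) measurable
      show "(LINT z|torus_measure. bohr_monomial i z * cnj (bohr_monomial j z)) = (if i = j then 1 else 0)"
      proof (cases "i = j")
        case True
        have "(LINT z|torus_measure. bohr_monomial i z * cnj (bohr_monomial i z)) = (LINT z|torus_measure. 1)"
        proof (rule integral_cong_AE)
          show "AE z in torus_measure. bohr_monomial i z * cnj (bohr_monomial i z) = 1"
            using AE_torus by eventually_elim (simp add: complex_norm_square[symmetric] norm_bohr_monomial)
        qed measurable
        with True show ?thesis using prob_space.prob_space[OF prob_space_torus] by simp
      next
        case False
        then show ?thesis using integral_bohr_monomial_orthogonal[of i j] ij by simp
      qed
    qed simp
    also have "\<dots> \<le> (\<integral>\<^sup>+z. 1 + ennreal (norm (D.ev (P k) z) powr p) \<partial>torus_measure)"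
    proof (intro nn_integral_mono)
      fix z
      define y where "y = norm (D.ev (P k) z)"
      have "y\<^sup>2 \<le> 1 + y powr p"
      proof (cases "y \<le> 1")
        case True
        then have "y\<^sup>2 \<le> 1" by (simp add: y_def power_le_one)
        then show ?thesis by (simp add: add_increasing2)
      next
        case False
        then have "y powr 2 \<le> y powr p" using p by (intro powr_mono) auto
        then show ?thesis using False by simp
      qed
      then have "ennreal (y\<^sup>2) \<le> ennreal (1 + y powr p)" by (rule ennreal_leI)
      then show "ennreal ((norm (D.ev (P k) z))\<^sup>2) \<le> 1 + ennreal (norm (D.ev (P k) z) powr p)"
        by (simp add: y_def ennreal_plus)
    qed
    also have "\<dots> = 1 + D.moment (P k)"
      unfolding D.moment_def by (subst nn_integral_add) (auto simp: T.emeasure_space_1[simplified])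
    also have "\<dots> \<le> 1 + ennreal (max B 0)"
      using B[OF k] by (intro add_left_mono order_trans[OF B[OF k]] ennreal_leI) auto
    also have "\<dots> = ennreal B'" by (simp add: B'_def ennreal_plus)
    finally show ?thesis by (subst (asm) ennreal_le_iff) (auto simp: B'_def)
  qed
  have "(\<Sum>n\<in>{1..<m}. (norm (a n))\<^sup>2) \<le> B'" for m
  proof (rule LIMSEQ_le_const2)
    show "(\<lambda>k. \<Sum>n\<in>{1..<m}. (norm (P k n))\<^sup>2) \<longlonglongrightarrow> (\<Sum>n\<in>{1..<m}. (norm (a n))\<^sup>2)"
      by (intro tendsto_sum tendsto_power tendsto_norm lim) auto
  qed (use bound in auto)
  moreover have "(\<Sum>n<m. (norm (a (Suc n)))\<^sup>2) = (\<Sum>n\<in>{1..<Suc m}. (norm (a n))\<^sup>2)" for m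
    unfolding One_nat_def sum.shift_bounds_Suc_ivl by (simp add: lessThan_atLeast0)
  ultimately have "(\<Sum>n<m. (norm (a (Suc n)))\<^sup>2) \<le> B'" for m
    by (simp only:)
  then have "summable (\<lambda>n. (norm (a (Suc n)))\<^sup>2)"
    by (intro summableI_nonneg_bounded) auto
  then show ?thesis by (subst (asm) summable_Suc_iff)
qed

subsection \<open>Extraction of coefficients of a given weight\<close>

text \<open>
  The weights \<open>j div 2 + 1\<close> tend to infinity and agree on the pairs \<open>2 i, 2 i + 1\<close>. Hence the level
  sets are finite, and the weight is constant on each of the products considered below.
\<close>

definition prime_weight :: "nat \<Rightarrow> nat" where
  "prime_weight j = j div 2 + 1"

text \<open>The completely additive function extending \<open>prime_weight\<close>: the degree of a
  Bohr monomial along the curve \<open>\<lambda>w j. w ^ prime_weight j\<close>.\<close>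

definition weight :: "nat \<Rightarrow> nat" where
  "weight n = (\<Sum>j | nth_prime j dvd n. prime_weight j * multiplicity (nth_prime j) n)"

lemma bohr_monomial_weight: "bohr_monomial n (\<lambda>j. w ^ prime_weight j) = w ^ weight n"
  unfolding bohr_monomial_def weight_def power_sum by (simp only: power_mult)

lemma weight_1 [simp]: "weight (Suc 0) = 0"
  unfolding weight_def by (rule sum.neutral) (auto dest: not_prime_unit[rotated])

text \<open>Additivity is inherited from the multiplicativity of Bohr monomials, evaluated on the
  curve at \<open>w = 2\<close>, where exponents can be compared.\<close>

lemma weight_mult:
  assumes "m \<ge> 1" "n \<ge> 1"
  shows "weight (m * n) = weight m + weight n"
proof -
  have "(2::complex) ^ weight (m * n) = 2 ^ (weight m + weight n)"
    using bohr_monomial_mult[OF assms, of "\<lambda>j. 2 ^ prime_weight j"]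
    unfolding bohr_monomial_weight power_add .
  then have "norm ((2::complex) ^ weight (m * n)) = norm ((2::complex) ^ (weight m + weight n))"
    by (rule arg_cong)
  then show ?thesis by (simp only: norm_power) simp
qed

lemma weight_nth_prime [simp]: "weight (nth_prime j) = prime_weight j"
proof -
  have "(2::complex) ^ weight (nth_prime j) = 2 ^ prime_weight j"
    unfolding bohr_monomial_weight[symmetric] by simp
  then have "norm ((2::complex) ^ weight (nth_prime j)) = norm ((2::complex) ^ prime_weight j)"
    by (rule arg_cong)
  then show ?thesis by (simp only: norm_power) simp
qed

definition weight_level :: "nat \<Rightarrow> nat set" where
  "weight_level M = {n. n \<ge> 1 \<and> weight n = M}"

text \<open>A prime factor of \<open>n\<close> has weight at most \<open>M\<close>, so its index is
  below \<open>2 * M\<close>, and the number of prime factors, counted with multiplicity, is at most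
  \<open>weight n\<close>. Finiteness of the levels follows.\<close>

lemma le_power_weight:
  assumes "n \<ge> 1" "weight n \<le> M"
  shows "n \<le> nth_prime (2 * M) ^ weight n"
  using assms
proof (induction n rule: less_induct)
  case (less n)
  show ?case
  proof (cases "n = 1")
    case False
    with less.prems obtain r where "prime r" "r dvd n"
      using prime_factor_nat by blast
    then obtain j k where n: "n = nth_prime j * k"
      by (metis prime_eq_nth_prime dvdE)
    have k: "k \<ge> 1" using n less.prems by (cases k) auto
    have pj: "nth_prime j \<ge> 1" using prime_ge_1_nat by simp
    have W: "weight n = prime_weight j + weight k"
      unfolding n using weight_mult[OF pj k] by simp
    have "0 < prime_weight j" by (simp add: prime_weight_def)
    have "k < n"
      using n k prime_gt_1_nat[OF prime_nth_prime[of j]] by simp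
    then have IH: "k \<le> nth_prime (2 * M) ^ weight k"
      using less.IH[of k] k W less.prems by simp
    have "j \<le> 2 * M" using W less.prems unfolding prime_weight_def by linarith
    then have "nth_prime j \<le> nth_prime (2 * M)"
      using strict_mono_nth_prime by (simp add: strict_mono_less_eq)
    also have "\<dots> \<le> nth_prime (2 * M) ^ prime_weight j"
      using prime_ge_1_nat[OF prime_nth_prime[of "2
        * M"]] by (intro self_le_power) (auto simp: prime_weight_def)
    finally show ?thesis
      unfolding W power_add[of _ "prime_weight j"] using IH n by (simp add: mult_le_mono)
  qed simp
qed

lemma finite_weight_level: "finite (weight_level M)"
proof (rule finite_subset)
  show "weight_level M \<subseteq> {..nth_prime (2 * M) ^ M}"
    using le_power_weight by (auto simp: weight_level_def)
qed simp

lemma weight_level_subset: "weight_level M \<subseteq> {1..}"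
  by (auto simp: weight_level_def)

lemma borel_measurable_bohr_polynomial:
  "(\<lambda>x. \<Sum>n\<in>A. c n * bohr_monomial n (snd x) * fst x ^ k n)
    \<in> borel_measurable (circle_measure \<Otimes>\<^sub>M torus_measure)"
  by (intro borel_measurable_sum borel_measurable_times borel_measurable_power borel_measurable_const
      measurable_compose[OF measurable_snd measurable_bohr_monomial]) measurable

text \<open>The one-variable coefficient bound along the curves \<open>w \<mapsto> (w\<^sup>e\<^sup>(\<^sup>j\<^sup>) z\<^sub>j)\<^sub>j\<close>, where \<open>e\<close> are the weights.\<close>

lemma torus_weight_level_bound:
  assumes q: "0 < q" and A: "finite A" "A \<subseteq> {1..}"
  shows "(\<integral>\<^sup>+z. ennreal (norm (\<Sum>n\<in>A \<inter> weight_level M. c n * bohr_monomial n z) powr q) \<partial>torus_measure)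
    \<le> of_nat (M + 1) * (\<integral>\<^sup>+z. ennreal (norm (\<Sum>n\<in>A. c n * bohr_monomial n z) powr q) \<partial>torus_measure)"
proof -
  interpret T: prob_space torus_measure by (rule prob_space_torus)
  interpret P: pair_sigma_finite circle_measure torus_measure
    by (intro pair_sigma_finite.intro prob_space_imp_sigma_finite prob_space_circle prob_space_torus)
  \<comment> \<open>\<open>M\<close> is inserted so that the coefficient bound also applies when no
    \<open>n\<close> in \<open>A\<close> has weight \<open>M\<close>.\<close>
  define K where "K = insert M (weight ` A)"
  define d where "d z k = (\<Sum>n\<in>{n \<in> A. weight n = k}. c n * bohr_monomial n z)" for z k
  define F where "F w z = (\<Sum>n\<in>A. c n * bohr_monomial n z * w ^ weight n)" for w z
  have K: "finite K" "M \<in> K" using A by (auto simp: K_def)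
  have F: "(\<Sum>k\<in>K. d z k * w ^ k) = F w z" for w z
  proof -
    have "(\<Sum>k\<in>K. d z k * w ^ k) = (\<Sum>k\<in>K. \<Sum>n\<in>{n \<in> A. weight n = k}. c n * bohr_monomial n z * w ^ weight n)"
      by (intro sum.cong refl) (simp add: d_def sum_distrib_right)
    also have "\<dots> = F w z"
      unfolding F_def using A by (intro sum.group) (auto simp: K_def)
    finally show ?thesis .
  qed
  have F1: "F w z = (\<Sum>n\<in>A. c n * bohr_monomial n (\<lambda>j. w ^ prime_weight j * z j))" for w z
    by (simp add: F_def bohr_monomial_rotate bohr_monomial_weight mult_ac)
  have AM: "A \<inter> weight_level M = {n \<in> A. weight n = M}"
    using A by (auto simp: weight_level_def)
  have Fm [measurable]: "(\<lambda>x. F (fst x) (snd x)) \<in> borel_measurable (circle_measure \<Otimes>\<^sub>M torus_measure)"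
    unfolding F_def by (rule borel_measurable_bohr_polynomial)
  have Fpair: "(\<lambda>(w, z). ennreal (norm (F w z) powr q)) \<in> borel_measurable (circle_measure \<Otimes>\<^sub>M torus_measure)"
    unfolding case_prod_beta' by measurable
  have Fw: "(\<lambda>w. F w z) \<in> borel_measurable circle_measure" for z
    unfolding F_def by measurable
  have meas: "(\<lambda>z. ennreal (norm (\<Sum>n\<in>A. c n * bohr_monomial n z) powr q)) \<in> borel_measurable torus_measure"
    by measurable
  have "(\<integral>\<^sup>+z. ennreal (norm (\<Sum>n\<in>A \<inter> weight_level M. c n * bohr_monomial n z) powr q) \<partial>torus_measure)
      \<le> (\<integral>\<^sup>+z. of_nat (M + 1) * (\<integral>\<^sup>+w. ennreal (norm (F w z) powr q) \<partial>circle_measure) \<partial>torus_measure)"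
  proof (intro nn_integral_mono)
    fix z
    show "ennreal (norm (\<Sum>n\<in>A \<inter> weight_level M. c n * bohr_monomial n z) powr q)
      \<le> of_nat (M + 1) * (\<integral>\<^sup>+w. ennreal (norm (F w z) powr q) \<partial>circle_measure)"
      using coefficient_powr_le_nn_integral_circle[OF q K, of "d z", unfolded F, unfolded d_def]
        unfolding AM .
  qed
  also have "\<dots> = of_nat (M + 1) * (\<integral>\<^sup>+z. (\<integral>\<^sup>+w. ennreal (norm (F w z) powr q) \<partial>circle_measure)
    \<partial>torus_measure)"
  proof (rule nn_integral_cmult)
    have "(\<lambda>(z, w). ennreal (norm (F w z) powr q)) \<in> borel_measurable (torus_measure \<Otimes>\<^sub>M circle_measure)"
      using measurable_pair_swap[OF Fpair] by (simp add: case_prod_beta')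
    then show "(\<lambda>z. \<integral>\<^sup>+w. ennreal (norm (F w z) powr q) \<partial>circle_measure) \<in> borel_measurable torus_measure"
      by (rule sigma_finite_measure.borel_measurable_nn_integral[OF prob_space_imp_sigma_finite[OF
        prob_space_circle]])
  qed
  also have "(\<integral>\<^sup>+z. (\<integral>\<^sup>+w. ennreal (norm (F w z) powr q) \<partial>circle_measure) \<partial>torus_measure)
      = (\<integral>\<^sup>+w. (\<integral>\<^sup>+z. ennreal (norm (F w z) powr q) \<partial>torus_measure) \<partial>circle_measure)"
    by (rule P.Fubini'[OF Fpair])
  also have "\<dots> = (\<integral>\<^sup>+w. (\<integral>\<^sup>+z. ennreal (norm (\<Sum>n\<in>A. c n
    * bohr_monomial n z) powr q) \<partial>torus_measure) \<partial>circle_measure)"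
  \<comment> \<open>For fixed \<open>w\<close> on the circle, \<open>F w\<close> is the polynomial
    composed with a rotation of the torus, so the inner integral does not depend on
    \<open>w\<close>.\<close>
  proof (rule nn_integral_cong_AE, use AE_circle in eventually_elim)
    fix w :: complex assume w: "norm w = 1"
    show "(\<integral>\<^sup>+z. ennreal (norm (F w z) powr q) \<partial>torus_measure)
        = (\<integral>\<^sup>+z. ennreal (norm (\<Sum>n\<in>A. c n * bohr_monomial n z) powr q) \<partial>torus_measure)"
      unfolding F1 by (rule nn_integral_torus_rotate[OF meas]) (simp add: norm_power w)
  qed
  also have "\<dots> = (\<integral>\<^sup>+z. ennreal (norm (\<Sum>n\<in>A. c n * bohr_monomial n z) powr q) \<partial>torus_measure)"
    using prob_space.emeasure_space_1[OF prob_space_circle] by simp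
  finally show ?thesis .
qed

text \<open>For fixed \<sigma> the factors \<open>n powr - \<sigma>\<close> are absorbed into the
  coefficients, and the torus bound is integrated over \<sigma>.\<close>

lemma bergman_weight_level_bound:
  assumes \<alpha>: "\<alpha> > -1" and q: "0 < q" and P: "P \<in> dirichlet_polynomials"
  shows "dirichlet_norm.moment (bergman_product \<alpha>) bergman_basis q (restrict_coeffs (weight_level M) P)
    \<le> of_nat (M + 1) * dirichlet_norm.moment (bergman_product \<alpha>) bergman_basis q P"
proof -
  interpret D: dirichlet_norm "bergman_product \<alpha>" bergman_basis q
    by (rule dirichlet_norm_bergman[OF \<alpha> q])
  interpret T: prob_space torus_measure by (rule prob_space_torus)
  obtain K where K: "\<And>x. D.ev P x = (\<Sum>n\<in>{1..<K}. P n * bergman_basis n x)" "\<And>n. n \<ge> K \<Longrightarrow> P n = 0"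
    using D.ev_poly[OF P] by blast
  define c where "c \<sigma> n = P n * of_real (real n powr - \<sigma>)" for \<sigma> n
  have e1: "D.ev P (\<sigma>, z) = (\<Sum>n\<in>{1..<K}. c \<sigma> n * bohr_monomial n z)" for \<sigma> z
    unfolding K by (simp add: bergman_basis_def c_def mult.assoc)
  have "D.ev (restrict_coeffs (weight_level M) P) x
    = (\<Sum>n\<in>{1..<K} \<inter> weight_level M. P n * bergman_basis n x)" for x
  proof -
    have "D.ev (restrict_coeffs (weight_level M) P) x
      = (\<Sum>n\<in>{1..<K} \<inter> weight_level M. restrict_coeffs (weight_level M) P n * bergman_basis n x)"
      using K(2) by (intro D.ev_eq_sum) (auto simp: restrict_coeffs_def not_less)
    also have "\<dots> = (\<Sum>n\<in>{1..<K} \<inter> weight_level M. P n * bergman_basis n x)"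
      by (intro sum.cong) (auto simp: restrict_coeffs_def)
    finally show ?thesis .
  qed
  then have e2: "D.ev (restrict_coeffs (weight_level M) P) (\<sigma>, z)
      = (\<Sum>n\<in>{1..<K} \<inter> weight_level M. c \<sigma> n * bohr_monomial n z)" for \<sigma> z
    by (simp add: bergman_basis_def c_def mult.assoc)
  have moment: "D.moment R = (\<integral>\<^sup>+\<sigma>. (\<integral>\<^sup>+z. ennreal (norm (D.ev R (\<sigma>, z)) powr q) \<partial>torus_measure)
    \<partial>bergman_measure \<alpha>)" for R
    unfolding D.moment_def by (rule T.nn_integral_fst[symmetric]) measurable
  have meas: "(\<lambda>\<sigma>. \<integral>\<^sup>+z. ennreal (norm (D.ev P (\<sigma>, z)) powr q) \<partial>torus_measure)
    \<in> borel_measurable (bergman_measure \<alpha>)"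
    by (rule T.borel_measurable_nn_integral_fst) measurable
  have "D.moment (restrict_coeffs (weight_level M) P)
      \<le> (\<integral>\<^sup>+\<sigma>. of_nat (M + 1) * (\<integral>\<^sup>+z. ennreal (norm (D.ev P (\<sigma>, z)) powr q) \<partial>torus_measure)
        \<partial>bergman_measure \<alpha>)"
    unfolding moment e1 e2 by (intro nn_integral_mono torus_weight_level_bound q) auto
  also have "\<dots> = of_nat (M + 1) * D.moment P"
    unfolding moment[of P] by (rule nn_integral_cmult[OF meas])
  finally show ?thesis .
qed

text \<open>A level involves finitely many coefficients, so coefficientwise convergence gives
  pointwise convergence of the projected polynomials, and Fatou's lemma carries the bound over to
  \<open>b\<close>. The bound \<open>B\<close> is a natural number so that it can index countably
  many events.\<close>

lemma bergman_space_imp_weight_level_bounded: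
  assumes \<alpha>: "\<alpha> > -1" and q: "0 < q" and b: "b \<in> bergman_space q \<alpha>"
  shows "\<exists>B::nat. \<forall>M. dirichlet_norm.moment (bergman_product \<alpha>) bergman_basis q (restrict_coeffs
    (weight_level M) b)
    \<le> of_nat (M + 1) * of_nat B"
proof -
  interpret D: dirichlet_norm "bergman_product \<alpha>" bergman_basis q
    by (rule dirichlet_norm_bergman[OF \<alpha> q])
  obtain P where P: "\<And>k. P k \<in> dirichlet_polynomials"
    and C: "\<forall>\<epsilon>>0. \<exists>K. \<forall>j\<ge>K. \<forall>k\<ge>K. bergman_norm q \<alpha> (\<lambda>n. P j n - P k n) < \<epsilon>"
    and lim: "\<And>n. n \<ge> 1 \<Longrightarrow> (\<lambda>k. P k n) \<longlonglongrightarrow> b n"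
    using b unfolding bergman_space_def dirichlet_completion_def by blast
  have C': "\<forall>\<epsilon>>0. \<exists>K. \<forall>j\<ge>K. \<forall>k\<ge>K. D.nrm (\<lambda>n. P j n - P k n) < \<epsilon>"
    using C by (simp add: bergman_norm_eq_nrm[OF \<alpha> q] dirichlet_polynomials_diff P)
  obtain B K where B: "\<And>k. k \<ge> K \<Longrightarrow> D.moment (P k) \<le> ennreal B"
    using D.Cauchy_nrm_imp_bounded_moment[OF P C'] by blast
  obtain B' :: nat where B': "B \<le> real B'"
    using real_arch_simple by blast
  have BB: "D.moment (P k) \<le> of_nat B'" if "k \<ge> K" for k
    using order_trans[OF B[OF that] ennreal_leI[OF B']] by (simp add: ennreal_of_nat_eq_real_of_nat)
  show ?thesis
  proof (intro exI[of _ B'] allI)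
    fix M
    let ?A = "weight_level M"
    have ev: "D.ev (restrict_coeffs ?A c) x = (\<Sum>n\<in>?A. c n * bergman_basis n x)" for c x
      by (subst D.ev_eq_sum[OF finite_weight_level weight_level_subset])
        (auto simp: restrict_coeffs_def intro!: sum.cong)
    have "(\<lambda>k. ennreal (norm (D.ev (restrict_coeffs ?A (P k)) x) powr q))
        \<longlonglongrightarrow> ennreal (norm (D.ev (restrict_coeffs ?A b) x) powr q)" for x
      unfolding ev using q weight_level_subset[of M]
      by (intro tendsto_ennrealI tendsto_powr' tendsto_norm tendsto_sum tendsto_mult tendsto_const lim) auto
    then have "D.moment (restrict_coeffs ?A b)
        = (\<integral>\<^sup>+x. liminf (\<lambda>k. ennreal (norm (D.ev (restrict_coeffs ?A (P k)) x) powr q)) \<partial>bergman_product \<alpha>)"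
      unfolding D.moment_def by (intro nn_integral_cong lim_imp_Liminf[symmetric]) auto
    also have "\<dots> \<le> liminf (\<lambda>k. D.moment (restrict_coeffs ?A (P k)))"
      unfolding D.moment_def by (rule nn_integral_liminf) measurable
    also have "\<dots> \<le> of_nat (M + 1) * of_nat B'"
    proof (rule Liminf_le)
      show "\<forall>\<^sub>F k in sequentially. D.moment (restrict_coeffs ?A (P k)) \<le> of_nat (M + 1) * of_nat B'"
      proof (rule eventually_sequentiallyI)
        fix k assume "K \<le> k"
        then show "D.moment (restrict_coeffs ?A (P k)) \<le> of_nat (M + 1) * of_nat B'"
          by (intro order_trans[OF bergman_weight_level_bound[OF \<alpha> q P]] mult_left_mono BB) auto
      qed
    qed simp
    finally show "D.moment (restrict_coeffs ?A b) \<le> of_nat (M + 1) * of_nat B'" .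
  qed
qed

text \<open>The finite bound \<open>B\<close> depends on \<omega>. The events on which a given
  \<open>B\<close> works increase to an event of full probability, so one of them has probability
  above \<open>1 - \<epsilon>\<close>; on it the lower Khinchine inequality, applied at each
  \<open>x\<close>, replaces the random sums by square functions.\<close>

lemma random_bergman_imp_square_function_bounded:
  assumes M: "subgaussian_sequence M X" and \<alpha>: "\<alpha> > -1" and q: "0 < q"
    and AE: "AE \<omega> in M. randomize X \<omega> a \<in> bergman_space q \<alpha>"
  shows "\<exists>B::real. \<forall>m. (\<integral>\<^sup>+x. ennreal ((\<Sum>n\<in>weight_level m. (norm (a n
    * bergman_basis n x))\<^sup>2) powr (q / 2)) \<partial>bergman_product \<alpha>)
    \<le> ennreal (real (m + 1) * B)"
proof -
  note N = dirichlet_norm_bergman[OF \<alpha> q]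
  note L = finite_weight_level weight_level_subset
  interpret D: dirichlet_norm "bergman_product \<alpha>" bergman_basis q by (rule N)
  interpret R: subgaussian_sequence M X by fact
  let ?low = "\<lambda>\<delta> \<epsilon>. \<forall>A c. \<forall>E\<in>R.events. finite A \<longrightarrow> A \<subseteq> {1..} \<longrightarrow> R.prob (space M - E) \<le> \<epsilon> \<longrightarrow>
      ennreal (\<delta> * (\<Sum>n\<in>A. (norm (c n))\<^sup>2) powr (q / 2))
        \<le> (\<integral>\<^sup>+\<omega>. ennreal (norm (\<Sum>n\<in>A. c n * X n \<omega>) powr q) * indicator E \<omega> \<partial>M)"
  have "\<exists>\<delta> \<epsilon>. 0 < \<delta> \<and> 0 < \<epsilon> \<and> ?low \<delta> \<epsilon>"
    by (rule R.khinchine_lower[OF q]) (intro exI conjI allI ballI impI, assumption+)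
  then obtain \<delta> \<epsilon> where \<delta>: "\<delta> > 0" and \<epsilon>: "\<epsilon> > 0" and low: "?low \<delta> \<epsilon>"
    by (elim exE conjE)
  define Y where "Y m \<omega> = D.moment (restrict_coeffs (weight_level m) (randomize X \<omega> a))" for m \<omega>
  have Y [measurable]: "Y m \<in> borel_measurable M" for m
    unfolding Y_def by (rule random_moment[OF N M L])
  define E where "E B = {\<omega> \<in> space M. \<forall>m. Y m \<omega> \<le> of_nat (m + 1) * of_nat B}" for B :: nat
  have E [measurable]: "E B \<in> R.events" for B
    unfolding E_def by measurable
  have "incseq E"
  proof (rule incseq_SucI)
    fix B show "E B \<subseteq> E (Suc B)"
    proof
      fix \<omega> assume "\<omega> \<in> E B"
      then have "\<omega> \<in> space M" and le: "Y m \<omega> \<le> of_nat (m + 1) * of_nat B" for m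
        by (auto simp: E_def)
      moreover have "of_nat (m + 1) * of_nat B \<le> (of_nat (m + 1) * of_nat (Suc B) :: ennreal)" for m
        by (intro mult_left_mono) auto
      ultimately show "\<omega> \<in> E (Suc B)"
        unfolding E_def using order_trans[OF le] by blast
    qed
  qed
  then have lim: "(\<lambda>B. R.prob (E B)) \<longlonglongrightarrow> R.prob (\<Union>B. E B)"
    by (intro R.finite_Lim_measure_incseq) auto
  have "AE \<omega> in M. \<omega> \<in> (\<Union>B. E B)"
    using AE AE_space
  proof eventually_elim
    case (elim \<omega>)
    then show ?case
      using bergman_space_imp_weight_level_bounded[OF \<alpha> q elim(1)] by (auto simp: E_def Y_def)
  qed
  then have "R.prob (\<Union>B. E B) = 1"
    by (intro R.prob_eq_1[THEN iffD2]) auto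
  with lim \<epsilon> have "\<forall>\<^sub>F B in sequentially. R.prob (E B) > 1 - \<epsilon>"
    by (intro order_tendstoD(1)[OF lim]) auto
  then obtain B where "R.prob (E B) > 1 - \<epsilon>"
    by (auto simp: eventually_sequentially)
  then have pE: "R.prob (space M - E B) \<le> \<epsilon>"
    by (simp add: R.prob_compl)
  show ?thesis
  proof (intro exI[of _ "real B / \<delta>"] allI)
    fix m
    let ?g = "\<lambda>x. (\<Sum>n\<in>weight_level m. (norm (a n * bergman_basis n x))\<^sup>2) powr (q / 2)"
    have [measurable]: "?g \<in> borel_measurable (bergman_product \<alpha>)" by measurable
    have "ennreal \<delta> * (\<integral>\<^sup>+x. ennreal (?g x) \<partial>bergman_product \<alpha>)
      = (\<integral>\<^sup>+x. ennreal (\<delta> * ?g x) \<partial>bergman_product \<alpha>)"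
      using \<delta> by (subst nn_integral_cmult[symmetric]) (auto simp: ennreal_mult)
    also have "\<dots> \<le> (\<integral>\<^sup>+x. (\<integral>\<^sup>+\<omega>. ennreal (norm (\<Sum>n\<in>weight_level m. (a n * bergman_basis n x)
      * X n \<omega>) powr q) * indicator (E B) \<omega> \<partial>M) \<partial>bergman_product \<alpha>)"
      by (intro nn_integral_mono low[rule_format] L E pE)
    also have "\<dots> = (\<integral>\<^sup>+\<omega>. Y m \<omega> * indicator (E B) \<omega> \<partial>M)"
      unfolding Y_def by (rule random_moment(2)[OF N M L E, symmetric])
    also have "\<dots> \<le> (\<integral>\<^sup>+\<omega>. of_nat (m + 1) * of_nat B \<partial>M)"
      by (intro nn_integral_mono) (auto simp: E_def indicator_def)
    also have "\<dots> = ennreal (real (m + 1) * real B)"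
      by (simp add: R.emeasure_space_1 ennreal_of_nat_eq_real_of_nat ennreal_mult ennreal_plus)
    finally have *: "ennreal \<delta> * (\<integral>\<^sup>+x. ennreal (?g x) \<partial>bergman_product \<alpha>)
      \<le> ennreal (real (m + 1) * real B)" .
    have "(\<integral>\<^sup>+x. ennreal (?g x) \<partial>bergman_product \<alpha>)
        = ennreal (1 / \<delta>) * (ennreal \<delta> * (\<integral>\<^sup>+x. ennreal (?g x) \<partial>bergman_product \<alpha>))"
      using \<delta> by (simp add: mult.assoc[symmetric] ennreal_mult[symmetric])
    also have "\<dots> \<le> ennreal (1 / \<delta>) * ennreal (real (m + 1) * real B)"
      by (intro mult_left_mono *) auto
    also have "\<dots> = ennreal (real (m + 1) * (real B / \<delta>))"
      using \<delta> by (simp add: ennreal_mult[symmetric])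
    finally show "(\<integral>\<^sup>+x. ennreal (?g x) \<partial>bergman_product \<alpha>) \<le> ennreal (real (m + 1) * (real B / \<delta>))" .
  qed
qed

subsection \<open>Products of sums of two variables\<close>

text \<open>Argument of Erdos: every \<open>n \<le> x\<close> is a product of a squarefree number and a square.\<close>

lemma nth_prime_le: "nth_prime k \<le> 4 ^ (k + 1)"
proof -
  \<comment> \<open>With this choice the primes up to \<open>x\<close> are exactly those of index
    less than \<open>k\<close>.\<close>
  define x where "x = nth_prime k - 1"
  define s where "s = floor_sqrt x"
  have s: "s\<^sup>2 \<le> x" by (simp add: s_def)
  \<comment> \<open>The primes in the squarefree part and the root of the square part determine
    \<open>n\<close>, so \<open>x\<close> is at most \<open>2 ^ k * s\<close>; together with
    \<open>s\<^sup>2 \<le> x\<close> this gives \<open>x \<le> 4 ^ k\<close>.\<close>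
  define f where "f n = ({j. nth_prime j dvd squarefree_part n}, square_part n)" for n :: nat
  have "inj_on f {1..x}"
  proof (rule inj_onI)
    fix m n assume mn: "m \<in> {1..x}" "n \<in> {1..x}" and "f m = f n"
    then have eq: "{j. nth_prime j dvd squarefree_part m} = {j. nth_prime j dvd squarefree_part n}"
      "square_part m = square_part n" by (auto simp: f_def)
    have "p dvd squarefree_part m \<longleftrightarrow> p dvd squarefree_part n" if "prime p" for p
      using eq(1) that by (metis (mono_tags, lifting) mem_Collect_eq prime_eq_nth_prime)
    then have "prime_factors (squarefree_part m) = prime_factors (squarefree_part n)"
      by (intro set_eqI) (auto simp: in_prime_factors_iff simp del: neq0_conv)
    moreover have "(\<Prod>p\<in>prime_factors (squarefree_part l). p) = squarefree_part l" if "l \<ge> 1" for l :: nat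
    proof -
      have "\<forall>p\<in>prime_factors (squarefree_part l). multiplicity p (squarefree_part l) = 1"
        using squarefree_factorial_semiring'[of "squarefree_part l"] by simp
      then have "(\<Prod>p\<in>prime_factors (squarefree_part l). p)
        = (\<Prod>p\<in>prime_factors (squarefree_part l). p ^ multiplicity p (squarefree_part l))"
        by (intro prod.cong) auto
      also have "\<dots> = squarefree_part l"
        using that by (intro prod_prime_factors[symmetric, THEN trans[OF sym]]) auto
      finally show ?thesis .
    qed
    ultimately have "squarefree_part m = squarefree_part n"
      using mn by (metis atLeastAtMost_iff)
    then show "m = n"
      using eq(2) squarefree_decompose[of m] squarefree_decompose[of n] by simp
  qed
  moreover have "f ` {1..x} \<subseteq> Pow {..<k} \<times> {1..s}"
  proof (rule image_subsetI)
    fix n assume n: "n \<in> {1..x}"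
    have "j < k" if "nth_prime j dvd squarefree_part n" for j
    proof -
      have "nth_prime j dvd n"
        using that squarefree_decompose[of n] by (metis dvd_mult2)
      then have "nth_prime j \<le> x" using n by (auto dest: dvd_imp_le)
      then have "nth_prime j < nth_prime k"
        using prime_gt_0_nat[OF prime_nth_prime[of k]] by (simp add: x_def)
      then show ?thesis using strict_mono_nth_prime by (simp add: strict_mono_less)
    qed
    moreover have "square_part n \<le> s"
    proof -
      have "(square_part n)\<^sup>2 \<le> n" using n by (intro dvd_imp_le) auto
      then show ?thesis using n by (simp add: s_def le_floor_sqrtI)
    qed
    moreover have "square_part n \<ge> 1" using n by (cases "square_part n") auto
    ultimately show "f n \<in> Pow {..<k} \<times> {1..s}" by (auto simp: f_def)
  qed
  ultimately have "card {1..x} \<le> card (Pow {..<k} \<times> {1..s})"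
    by (intro card_inj_on_le) auto
  then have x: "x \<le> 2 ^ k * s" by (simp add: card_cartesian_product card_Pow)
  with s have "s * s \<le> 2 ^ k * s" unfolding power2_eq_square by (rule le_trans)
  then have "s \<le> 2 ^ k" by (cases "s = 0") auto
  then have "2 ^ k * s \<le> 2 ^ k * 2 ^ k" by simp
  also have "\<dots> = (4::nat) ^ k" by (simp add: power_mult_distrib[symmetric])
  finally have "x \<le> 4 ^ k" using x by simp
  then have "x + 1 \<le> 4 ^ k + 4 ^ k" by (intro add_mono) auto
  also have "\<dots> \<le> (4::nat) ^ (k + 1)" by simp
  finally show ?thesis using prime_gt_0_nat[OF prime_nth_prime[of k]] by (simp add: x_def)
qed

text \<open>The integers that occur in the expansion of \<open>(p_0 + p_1) (p_2 + p_3) ...\<close>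
  with \<open>m\<close> factors: one prime is chosen from each pair of neighbours.\<close>

fun pair_products :: "nat \<Rightarrow> nat set" where
  "pair_products 0 = {1}"
| "pair_products (Suc m) =
    (\<lambda>n. n * nth_prime (2 * m)) ` pair_products m \<union> (\<lambda>n. n * nth_prime (2 * m + 1)) ` pair_products m"

lemma finite_pair_products [simp]: "finite (pair_products m)"
  by (induction m) auto

lemma pair_products_ge_1: "n \<in> pair_products m \<Longrightarrow> n \<ge> 1"
proof (induction m arbitrary: n)
  case (Suc m)
  then show ?case using prime_ge_1_nat[OF prime_nth_prime] by (fastforce simp: Suc_le_eq)
qed simp

lemma nth_prime_dvd_pair_products:
  "n \<in> pair_products m \<Longrightarrow> nth_prime j dvd n \<Longrightarrow> j < 2 * m"
proof (induction m arbitrary: n)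
  case 0
  then show ?case using prime_gt_1_nat[OF prime_nth_prime[of j]] by simp
next
  case (Suc m)
  from Suc.prems obtain k i where n: "n = k * nth_prime i" "k \<in> pair_products m" "i = 2 * m \<or> i = 2 * m + 1"
    by auto
  then have "nth_prime j dvd k \<or> j = i"
    using Suc.prems(2) by (auto simp: prime_dvd_mult_iff dest: primes_dvd_imp_eq[rotated 2])
  then show ?case using Suc.IH[OF n(2)] n(3) by auto
qed

lemma gt_pair_products: "n \<in> pair_products m \<Longrightarrow> m < n"
proof (induction m arbitrary: n)
  case (Suc m)
  then obtain k i where n: "n = k * nth_prime i" "k \<in> pair_products m" by auto
  have "Suc m < k * 2" using Suc.IH[OF n(2)] by simp
  also have "\<dots> \<le> k * nth_prime i" using prime_ge_2_nat[OF prime_nth_prime[of i]] by simp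
  finally show ?case using n by simp
qed simp

lemma le_pair_products: "n \<in> pair_products m \<Longrightarrow> n \<le> nth_prime (2 * m) ^ m"
proof -
  have "n \<in> pair_products m \<Longrightarrow> m \<le> l \<Longrightarrow> n \<le> nth_prime (2 * l) ^ m" for l
  proof (induction m arbitrary: n)
    case (Suc m)
    then obtain k i where n: "n = k * nth_prime i" "k \<in> pair_products m" "i \<le> 2 * m + 1" by auto
    have "nth_prime i \<le> nth_prime (2 * l)"
      using n Suc.prems(2) strict_mono_nth_prime by (simp add: strict_mono_less_eq)
    then have "k * nth_prime i \<le> nth_prime (2 * l) ^ m * nth_prime (2 * l)"
      using Suc.IH[OF n(2)] Suc.prems(2) by (intro mult_le_mono) auto
    then show ?case using n(1) by (simp only: power_Suc2)
  qed simp
  then show "n \<in> pair_products m \<Longrightarrow> n \<le> nth_prime (2 * m) ^ m" by blast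
qed

text \<open>Both primes of the pair with index \<open>i\<close> have weight \<open>i + 1\<close>, so
  the choice within the pairs does not matter. The quadratic growth keeps the loss in the projection
  onto a level polynomial in \<open>m\<close>.\<close>

definition pair_weight :: "nat \<Rightarrow> nat" where
  "pair_weight m = (\<Sum>i<m. i + 1)"

lemma weight_pair_products: "n \<in> pair_products m \<Longrightarrow> weight n = pair_weight m"
proof (induction m arbitrary: n)
  case (Suc m)
  then obtain k i where n: "n = k * nth_prime i" "k \<in> pair_products m" "i = 2 * m \<or> i = 2 * m + 1" by auto
  have "weight n = weight k + prime_weight i"
    unfolding n(1) using pair_products_ge_1[OF n(2)] prime_ge_1_nat[OF prime_nth_prime[of i]]
    by (subst weight_mult) auto
  also have "prime_weight i = m + 1" using n(3) by (auto simp: prime_weight_def)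
  finally show ?case using Suc.IH[OF n(2)] by (simp add: pair_weight_def)
qed (simp add: pair_weight_def)

lemma strict_mono_pair_weight: "strict_mono pair_weight"
  by (rule strict_mono_Suc_iff[THEN iffD2]) (simp add: pair_weight_def)

lemma pair_products_disjoint: "n \<in> pair_products m \<Longrightarrow> n \<in> pair_products l \<Longrightarrow> m = l"
  using weight_pair_products[of n m] weight_pair_products[of n l] strict_mono_pair_weight
  by (simp add: strict_mono_eq)

text \<open>Complete multiplicativity factors the sum along the pairs, as in an Euler product. The
  cases needed are Bohr monomials, negative powers of \<open>n\<close>, and the constant 1, which
  counts the elements.\<close>

lemma sum_pair_products:
  fixes h :: "nat \<Rightarrow> 'a::comm_semiring_1"
  assumes h1: "h 1 = 1" and h: "\<And>m n. m \<ge> 1 \<Longrightarrow> n \<ge> 1 \<Longrightarrow> h (m * n) = h m * h n"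
  shows "(\<Sum>n\<in>pair_products m. h n) = (\<Prod>i<m. h (nth_prime (2 * i)) + h (nth_prime (2 * i + 1)))"
proof (induction m)
  case (Suc m)
  have pos: "nth_prime i \<ge> 1" for i by (rule prime_ge_1_nat) simp
  have inj: "inj_on (\<lambda>n. n * nth_prime i) (pair_products m)" for i
    using pos[of i] by (intro inj_onI) auto
  have disj: "(\<lambda>n. n * nth_prime (2 * m)) ` pair_products m \<inter> (\<lambda>n. n * nth_prime (2 * m
    + 1)) ` pair_products m = {}"
  proof (rule ccontr)
    assume "\<not> ?thesis"
    then obtain k l where kl: "k \<in> pair_products m" "l \<in> pair_products m"
      "k * nth_prime (2 * m) = l * nth_prime (2 * m + 1)" by auto
    then have "nth_prime (2 * m) dvd l * nth_prime (2 * m + 1)"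
      by (metis dvd_triv_right)
    then have "nth_prime (2 * m) dvd l"
      by (auto simp: prime_dvd_mult_iff dest: primes_dvd_imp_eq[rotated 2])
    then show False using nth_prime_dvd_pair_products[OF kl(2)] by blast
  qed
  have "(\<Sum>n\<in>(\<lambda>n. n * nth_prime i) ` pair_products m. h n) = (\<Sum>n\<in>pair_products m. h n) * h (nth_prime i)" for i
    using pos[of i] by (subst sum.reindex[OF inj])
      (auto simp: h[OF pair_products_ge_1 pos] sum_distrib_right intro!: sum.cong)
  then show ?case
    unfolding pair_products.simps using disj
    by (subst sum.union_disjoint) (auto simp: Suc.IH distrib_left)
qed (use h1 in simp)

lemma sum_bohr_monomial_pair_products:
  "(\<Sum>n\<in>pair_products m. bohr_monomial n z) = (\<Prod>i<m. z (2 * i) + z (2 * i + 1))"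
  by (subst sum_pair_products) (auto simp: bohr_monomial_mult)

lemma card_pair_products: "card (pair_products m) = 2 ^ m"
  using sum_pair_products[of "\<lambda>_. 1::nat" m] by (simp add: numeral_2_eq_2)

section \<open>Moments of the products and the gap between p < 2 and 2\<close>

definition pair_moment :: "real \<Rightarrow> ennreal" where
  "pair_moment p = (\<integral>\<^sup>+w. ennreal (norm (1 + w) powr p) \<partial>circle_measure)"

text \<open>Averaging over a rotation of the single coordinate \<open>2 * m + 1\<close> isolates the
  last factor. At every point with unimodular coordinates its average is
  \<open>pair_moment p\<close>, so the factors separate one by one.\<close>

lemma nn_integral_pair_product:
  assumes p: "0 < p"
  shows "(\<integral>\<^sup>+z. ennreal (norm (\<Prod>i<m. z (2 * i) + z (2 * i + 1)) powr p) \<partial>torus_measure) = pair_moment p ^ m"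
proof (induction m)
  case 0
  then show ?case using prob_space.emeasure_space_1[OF prob_space_torus] by simp
next
  case (Suc m)
  interpret T: prob_space torus_measure by (rule prob_space_torus)
  interpret P: pair_sigma_finite circle_measure torus_measure
    by (intro pair_sigma_finite.intro prob_space_imp_sigma_finite prob_space_circle prob_space_torus)
  define G where "G z = (\<Prod>i<m. z (2 * i) + z (2 * i + 1))" for z :: "nat \<Rightarrow> complex"
  define a b where "a z = z (2 * m)" and "b z = z (2 * m + 1)" for z :: "nat \<Rightarrow> complex"
  have [measurable]: "a \<in> borel_measurable torus_measure" "b \<in> borel_measurable torus_measure"
    unfolding a_def b_def by (rule measurable_torus_component)+
  have [measurable]: "G \<in> borel_measurable torus_measure"
    unfolding G_def by (intro borel_measurable_prod borel_measurable_add measurable_torus_component)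
  have [measurable]: "(\<lambda>x. a (snd x)) \<in> borel_measurable (circle_measure \<Otimes>\<^sub>M torus_measure)"
    "(\<lambda>x. b (snd x)) \<in> borel_measurable (circle_measure \<Otimes>\<^sub>M torus_measure)"
    by (rule measurable_compose[OF measurable_snd]; measurable)+
  have [measurable]: "(\<lambda>x. G (snd x)) \<in> borel_measurable (circle_measure \<Otimes>\<^sub>M torus_measure)"
    by (rule measurable_compose[OF measurable_snd]) measurable
  define H where "H u z = ennreal (norm (G z) powr p) * ennreal (norm (a z + u * b z) powr p)" for u z
  have Hpair: "(\<lambda>(u, z). H u z) \<in> borel_measurable (circle_measure \<Otimes>\<^sub>M torus_measure)"
    unfolding H_def case_prod_beta' by measurable
  have H1: "H 1 \<in> borel_measurable torus_measure"
    unfolding H_def by measurable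
  have "(\<integral>\<^sup>+z. ennreal (norm (\<Prod>i<Suc m. z (2 * i) + z (2 * i + 1)) powr p) \<partial>torus_measure)
      = (\<integral>\<^sup>+z. H 1 z \<partial>torus_measure)"
    by (intro nn_integral_cong) (simp add: H_def G_def a_def b_def norm_mult powr_mult ennreal_mult)
  also have "\<dots> = (\<integral>\<^sup>+u. (\<integral>\<^sup>+z. H 1 z \<partial>torus_measure) \<partial>circle_measure)"
    using prob_space.emeasure_space_1[OF prob_space_circle] by simp
  also have "\<dots> = (\<integral>\<^sup>+u. (\<integral>\<^sup>+z. H u z \<partial>torus_measure) \<partial>circle_measure)"
  proof (rule nn_integral_cong_AE, use AE_circle in eventually_elim)
    fix u :: complex assume u: "norm u = 1"
    define v where "v j = (if j = 2 * m + 1 then u else 1)" for j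
    have "G (\<lambda>j. v j * z j) = G z" for z
      unfolding G_def by (intro prod.cong) (auto simp: v_def)
    then have "H 1 (\<lambda>j. v j * z j) = H u z" for z
      by (simp add: H_def v_def a_def b_def)
    then show "(\<integral>\<^sup>+z. H 1 z \<partial>torus_measure) = (\<integral>\<^sup>+z. H u z \<partial>torus_measure)"
      using nn_integral_torus_rotate[OF H1, of v] u by (simp add: v_def)
  qed
  also have "\<dots> = (\<integral>\<^sup>+z. (\<integral>\<^sup>+u. H u z \<partial>circle_measure) \<partial>torus_measure)"
    by (rule P.Fubini'[OF Hpair, symmetric])
  also have "\<dots> = (\<integral>\<^sup>+z. ennreal (norm (G z) powr p) * pair_moment p \<partial>torus_measure)"
  proof (rule nn_integral_cong_AE, use AE_torus in eventually_elim)
    fix z :: "nat \<Rightarrow> complex" assume z: "\<forall>j. norm (z j) = 1"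
    define v where "v = b z / a z"
    have v: "norm v = 1" using z by (simp add: v_def norm_divide a_def b_def)
    have z0: "a z \<noteq> 0" using z by (metis a_def norm_zero zero_neq_one)
    have "norm (a z + u * b z) = norm (1 + v * u)" for u
    proof -
      have "a z + u * b z = a z * (1 + v * u)"
        using z0 by (simp add: v_def field_simps)
      then show ?thesis using z by (simp add: norm_mult a_def)
    qed
    then have inner: "(\<integral>\<^sup>+u. ennreal (norm (a z + u * b z) powr p) \<partial>circle_measure) = pair_moment p"
      unfolding pair_moment_def
      using nn_integral_circle_rotate[of "\<lambda>w. ennreal (norm (1 + w) powr p)" v] v by simp
    show "(\<integral>\<^sup>+u. H u z \<partial>circle_measure) = ennreal (norm (G z) powr p) * pair_moment p"
    proof -
      have "(\<lambda>u. ennreal (norm (a + u * b) powr p)) \<in> borel_measurable circle_measure" for a b :: complex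
        by measurable
      then show ?thesis
        unfolding H_def by (simp only: nn_integral_cmult inner)
    qed
  qed
  also have "\<dots> = pair_moment p ^ m * pair_moment p"
    using Suc.IH by (subst nn_integral_multc) (auto simp: G_def)
  finally show ?case by (simp add: mult.commute)
qed

text \<open>Strict concavity of \<open>y powr s\<close>, whose graph lies below its tangent at 1.
  The proof is that of the weighted inequality of arithmetic and geometric means for
  \<open>y\<close> and 1.\<close>

lemma powr_less_tangent:
  fixes y s :: real
  assumes "0 \<le> y" "y \<noteq> 1" "0 < s" "s < 1"
  shows "y powr s < 1 + s * (y - 1)"
proof (cases "y = 0")
  case False
  with assms have y: "y > 0" by simp
  \<comment> \<open>The weighted mean of \<open>y\<close> and 1. In the inequalities
    \<open>ln x \<le> x - 1\<close> at \<open>y / u\<close> and at \<open>1 / u\<close>, with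
    weights \<open>s\<close> and \<open>1 - s\<close>, the right-hand sides add up to 0.\<close>
  define u where "u = s * y + (1 - s)"
  have u: "u > 0" using y assms by (simp add: u_def add_pos_pos)
  have yu: "y / u \<noteq> 1"
  proof
    assume "y / u = 1"
    then have "(1 - s) * (y - 1) = 0" using u by (simp add: u_def field_simps)
    then show False using assms by simp
  qed
  have "ln (y / u) < y / u - 1"
    using ln_le_minus_one[of "y / u"] ln_eq_minus_one[of "y / u"] y u yu by (auto simp: less_le)
  then have "s * ln (y / u) < s * (y / u - 1)" using assms by simp
  moreover have "(1 - s) * ln (1 / u) \<le> (1 - s) * (1 / u - 1)"
    using assms u by (intro mult_left_mono ln_le_minus_one) auto
  ultimately have "s * ln (y / u) + (1 - s) * ln (1 / u) < s * (y / u - 1) + (1 - s) * (1 / u - 1)"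
    by linarith
  also have "\<dots> = (s * y + (1 - s)) / u - 1"
    using u by (simp add: field_simps)
  also have "\<dots> = 0" using u by (simp add: u_def)
  also have "s * ln (y / u) + (1 - s) * ln (1 / u) = s * ln y - ln u"
    using y u by (simp add: ln_div algebra_simps)
  finally have "exp (s * ln y) < exp (ln u)" by (subst exp_less_cancel_iff) simp
  then have "y powr s < u" using y u by (simp add: powr_def)
  then show ?thesis by (simp add: u_def algebra_simps)
qed (use assms in auto)

text \<open>This is where \<open>p < 2\<close> enters: \<open>1 + w\<close> has norm \<open>\<surd>2\<close> in \<open>L\<^sup>2\<close>, and \<open>|1 + w|\<close> is not constant.\<close>

lemma pair_moment_less:
  assumes p: "0 < p" "p < 2"
  shows "pair_moment p < ennreal (2 powr (p / 2))"
proof -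
  note integrable_const_bound =
    finite_measure.integrable_const_bound[OF prob_space.finite_measure[OF prob_space_circle]]
  define s where "s = p / 2"
  have s: "0 < s" "s < 1" using p by (auto simp: s_def)
  \<comment> \<open>On the circle the square of \<open>norm (1 + w)\<close> is
    \<open>2 * (1 + Re w)\<close>, and \<open>g\<close> is the gap between the power and its
    tangent. Its integral is 1 minus the normalized moment, so it remains to exclude that
    \<open>g\<close> vanishes almost everywhere.\<close>
  define g where "g w = 1 + s * Re w - (1 + Re w) powr s" for w :: complex
  have tangent: "(1 + Re w) powr s < 1 + s * Re w" if "norm w = 1" "Re w \<noteq> 0" for w
    using powr_less_tangent[of "1 + Re w" s] abs_Re_le_cmod[of w] that s by auto
  have g0: "AE w in circle_measure. 0 \<le> g w"
    using AE_circle
  proof eventually_elim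
    case (elim w)
    then show ?case using tangent[of w] by (cases "Re w = 0") (auto simp: g_def)
  qed
  have Re1: "AE w in circle_measure. \<bar>Re w\<bar> \<le> 1"
    using AE_circle by eventually_elim (metis abs_Re_le_cmod)
  have intid: "integrable circle_measure (\<lambda>w. w)"
    by (rule integrable_const_bound[where B = 1]) (use AE_circle in auto)
  have intRe: "integrable circle_measure Re" using integrable_Re[OF intid] by simp
  have Re0: "(LINT w|circle_measure. Re w) = 0"
    using integral_Re[OF intid] integral_circle_id by simp
  have intp: "integrable circle_measure (\<lambda>w. (1 + Re w) powr s)"
  proof (rule integrable_const_bound[where B = "2 powr s"])
    show "AE w in circle_measure. norm ((1 + Re w) powr s) \<le> 2 powr s"
      using Re1 by eventually_elim (use s in \<open>auto intro!: powr_mono2\<close>)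
  qed measurable
  have intg: "integrable circle_measure g"
    unfolding g_def using intRe intp by (intro Bochner_Integration.integrable_diff
      Bochner_Integration.integrable_add) auto
  have meas1: "measure circle_measure UNIV = 1"
    using prob_space.prob_space[OF prob_space_circle] by simp
  have "(LINT w|circle_measure. g w) = 1 - (LINT w|circle_measure. (1 + Re w) powr s)"
    unfolding g_def using intRe intp Re0 meas1 by simp
  moreover have "(LINT w|circle_measure. g w) \<noteq> 0"
  proof
    assume "(LINT w|circle_measure. g w) = 0"
    then have "AE w in circle_measure. g w = 0"
      using integral_nonneg_eq_0_iff_AE[OF intg g0] by simp
    with AE_circle have Re: "AE w in circle_measure. Re w = 0"
    proof eventually_elim
      case (elim w)
      then show ?case using tangent[of w] by (auto simp: g_def)
    qed
    \<comment> \<open>Rotation by \<open>\<i>\<close> turns \<open>Re w = 0\<close> into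
      \<open>Im w = 0\<close>, and both together contradict \<open>norm w = 1\<close>.\<close>
    then have "AE w in distr circle_measure borel (\<lambda>w. \<i> * w). Re w = 0"
      by (subst distr_circle_rotate) auto
    then have "AE w in circle_measure. Re (\<i> * w) = 0"
      by (subst (asm) AE_distr_iff) auto
    with Re AE_circle have "AE w in circle_measure. False"
    proof eventually_elim
      case (elim w)
      then have "w = 0" by (simp add: complex_eq_iff)
      with elim show False by simp
    qed
    then show False
      using prob_space.emeasure_space_1[OF prob_space_circle] by (simp add: AE_iff_measurable[OF _ refl])
  qed
  moreover have "0 \<le> (LINT w|circle_measure. g w)" by (rule integral_nonneg_AE[OF g0])
  ultimately have lt: "(LINT w|circle_measure. (1 + Re w) powr s) < 1" by simp
  have "pair_moment p = (\<integral>\<^sup>+w. ennreal (2 powr s) * ennreal ((1 + Re w) powr s) \<partial>circle_measure)"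
    unfolding pair_moment_def
  proof (rule nn_integral_cong_AE, use AE_circle in eventually_elim)
    fix w :: complex assume w: "norm w = 1"
    have "(norm (1 + w))\<^sup>2 = 2 * (1 + Re w)"
    proof -
      have "(Re w)\<^sup>2 + (Im w)\<^sup>2 = 1" using w cmod_power2[of w] by simp
      then show ?thesis unfolding cmod_power2 by (simp add: power2_sum algebra_simps)
    qed
    then have "norm (1 + w) = (2 * (1 + Re w)) powr (1 / 2)"
      by (metis norm_ge_zero powr_half_sqrt real_sqrt_unique zero_le_power2)
    then have "norm (1 + w) powr p = (2 * (1 + Re w)) powr s"
      by (simp add: powr_powr s_def)
    also have "\<dots> = 2 powr s * (1 + Re w) powr s" by (rule powr_mult)
    finally show "ennreal (norm (1 + w) powr p) = ennreal (2 powr s) * ennreal ((1 + Re w) powr s)"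
      by (simp add: ennreal_mult)
  qed
  also have "\<dots> = ennreal (2 powr s) * ennreal (LINT w|circle_measure. (1 + Re w) powr s)"
    by (subst nn_integral_cmult) (auto simp: nn_integral_eq_integral[OF intp])
  also have "\<dots> = ennreal (2 powr s * (LINT w|circle_measure. (1 + Re w) powr s))"
    by (simp add: ennreal_mult integral_nonneg_AE)
  also have "\<dots> < ennreal (2 powr s)"
    using lt by (intro ennreal_lessI) auto
  finally show ?thesis by (simp add: s_def)
qed

subsection \<open>The counterexample\<close>

text \<open>Members of \<open>pair_products m\<close> exceed \<open>m\<close>, so the range
  \<open>m \<le> n\<close> covers all cases; the sets are disjoint, so at most one summand is
  nonzero.\<close>

definition pair_series :: "real \<Rightarrow> dseries" where
  "pair_series \<beta> n = (\<Sum>m\<le>n. if n \<in> pair_products m then of_real (\<beta> ^ m) else 0)"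

lemma pair_series_eq:
  assumes "n \<in> pair_products m"
  shows "pair_series \<beta> n = of_real (\<beta> ^ m)"
proof -
  have "pair_series \<beta> n = (\<Sum>l\<le>n. if l = m then of_real (\<beta> ^ m) else 0)"
    unfolding pair_series_def
  proof (intro sum.cong refl)
    fix l
    show "(if n \<in> pair_products l then of_real (\<beta> ^ l) else 0) = (if l
      = m then complex_of_real (\<beta> ^ m) else 0)"
      using pair_products_disjoint[OF assms, of l] assms by (cases "l = m") auto
  qed
  also have "\<dots> = of_real (\<beta> ^ m)"
    using gt_pair_products[OF assms] by (subst sum.delta) auto
  finally show ?thesis .
qed

lemma pair_series_eq_0: "n \<notin> (\<Union>m. pair_products m) \<Longrightarrow> pair_series \<beta> n = 0"
  by (auto simp: pair_series_def)

text \<open>The sums \<open>t m\<close> of the absolute values over \<open>pair_products m\<close>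
  satisfy a recursion whose ratio tends to 0, because \<open>nth_prime j \<ge> j\<close>.
  Convergence is therefore absolute, however large \<beta> is.\<close>

lemma pair_series_converges:
  assumes \<beta>: "0 < \<beta>"
  shows "converges_on_half_plane (pair_series \<beta>) (1 / 2)"
  unfolding converges_on_half_plane_def
proof (intro allI impI)
  fix s :: complex assume s: "1 / 2 < Re s"
  define h where "h n = real n powr - Re s" for n
  define t where "t m = \<beta> ^ m * (\<Sum>n\<in>pair_products m. h n)" for m
  have h0: "0 \<le> h n" for n by (simp add: h_def)
  have h_mult: "h (m * n) = h m * h n" for m n
    by (simp add: h_def powr_mult)
  have h1: "h 1 = 1" by (simp add: h_def)
  have t0: "0 \<le> t m" for m using \<beta> h0 by (simp add: t_def sum_nonneg)
  have t_Suc: "t (Suc m) = \<beta> * (h (nth_prime (2 * m)) + h (nth_prime (2 * m + 1))) * t m" for m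
    unfolding t_def by (subst (1 2) sum_pair_products[where h = h, OF h1 h_mult]) (simp_all add: mult_ac)
  have "(\<lambda>m. 2 * \<beta> * real m powr - Re s) \<longlonglongrightarrow> 2 * \<beta> * 0"
    using s by (intro tendsto_mult tendsto_const tendsto_neg_powr filterlim_real_sequentially) auto
  then have "\<forall>\<^sub>F m in sequentially. 2 * \<beta> * real m powr - Re s < 1 / 2"
    by (intro order_tendstoD(2)[where y = "2 * \<beta> * 0"]) auto
  then obtain N where N: "\<And>m. m \<ge> N \<Longrightarrow> 2 * \<beta> * real m powr - Re s < 1 / 2"
    by (auto simp: eventually_sequentially)
  have "summable t"
  proof (rule summable_ratio_test[of "1 / 2" "max N 1"])
    fix m assume m: "max N 1 \<le> m"
    have h_le: "h (nth_prime j) \<le> real m powr - Re s" if "m \<le> j" for j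
    proof -
      have "m \<le> nth_prime j"
        using that strict_mono_imp_increasing[OF strict_mono_nth_prime, of j] by linarith
      then show ?thesis
        unfolding h_def using m s by (intro powr_mono2') auto
    qed
    have "\<beta> * (h (nth_prime (2 * m)) + h (nth_prime (2 * m + 1)))
      \<le> \<beta> * (real m powr - Re s + real m powr - Re s)"
      using \<beta> by (intro mult_left_mono add_mono h_le) auto
    also have "\<dots> \<le> 1 / 2" using N[of m] m by simp
    finally have "t (Suc m) \<le> 1 / 2 * t m"
      unfolding t_Suc by (rule mult_right_mono[OF _ t0])
    then show "norm (t (Suc m)) \<le> 1 / 2 * norm (t m)"
      using t0[of m] t0[of "Suc m"] by simp
  qed simp
  have norm_le: "(\<Sum>n<N. norm (pair_series \<beta> n * of_nat n powr - s)) \<le> (\<Sum>m. t m)" for N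
  proof -
    have "(\<Sum>n<N. norm (pair_series \<beta> n * of_nat n powr - s))
        \<le> (\<Sum>n\<in>(\<Union>m\<in>{..<N}. pair_products m). norm (pair_series \<beta> n * of_nat n powr - s))"
    proof -
      have "(\<Sum>n<N. norm (pair_series \<beta> n * of_nat n powr - s))
        = (\<Sum>n\<in>{..<N} \<inter> (\<Union>m\<in>{..<N}. pair_products m). norm (pair_series \<beta> n * of_nat n powr - s))"
      proof (rule sum.mono_neutral_right)
        have "pair_series \<beta> n = 0" if "n < N" "n \<notin> (\<Union>m\<in>{..<N}. pair_products m)" for n
          using that gt_pair_products[of n] by (intro pair_series_eq_0) force
        then show "\<forall>n\<in>{..<N} - {..<N} \<inter> (\<Union>m\<in>{..<N}. pair_products m). norm (pair_series \<beta> n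
          * of_nat n powr - s) = 0"
          by auto
      qed auto
      also have "\<dots> \<le> (\<Sum>n\<in>(\<Union>m\<in>{..<N}. pair_products m). norm (pair_series \<beta> n * of_nat n powr - s))"
        by (intro sum_mono2) auto
      finally show ?thesis .
    qed
    also have "\<dots> = (\<Sum>m<N. \<Sum>n\<in>pair_products m. norm (pair_series \<beta> n * of_nat n powr - s))"
      by (intro sum.UNION_disjoint) (auto dest: pair_products_disjoint)
    also have "\<dots> = (\<Sum>m<N. t m)"
      unfolding t_def sum_distrib_left h_def
      using \<beta> norm_nat_powr_minus[OF pair_products_ge_1]
      by (intro sum.cong refl) (simp add: norm_mult pair_series_eq norm_power)
    also have "\<dots> \<le> (\<Sum>m. t m)"
      using \<open>summable t\<close> t0 by (intro sum_le_suminf) auto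
    finally show ?thesis .
  qed
  have "summable (\<lambda>n. norm (pair_series \<beta> n * of_nat n powr - s))"
    by (rule summableI_nonneg_bounded[OF _ norm_le]) simp
  then show "summable (\<lambda>n. pair_series \<beta> n * of_nat n powr - s)"
    by (rule summable_norm_cancel)
qed

text \<open>The moments of the increments decay like \<open>r ^ (2 * k)\<close>. One factor
  \<open>r ^ k\<close> is spent on the weights of the quasi-triangle inequality, and the other one
  makes the series converge.\<close>

lemma pair_series_in_hardy_space:
  assumes p: "0 < p" and \<beta>: "0 < \<beta>" and r: "0 < r" "r < 1"
    and le: "ennreal (\<beta> powr p) * pair_moment p \<le> ennreal (r\<^sup>2)"
  shows "pair_series \<beta> \<in> hardy_space p"
proof -
  interpret D: dirichlet_norm torus_measure bohr_monomial p by (rule dirichlet_norm_torus[OF p])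
  define S where "S k = restrict_coeffs (\<Union>m<k. pair_products m) (pair_series \<beta>)" for k
  have S: "S k \<in> dirichlet_polynomials" for k
    unfolding S_def by (rule restrict_coeffs_polynomial) simp
  have diff: "(\<lambda>n. S (Suc k) n - S k n) = restrict_coeffs (pair_products k) (pair_series \<beta>)" for k
    by (auto simp: fun_eq_iff S_def restrict_coeffs_def lessThan_Suc dest: pair_products_disjoint)
  have moment: "D.moment (\<lambda>n. S (Suc k) n - S k n) \<le> ennreal (r\<^sup>2) ^ k" for k
  proof -
    have "D.ev (restrict_coeffs (pair_products k) (pair_series \<beta>)) z
        = of_real (\<beta> ^ k) * (\<Prod>i<k. z (2 * i) + z (2 * i + 1))" for z
    proof -
      have "D.ev (restrict_coeffs (pair_products k) (pair_series \<beta>)) z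
        = (\<Sum>n\<in>pair_products k. restrict_coeffs (pair_products k) (pair_series \<beta>) n * bohr_monomial n z)"
        by (rule D.ev_eq_sum) (auto simp: restrict_coeffs_def dest: pair_products_ge_1)
      also have "\<dots> = (\<Sum>n\<in>pair_products k. of_real (\<beta> ^ k) * bohr_monomial n z)"
        by (intro sum.cong refl) (simp add: restrict_coeffs_def pair_series_eq)
      finally show ?thesis
        unfolding sum_distrib_left[symmetric] sum_bohr_monomial_pair_products .
    qed
    then have "D.moment (\<lambda>n. S (Suc k) n - S k n)
        = (\<integral>\<^sup>+z. ennreal ((\<beta> powr p) ^ k) * ennreal (norm (\<Prod>i<k. z (2 * i) + z (2 * i
          + 1)) powr p) \<partial>torus_measure)"
      unfolding D.moment_def diff using \<beta>
      by (intro nn_integral_cong)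
        (simp add: norm_mult norm_power powr_mult ennreal_mult powr_power[symmetric] powr_realpow[symmetric]
          powr_powr mult.commute)
    also have "\<dots> = ennreal ((\<beta> powr p) ^ k) * pair_moment p ^ k"
      unfolding nn_integral_pair_product[OF p, symmetric]
    proof (rule nn_integral_cmult)
      have [measurable]: "(\<lambda>z. \<Prod>i<k. z (2 * i) + z (2 * i + 1)) \<in> borel_measurable torus_measure"
        by (intro borel_measurable_prod borel_measurable_add measurable_torus_component)
      show "(\<lambda>z. ennreal (norm (\<Prod>i<k. z (2 * i) + z (2 * i + 1)) powr p)) \<in> borel_measurable torus_measure"
        by measurable
    qed
    also have "\<dots> = (ennreal (\<beta> powr p) * pair_moment p) ^ k"
      by (simp add: ennreal_power power_mult_distrib)
    also have "\<dots> \<le> ennreal (r\<^sup>2) ^ k" by (intro power_mono le) simp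
    finally show ?thesis .
  qed
  \<comment> \<open>Chosen such that \<open>l powr p = r\<close>, hence the weights are
    \<open>1 / r ^ k\<close>.\<close>
  define l where "l = r powr (1 / p)"
  have l: "0 < l" "l < 1"
    using p r powr_less_mono2[of "1 / p" r 1] by (auto simp: l_def)
  have lk: "(1 / l ^ k) powr p = 1 / r ^ k" for k
  proof -
    have "l ^ k = r powr (k / p)" using r by (simp add: l_def powr_power)
    then have "(l ^ k) powr p = r powr real k"
      using p by (simp only: powr_powr) simp
    moreover have "(1 / l ^ k) powr p = 1 / (l ^ k) powr p"
      by (simp only: powr_divide) simp
    moreover have "r powr real k = r ^ k"
      by (rule powr_realpow) (rule r)
    ultimately show ?thesis by simp
  qed
  have "(\<Sum>k. ennreal ((1 / l ^ k) powr p) * D.moment (\<lambda>n. S (Suc k) n - S k n)) \<le> (\<Sum>k. ennreal (r ^ k))"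
  proof (intro suminf_le)
    fix k
    have "ennreal ((1 / l ^ k) powr p) * D.moment (\<lambda>n. S (Suc k) n - S k n)
        \<le> ennreal (1 / r ^ k) * ennreal (r\<^sup>2) ^ k"
      unfolding lk by (intro mult_left_mono moment) simp
    also have "\<dots> = ennreal (1 / r ^ k * (r\<^sup>2) ^ k)"
      using r by (subst ennreal_mult) (auto simp: ennreal_power)
    also have "1 / r ^ k * (r\<^sup>2) ^ k = r ^ k"
      using r by (simp add: power2_eq_square power_mult_distrib)
    finally show "ennreal ((1 / l ^ k) powr p) * D.moment (\<lambda>n. S (Suc k) n - S k n) \<le> ennreal (r ^ k)" .
  qed auto
  also have "\<dots> < \<infinity>"
    using r by (subst suminf_ennreal2) (auto intro!: summable_geometric)
  finally have "\<forall>\<epsilon>>0. \<exists>K. \<forall>j\<ge>K. \<forall>k\<ge>K. D.nrm (\<lambda>n. S j n - S k n) < \<epsilon>"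
    by (rule D.summable_moments_imp_Cauchy_nrm[OF S l])
  then have "\<forall>\<epsilon>>0. \<exists>K. \<forall>j\<ge>K. \<forall>k\<ge>K. hardy_norm p (\<lambda>n. S j n - S k n) < \<epsilon>"
    by (simp add: hardy_norm_eq_nrm[OF p])
  moreover have "(\<lambda>k. S k n) \<longlonglongrightarrow> pair_series \<beta> n" for n
  proof (cases "n \<in> (\<Union>m. pair_products m)")
    case True
    then obtain m where m: "n \<in> pair_products m" by blast
    show ?thesis
    proof (rule tendsto_eventually, rule eventually_sequentiallyI)
      fix k assume "Suc m \<le> k"
      with m show "S k n = pair_series \<beta> n" by (auto simp: S_def restrict_coeffs_def)
    qed
  next
    case False
    then show ?thesis by (simp add: S_def restrict_coeffs_def pair_series_eq_0)
  qed
  ultimately show ?thesis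
    using pair_series_converges[OF \<beta>] S unfolding hardy_space_def dirichlet_completion_def by blast
qed

text \<open>There are \<open>2 ^ m\<close> terms with coefficient \<open>\<beta> ^ m\<close>, and
  their indices \<open>n\<close> are at most \<open>4 ^ ((2 * m + 1) * m)\<close>. The upper bound
  for \<sigma> is what keeps \<open>n powr - \<sigma>\<close> at least
  \<open>exp (- c * m)\<close>.\<close>

lemma pair_series_square_function:
  assumes \<beta>: "0 < \<beta>" and c: "0 < c" and \<sigma>: "0 < \<sigma>" "\<sigma> \<le> c / ((2 * real m + 1) * ln 4)"
    and z: "\<And>j. norm (z j) = 1"
  shows "(2 * \<beta>\<^sup>2 * exp (- 2 * c)) ^ m
    \<le> (\<Sum>n\<in>weight_level (pair_weight m). (norm (pair_series \<beta> n * bergman_basis n (\<sigma>, z)))\<^sup>2)"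
proof -
  have summand: "\<beta> ^ (2 * m) * exp (- 2 * c * m) \<le> (norm (pair_series \<beta> n * bergman_basis n (\<sigma>, z)))\<^sup>2"
    if n: "n \<in> pair_products m" for n
  proof -
    have n1: "real n \<ge> 1" using pair_products_ge_1[OF n] by simp
    have "n \<le> (4 ^ (2 * m + 1)) ^ m"
      by (rule order_trans[OF le_pair_products[OF n]]) (intro power_mono nth_prime_le, simp)
    then have "real n \<le> (4 ^ (2 * m + 1)) ^ m"
      by (metis of_nat_le_iff of_nat_numeral of_nat_power)
    then have "ln (real n) \<le> ln ((4 ^ (2 * m + 1)) ^ m)" using n1 by (subst ln_le_cancel_iff) auto
    also have "\<dots> = (2 * real m + 1) * ln 4 * m"
      by (simp only: ln_realpow zero_less_power zero_less_numeral) simp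
    finally have "\<sigma> * ln (real n) \<le> c / ((2 * real m + 1) * ln 4) * ((2 * real m + 1) * ln 4 * m)"
      using \<sigma> c n1 by (intro mult_mono) auto
    also have "\<dots> = c * m"
    proof -
      have "(2 * real m + 1) * ln 4 \<noteq> 0" by (simp add: add_nonneg_eq_0_iff)
      then show ?thesis by simp
    qed
    finally have "exp (- (2 * c * m)) \<le> exp (- 2 * \<sigma> * ln (real n))" by simp
    also have "\<dots> = (real n powr - \<sigma>)\<^sup>2"
      using n1 by (simp add: powr_def power2_eq_square exp_add[symmetric])
    finally have "\<beta> ^ (2 * m) * exp (- 2 * c * m) \<le> \<beta> ^ (2 * m) * (real n powr - \<sigma>)\<^sup>2"
      using \<beta> by (intro mult_left_mono) auto
    also have "\<beta> ^ (2 * m) = (\<beta> ^ m)\<^sup>2" by (rule power_even_eq)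
    also have "(\<beta> ^ m)\<^sup>2 * (real n powr - \<sigma>)\<^sup>2 = (norm (pair_series \<beta> n * bergman_basis n (\<sigma>, z)))\<^sup>2"
      using \<beta> z by (simp add: norm_mult pair_series_eq[OF n] bergman_basis_def norm_bohr_monomial
          power_mult_distrib norm_power)
    finally show ?thesis unfolding power_even_eq .
  qed
  have "(2 * \<beta>\<^sup>2 * exp (- 2 * c)) ^ m = (\<Sum>n\<in>pair_products m. \<beta> ^ (2 * m) * exp (- 2 * c * m))"
    unfolding power_mult[of \<beta> 2 m]
    by (simp add: card_pair_products power_mult_distrib exp_of_nat_mult[symmetric] mult_ac)
  also have "\<dots> \<le> (\<Sum>n\<in>pair_products m. (norm (pair_series \<beta> n * bergman_basis n (\<sigma>, z)))\<^sup>2)"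
    by (intro sum_mono summand)
  also have "\<dots> \<le> (\<Sum>n\<in>weight_level (pair_weight m). (norm (pair_series \<beta> n * bergman_basis n (\<sigma>, z)))\<^sup>2)"
    by (intro sum_mono2 finite_weight_level)
      (auto simp: weight_level_def weight_pair_products pair_products_ge_1[unfolded One_nat_def])
  finally show ?thesis .
qed

lemma pair_weight_le: "real (pair_weight m + 1) \<le> (real m + 1)\<^sup>2"
proof -
  have "pair_weight m \<le> m * m"
    unfolding pair_weight_def using sum_bounded_above[of "{..<m}" "\<lambda>i. i + 1" m] by simp
  then have "pair_weight m + 1 \<le> (m + 1)\<^sup>2" by (simp add: power2_eq_square)
  then have "real (pair_weight m + 1) \<le> real ((m + 1)\<^sup>2)" by (rule of_nat_mono)
  then show ?thesis by (simp add: add.commute)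
qed

lemma pair_series_random_not_bergman:
  assumes M: "subgaussian_sequence M X" and \<alpha>: "\<alpha> > -1" and q: "0 < q"
    and \<beta>: "0 < \<beta>" "1 < 2 * \<beta>\<^sup>2"
  shows "\<not> (AE \<omega> in M. randomize X \<omega> (pair_series \<beta>) \<in> bergman_space q \<alpha>)"
proof
  assume "AE \<omega> in M. randomize X \<omega> (pair_series \<beta>) \<in> bergman_space q \<alpha>"
  then obtain B :: real where B: "\<And>m. (\<integral>\<^sup>+x. ennreal ((\<Sum>n\<in>weight_level m. (norm (pair_series \<beta> n
    * bergman_basis n x))\<^sup>2) powr (q / 2)) \<partial>bergman_product \<alpha>)
      \<le> ennreal (real (m + 1) * B)"
    using random_bergman_imp_square_function_bounded[OF M \<alpha> q] by blast
  interpret T: prob_space torus_measure by (rule prob_space_torus)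
  have UNIV_torus: "UNIV \<in> sets torus_measure" using sets.top[of torus_measure] by simp
  obtain k where k: "k > 0"
    "\<And>\<delta>. 0 < \<delta> \<Longrightarrow> \<delta> \<le> 1 \<Longrightarrow> ennreal (k * \<delta> powr (\<bar>\<alpha>\<bar> + 1)) \<le> emeasure (bergman_measure \<alpha>) {0<..\<delta>}"
    using bergman_measure_near_0[OF \<alpha>] by blast
  \<comment> \<open>The factor \<open>exp (- 2 * c)\<close> lost by the translation must not consume
    the gain, so \<open>2 * c\<close> is at most half of \<open>ln (2 * \<beta>\<^sup>2)\<close>.
    The minimum with 1 keeps \<open>\<delta> m \<le> 1\<close>.\<close>
  define c where "c = min 1 (ln (2 * \<beta>\<^sup>2) / 4)"
  have ln_pos: "ln (2 * \<beta>\<^sup>2) > 0" using \<beta>(2) by (rule ln_gt_zero)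
  have c: "0 < c" "c \<le> 1" using ln_pos by (auto simp: c_def)
  define \<gamma> where "\<gamma> = 2 * \<beta>\<^sup>2 * exp (- 2 * c)"
  have "2 * c < ln (2 * \<beta>\<^sup>2)" using ln_pos by (auto simp: c_def min_def)
  then have "exp (2 * c) < exp (ln (2 * \<beta>\<^sup>2))" by simp
  then have \<gamma>: "\<gamma> > 1" using \<beta> by (simp add: \<gamma>_def exp_minus field_simps)
  define g where "g = \<gamma> powr (q / 2)"
  have g: "g > 1" using \<gamma> q powr_less_mono2[of "q / 2" 1 \<gamma>] by (simp add: g_def)
  define \<delta> where "\<delta> m = c / ((2 * real m + 1) * ln 4)" for m
  have ln4: "ln 4 \<ge> (1 :: real)"
    using exp_le by (subst ln_ge_iff) auto
  have \<delta>: "0 < \<delta> m" "\<delta> m \<le> 1" for m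
  proof -
    have "1 * 1 \<le> (2 * real m + 1) * ln 4" using ln4 by (intro mult_mono) auto
    then show "0 < \<delta> m" "\<delta> m \<le> 1" using c by (auto simp: \<delta>_def divide_le_eq)
  qed
  \<comment> \<open>The square function is bounded below only on the part
    \<open>{0<..\<delta> m}\<close> of the translations. The resulting left side is exponential in
    \<open>m\<close> up to a power of \<open>\<delta> m\<close>, the right side polynomial.\<close>
  have main: "k * g ^ m * \<delta> m powr (\<bar>\<alpha>\<bar> + 1) \<le> (real m + 1)\<^sup>2 * max B 0" for m
  proof -
    let ?f = "\<lambda>x. (\<Sum>n\<in>weight_level (pair_weight m). (norm (pair_series \<beta> n
      * bergman_basis n x))\<^sup>2) powr (q / 2)"
    have "ennreal (g ^ m) * ennreal (k * \<delta> m powr (\<bar>\<alpha>\<bar> + 1))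
      \<le> ennreal (g ^ m) * emeasure (bergman_product \<alpha>) ({0<..\<delta> m} \<times> UNIV)"
      using k(2)[OF \<delta>, of m] T.emeasure_space_1
      by (subst T.emeasure_pair_measure_Times) (auto intro!: mult_left_mono UNIV_torus)
    also have "\<dots> = (\<integral>\<^sup>+x. ennreal (g ^ m) * indicator ({0<..\<delta> m} \<times> UNIV) x \<partial>bergman_product \<alpha>)"
      by (rule nn_integral_cmult_indicator[symmetric])
        (intro pair_measureI UNIV_torus, simp)
    also have "\<dots> \<le> (\<integral>\<^sup>+x. ennreal (?f x) \<partial>bergman_product \<alpha>)"
    proof (rule nn_integral_mono_AE, use AE_bergman_product[OF \<alpha>] in eventually_elim)
      case (elim x)
      show ?case
      proof (cases "fst x \<le> \<delta> m")
        case True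
        have "\<gamma> ^ m \<le> (\<Sum>n\<in>weight_level (pair_weight m). (norm (pair_series \<beta> n
          * bergman_basis n (fst x, snd x)))\<^sup>2)"
          unfolding \<gamma>_def using elim True by (intro pair_series_square_function \<beta> c) (auto simp: \<delta>_def)
        then have "(\<gamma> ^ m) powr (q / 2) \<le> ?f x"
          using \<gamma> q by (intro powr_mono2) auto
        moreover have "(\<gamma> ^ m) powr (q / 2) = g ^ m"
          using \<gamma> by (simp add: g_def powr_power powr_realpow[symmetric] powr_powr mult.commute)
        ultimately show ?thesis by (auto simp: indicator_def ennreal_leI)
      qed (auto simp: indicator_def)
    qed
    also have "\<dots> \<le> ennreal (real (pair_weight m + 1) * B)" by (rule B)
    also have "\<dots> \<le> ennreal ((real m + 1)\<^sup>2 * max B 0)"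
      by (intro ennreal_leI order_trans[OF mult_left_mono mult_right_mono[OF pair_weight_le]]) auto
    finally show ?thesis
      using k g by (simp add: ennreal_mult[symmetric] mult_ac)
  qed
  have "filterlim (\<lambda>m::nat. k * g ^ m * (c / ((2 * real m + 1) * ln 4)) powr (\<bar>\<alpha>\<bar> + 1) / (real m
    + 1)\<^sup>2) at_top at_top"
  proof -
    \<comment> \<open>Exponential growth beats every power of \<open>m\<close>; the values
      \<open>ln 4\<close> and \<open>\<bar>\<alpha>\<bar> + 1\<close> enter only as positive numbers
      \<open>L\<close> and \<open>A\<close>.\<close>
    have "filterlim (\<lambda>m::nat. k * g ^ m * (c / ((2 * real m + 1) * L)) powr A / (real m + 1)\<^sup>2) at_top at_top"
      if "L > 0" "A > 0" for L A :: real
      using g c(1) k(1) that by real_asymp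
    then show ?thesis by simp
  qed
  then have "\<forall>\<^sub>F m in sequentially. k * g ^ m * \<delta> m powr (\<bar>\<alpha>\<bar> + 1) / (real m + 1)\<^sup>2 > max B 0"
    unfolding filterlim_at_top_dense \<delta>_def by blast
  then obtain m where "k * g ^ m * \<delta> m powr (\<bar>\<alpha>\<bar> + 1) / (real m + 1)\<^sup>2 > max B 0"
    by (auto simp: eventually_sequentially)
  then have "max B 0 * (real m + 1)\<^sup>2 < k * g ^ m * \<delta> m powr (\<bar>\<alpha>\<bar> + 1)"
    by (subst (asm) less_divide_eq) (auto simp: add_nonneg_eq_0_iff)
  with main[of m] show False by (simp add: mult.commute)
qed

theorem theorem1p4:
  fixes p q \<alpha> :: real and M :: "'w measure" and X :: "nat \<Rightarrow> 'w \<Rightarrow> complex"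
  assumes "0 < p" and "0 < q" and "\<alpha> > -1"
    and "standard_random_sequence M X"
  shows "(\<forall>f\<in>hardy_space p. AE \<omega> in M. randomize X \<omega> f \<in> bergman_space q \<alpha>) \<longleftrightarrow> p \<ge> 2"
proof
  note M = subgaussian_sequence[OF assms(4)]
  assume *: "\<forall>f\<in>hardy_space p. AE \<omega> in M. randomize X \<omega> f \<in> bergman_space q \<alpha>"
  show "p \<ge> 2"
  proof (rule ccontr)
    assume "\<not> p \<ge> 2"
    then have lt: "pair_moment p < ennreal (2 powr (p / 2))"
      using pair_moment_less[OF assms(1)] by simp
    then obtain a where a: "pair_moment p = ennreal a" "0 \<le> a" by (cases "pair_moment p") auto
    with lt have "a < 2 powr (p / 2)" by (simp add: ennreal_less_iff)
    then obtain b where b: "a < b" "b < 2 powr (p / 2)" using dense by blast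
    have b0: "b > 0" using a b by simp
    \<comment> \<open>Now \<open>\<beta> powr p = 1 / b\<close>, so \<open>a < b\<close> gives
      \<open>\<beta> powr p * a < 1\<close>, and \<open>b < 2 powr (p / 2)\<close> gives
      \<open>\<beta>\<^sup>2 = b powr (- 2 / p) > 1 / 2\<close>.\<close>
    define \<beta> where "\<beta> = b powr (- 1 / p)"
    have \<beta>: "\<beta> > 0" using b0 by (simp add: \<beta>_def)
    have "- 1 / p * p = - 1" using assms(1) by simp
    then have "\<beta> powr p = inverse b"
      unfolding \<beta>_def powr_powr using b0 by (simp add: powr_minus)
    have "inverse b * a < 1" using b b0 by (simp add: field_simps)
    \<comment> \<open>The maximum with 1/2 keeps \<open>r\<close> positive without a separate
      argument for \<open>a > 0\<close>.\<close>
    define r where "r = sqrt (max (inverse b * a) (1 / 2))"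
    have r: "0 < r" "r < 1" "r\<^sup>2 = max (inverse b * a) (1 / 2)"
      using \<open>inverse b * a < 1\<close> by (auto simp: r_def real_sqrt_lt_1_iff)
    have "ennreal (\<beta> powr p) * pair_moment p \<le> ennreal (r\<^sup>2)"
      using a b0 \<open>\<beta> powr p = inverse b\<close> by (simp add: ennreal_mult[symmetric] r(3) ennreal_leI)
    then have "pair_series \<beta> \<in> hardy_space p"
      by (rule pair_series_in_hardy_space[OF assms(1) \<beta> r(1,2)])
    moreover have "1 < 2 * \<beta>\<^sup>2"
    proof -
      have "b powr (2 / p) < (2 powr (p / 2)) powr (2 / p)"
        using assms(1) b b0 by (intro powr_less_mono2) auto
      then have "b powr (2 / p) < 2" using assms(1) by (simp add: powr_powr)
      then have "1 < 2 * inverse (b powr (2 / p))" using b0 by (simp add: field_simps)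
      also have "inverse (b powr (2 / p)) = \<beta>\<^sup>2"
        unfolding \<beta>_def power2_eq_square powr_add[symmetric] powr_minus[symmetric]
        by (simp add: add_divide_distrib[symmetric])
      finally show ?thesis .
    qed
    ultimately show False
      using * pair_series_random_not_bergman[OF M assms(3,2) \<beta>] by blast
  qed
next
  assume "p \<ge> 2"
  then show "\<forall>f\<in>hardy_space p. AE \<omega> in M. randomize X \<omega> f \<in> bergman_space q \<alpha>"
    using square_summable_imp_random_bergman[OF subgaussian_sequence[OF assms(4)] assms(3,2)]
      hardy_space_imp_square_summable by blast
qed

end
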